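(* An isoparametric hypersurface in $\mathbb{S}^{m+1}$ of degree $3$ is $c$-biharmonic if and only if it is minimal.
   Context: A hypersurface of the unit sphere $\mathbb{S}^{m+1}$ is isoparametric if it has constant principal curvatures; its degree $\ell$ is the number of distinct principal curvatures. Minimal means $\mathrm{Tr}A=0$, with $A$ the shape operator. Conventions: $R(X,Y)Z=[\nabla_X,\nabla_Y]Z-\nabla_{[X,Y]}Z$; $g(\mathrm{Ric}(X),Y)=\mathrm{Ric}(X,Y)=\mathrm{Tr}\{Z\mapsto R(Z,X)Y\}$; $\mathrm{Scal}=\mathrm{Tr}\,\mathrm{Ric}$; traces are taken with respect to the domain metric. $c$-biharmonic maps: for a smooth map $\phi:(M^m,g)\to(N^n,h)$ of Riemannian manifolds, let $\bar\nabla$ be the connection on $\phi^{-1}TN$, $\tau(\phi)=\mathrm{Tr}\,\bar\nabla d\phi$ the tension field, $\bar\Delta=-\mathrm{Tr}(\bar\nabla\bar\nabla-\bar\nabla_{\nabla})$ the rough Laplacian on $\phi^{-1}TN$, and $\tau_2(\phi)=-\bar\Delta\tau(\phi)-\mathrm{Tr}\,R^N(d\phi(\cdot),\tau(\phi))d\phi(\cdot)$ the bitension field. The map $\phi$ is $c$-biharmonic (conformal-biharmonic) if $$\tau_2^c(\phi):=\tau_2(\phi)-\tfrac23\,\mathrm{Scal}\,\tau(\phi)+2\,\mathrm{Tr}(\bar\nabla d\phi)(\mathrm{Ric}(\cdot),\cdot)+\tfrac13 d\phi(\nabla\mathrm{Scal})=0,$$ where $\mathrm{Scal}$ and $\mathrm{Ric}$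 are those of $(M,g)$. A $c$-biharmonic hypersurface is a codimension-one isometric immersion that is a $c$-biharmonic map. All hypersurfaces are oriented and without boundary. *)

theory Defs
  imports "HOL-Analysis.Analysis"
begin

section \<open>Smooth functions\<close>

text \<open>Used for open \<open>S\<close> only; \<open>C\<^sup>k\<close> in terms of iterated directional derivatives.\<close>

primrec Ck_on :: "nat \<Rightarrow> 'a::real_normed_vector set \<Rightarrow> ('a \<Rightarrow> 'b::real_normed_vector) \<Rightarrow> bool" where
  "Ck_on 0 S f \<longleftrightarrow> continuous_on S f"
| "Ck_on (Suc k) S f \<longleftrightarrow>
     f differentiable_on S \<and> (\<forall>v. Ck_on k S (\<lambda>x. frechet_derivative f (at x) v))"

definition smooth_on :: "'a::real_normed_vector set \<Rightarrow> ('a \<Rightarrow> 'b::real_normed_vector) \<Rightarrow> bool" where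
  "smooth_on S f \<longleftrightarrow> (\<forall>k. Ck_on k S f)"


section \<open>Riemannian manifolds\<close>

text \<open>A chart is given by its inverse: a pair of an open coordinate domain in \<open>\<real>\<^sup>m\<close> and a local
  parametrization of the manifold on it. The parametrization has no meaning outside the domain.\<close>

type_synonym ('p, 'm) chart = "(real^'m) set \<times> (real^'m \<Rightarrow> 'p)"

abbreviation cdom :: "('p, 'm::finite) chart \<Rightarrow> (real^'m) set" where "cdom c \<equiv> fst c"
abbreviation param :: "('p, 'm::finite) chart \<Rightarrow> real^'m \<Rightarrow> 'p" where "param c \<equiv> snd c"
abbreviation cimage :: "('p, 'm::finite) chart \<Rightarrow> 'p set" where "cimage c \<equiv> param c ` cdom c"

definition coord :: "('p, 'm::finite) chart \<Rightarrow> 'p \<Rightarrow> real^'m" where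
  "coord c = inv_into (cdom c) (param c)"

text \<open>The expression of a map \<open>\<phi>\<close> in the charts \<open>c\<close> and \<open>d\<close>, and its (open) domain.\<close>

definition local_rep ::
  "('p, 'm::finite) chart \<Rightarrow> ('q, 'n::finite) chart \<Rightarrow> ('p \<Rightarrow> 'q) \<Rightarrow> real^'m \<Rightarrow> real^'n" where
  "local_rep c d \<phi> = coord d \<circ> \<phi> \<circ> param c"

definition local_dom ::
  "('p, 'm::finite) chart \<Rightarrow> ('q, 'n::finite) chart \<Rightarrow> ('p \<Rightarrow> 'q) \<Rightarrow> (real^'m) set" where
  "local_dom c d \<phi> = {x \<in> cdom c. \<phi> (param c x) \<in> cimage d}"

text \<open>The metric is stored through its coefficient matrices \<open>(g\<^sub>i\<^sub>j)\<close> in every chart of the atlas.\<close>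

record ('p, 'm::finite) riem =
  mtop :: "'p topology"
  atlas :: "('p, 'm) chart set"
  mcoeff :: "('p, 'm) chart \<Rightarrow> real^'m \<Rightarrow> real^'m^'m"

definition pullback_metric ::
  "(real^'m::finite \<Rightarrow> real^'n::finite) \<Rightarrow> (real^'n \<Rightarrow> real^'n^'n) \<Rightarrow> real^'m \<Rightarrow> real^'m^'m" where
  "pullback_metric f H x =
     transpose (jacobian f (at x)) ** H (f x) ** jacobian f (at x)"

definition riemannian_manifold :: "('p, 'm::finite) riem \<Rightarrow> bool" where
  "riemannian_manifold M \<longleftrightarrow>
     Hausdorff_space (mtop M) \<and> second_countable (mtop M) \<and>
     (\<Union>c\<in>atlas M. cimage c) = topspace (mtop M) \<and>
     (\<forall>c\<in>atlas M. open (cdom c) \<and> openin (mtop M) (cimage c) \<and>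
        homeomorphic_map (top_of_set (cdom c)) (subtopology (mtop M) (cimage c)) (param c)) \<and>
     (\<forall>c\<in>atlas M. \<forall>d\<in>atlas M. smooth_on (local_dom c d id) (local_rep c d id)) \<and>
     (\<forall>c\<in>atlas M. smooth_on (cdom c) (mcoeff M c) \<and>
        (\<forall>x\<in>cdom c. transpose (mcoeff M c x) = mcoeff M c x \<and>
           (\<forall>u. u \<noteq> 0 \<longrightarrow> u \<bullet> (mcoeff M c x *v u) > 0))) \<and>
     (\<forall>c\<in>atlas M. \<forall>d\<in>atlas M. \<forall>x\<in>local_dom c d id.
        mcoeff M c x = pullback_metric (local_rep c d id) (mcoeff M d) x)"

definition smooth_map ::
  "('p, 'm::finite) riem \<Rightarrow> ('q, 'n::finite) riem \<Rightarrow> ('p \<Rightarrow> 'q) \<Rightarrow> bool" where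
  "smooth_map M N \<phi> \<longleftrightarrow>
     continuous_map (mtop M) (mtop N) \<phi> \<and>
     (\<forall>c\<in>atlas M. \<forall>d\<in>atlas N. smooth_on (local_dom c d \<phi>) (local_rep c d \<phi>))"

text \<open>The Euclidean unit sphere: all smooth local parametrizations, with the metric induced from
  the ambient space. It is a manifold modelled on \<open>\<real>\<^sup>n\<close> when the ambient dimension is \<open>n + 1\<close>.\<close>

definition round_sphere :: "('a::euclidean_space, 'n::finite) riem" where
  "round_sphere =
     \<lparr> mtop = top_of_set (sphere 0 1),
       atlas = {(U, \<psi>). open U \<and> openin (top_of_set (sphere 0 1)) (\<psi> ` U) \<and>
                  homeomorphism U (\<psi> ` U) \<psi> (inv_into U \<psi>) \<and> smooth_on U \<psi> \<and>
                  (\<forall>x\<in>U. inj (frechet_derivative \<psi> (at x)))},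
       mcoeff = (\<lambda>(U, \<psi>) x. \<chi> i j.
                  frechet_derivative \<psi> (at x) (axis i 1) \<bullet> frechet_derivative \<psi> (at x) (axis j 1)) \<rparr>"


section \<open>Riemannian geometry in a coordinate domain\<close>

text \<open>\<open>G\<close> and \<open>H\<close> are the coefficient matrices of the metrics of domain and target. Vector fields
  are given by their components. Tensors at a point are obtained by inserting the
  constant-coefficient fields that extend the given vectors.\<close>

definition christoffel ::
  "(real^'m::finite \<Rightarrow> real^'m^'m) \<Rightarrow> 'm \<Rightarrow> 'm \<Rightarrow> 'm \<Rightarrow> real^'m \<Rightarrow> real" where
  "christoffel G k i j x =
     (\<Sum>l\<in>UNIV. matrix_inv (G x) $ k $ l *
        (frechet_derivative (\<lambda>y. G y $ j $ l) (at x) (axis i 1)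
       + frechet_derivative (\<lambda>y. G y $ i $ l) (at x) (axis j 1)
       - frechet_derivative (\<lambda>y. G y $ i $ j) (at x) (axis l 1))) / 2"

definition christoffel_map ::
  "(real^'m::finite \<Rightarrow> real^'m^'m) \<Rightarrow> real^'m \<Rightarrow> real^'m \<Rightarrow> real^'m \<Rightarrow> real^'m" where
  "christoffel_map G x u v = (\<chi> k. \<Sum>i\<in>UNIV. \<Sum>j\<in>UNIV. christoffel G k i j x * u $ i * v $ j)"

text \<open>The Levi-Civita connection \<open>\<nabla>\<^sub>X Y\<close>.\<close>

definition cov_deriv ::
  "(real^'m::finite \<Rightarrow> real^'m^'m) \<Rightarrow> (real^'m \<Rightarrow> real^'m) \<Rightarrow> (real^'m \<Rightarrow> real^'m) \<Rightarrow> real^'m \<Rightarrow> real^'m"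
  where
  "cov_deriv G X Y x = frechet_derivative Y (at x) (X x) + christoffel_map G x (X x) (Y x)"

definition lie_bracket ::
  "(real^'m::finite \<Rightarrow> real^'m) \<Rightarrow> (real^'m \<Rightarrow> real^'m) \<Rightarrow> real^'m \<Rightarrow> real^'m" where
  "lie_bracket X Y x = frechet_derivative Y (at x) (X x) - frechet_derivative X (at x) (Y x)"

definition curvature_fields ::
  "(real^'m::finite \<Rightarrow> real^'m^'m) \<Rightarrow> (real^'m \<Rightarrow> real^'m) \<Rightarrow> (real^'m \<Rightarrow> real^'m) \<Rightarrow>
     (real^'m \<Rightarrow> real^'m) \<Rightarrow> real^'m \<Rightarrow> real^'m" where
  "curvature_fields G X Y Z x =
     cov_deriv G X (cov_deriv G Y Z) x - cov_deriv G Y (cov_deriv G X Z) x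
     - cov_deriv G (lie_bracket X Y) Z x"

definition curvature ::
  "(real^'m::finite \<Rightarrow> real^'m^'m) \<Rightarrow> real^'m \<Rightarrow> real^'m \<Rightarrow> real^'m \<Rightarrow> real^'m \<Rightarrow> real^'m" where
  "curvature G x u v w = curvature_fields G (\<lambda>_. u) (\<lambda>_. v) (\<lambda>_. w) x"

definition ricci :: "(real^'m::finite \<Rightarrow> real^'m^'m) \<Rightarrow> real^'m \<Rightarrow> real^'m \<Rightarrow> real^'m \<Rightarrow> real" where
  "ricci G x u v = trace (matrix (\<lambda>w. curvature G x w u v))"

text \<open>The vector representing a linear form with respect to the metric.\<close>

definition sharp :: "(real^'m::finite \<Rightarrow> real^'m^'m) \<Rightarrow> real^'m \<Rightarrow> (real^'m \<Rightarrow> real) \<Rightarrow> real^'m" where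
  "sharp G x \<alpha> = matrix_inv (G x) *v (\<chi> i. \<alpha> (axis i 1))"

definition ricci_op :: "(real^'m::finite \<Rightarrow> real^'m^'m) \<Rightarrow> real^'m \<Rightarrow> real^'m \<Rightarrow> real^'m" where
  "ricci_op G x u = sharp G x (ricci G x u)"

definition scal :: "(real^'m::finite \<Rightarrow> real^'m^'m) \<Rightarrow> real^'m \<Rightarrow> real" where
  "scal G x = trace (matrix (ricci_op G x))"

definition grad :: "(real^'m::finite \<Rightarrow> real^'m^'m) \<Rightarrow> (real^'m \<Rightarrow> real) \<Rightarrow> real^'m \<Rightarrow> real^'m" where
  "grad G s x = sharp G x (frechet_derivative s (at x))"

text \<open>The trace of a (vector-valued) bilinear form with respect to the metric.\<close>

definition metric_trace ::
  "(real^'m::finite \<Rightarrow> real^'m^'m) \<Rightarrow> real^'m \<Rightarrow> (real^'m \<Rightarrow> real^'m \<Rightarrow> 'v::real_vector) \<Rightarrow> 'v" where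
  "metric_trace G x b =
     (\<Sum>i\<in>UNIV. \<Sum>j\<in>UNIV. (matrix_inv (G x) $ i $ j) *\<^sub>R b (axis i 1) (axis j 1))"


section \<open>Maps in local coordinates\<close>

text \<open>The differential applied to a vector field, as a section along \<open>f\<close>.\<close>

definition dmap ::
  "(real^'m::finite \<Rightarrow> real^'n::finite) \<Rightarrow> (real^'m \<Rightarrow> real^'m) \<Rightarrow> real^'m \<Rightarrow> real^'n" where
  "dmap f X x = frechet_derivative f (at x) (X x)"

text \<open>The connection \<open>\<nabla>\<^sub>X V\<close> on the pull-back bundle, for a section \<open>V\<close> along \<open>f\<close>.\<close>

definition pull_cov ::
  "(real^'n::finite \<Rightarrow> real^'n^'n) \<Rightarrow> (real^'m::finite \<Rightarrow> real^'n) \<Rightarrow> (real^'m \<Rightarrow> real^'m) \<Rightarrow>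
     (real^'m \<Rightarrow> real^'n) \<Rightarrow> real^'m \<Rightarrow> real^'n" where
  "pull_cov H f X V x =
     frechet_derivative V (at x) (X x) + christoffel_map H (f x) (dmap f X x) (V x)"

text \<open>The second fundamental form \<open>(\<nabla>df)(u, v)\<close> of the map \<open>f\<close>.\<close>

definition second_fund ::
  "(real^'m::finite \<Rightarrow> real^'m^'m) \<Rightarrow> (real^'n::finite \<Rightarrow> real^'n^'n) \<Rightarrow> (real^'m \<Rightarrow> real^'n) \<Rightarrow>
     real^'m \<Rightarrow> real^'m \<Rightarrow> real^'m \<Rightarrow> real^'n" where
  "second_fund G H f x u v =
     pull_cov H f (\<lambda>_. u) (dmap f (\<lambda>_. v)) x - dmap f (cov_deriv G (\<lambda>_. u) (\<lambda>_. v)) x"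

definition tension ::
  "(real^'m::finite \<Rightarrow> real^'m^'m) \<Rightarrow> (real^'n::finite \<Rightarrow> real^'n^'n) \<Rightarrow> (real^'m \<Rightarrow> real^'n) \<Rightarrow>
     real^'m \<Rightarrow> real^'n" where
  "tension G H f x = metric_trace G x (second_fund G H f x)"

definition rough_laplacian ::
  "(real^'m::finite \<Rightarrow> real^'m^'m) \<Rightarrow> (real^'n::finite \<Rightarrow> real^'n^'n) \<Rightarrow> (real^'m \<Rightarrow> real^'n) \<Rightarrow>
     (real^'m \<Rightarrow> real^'n) \<Rightarrow> real^'m \<Rightarrow> real^'n" where
  "rough_laplacian G H f V x =
     - metric_trace G x (\<lambda>u v.
         pull_cov H f (\<lambda>_. u) (pull_cov H f (\<lambda>_. v) V) x
         - pull_cov H f (cov_deriv G (\<lambda>_. u) (\<lambda>_. v)) V x)"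

definition bitension ::
  "(real^'m::finite \<Rightarrow> real^'m^'m) \<Rightarrow> (real^'n::finite \<Rightarrow> real^'n^'n) \<Rightarrow> (real^'m \<Rightarrow> real^'n) \<Rightarrow>
     real^'m \<Rightarrow> real^'n" where
  "bitension G H f x =
     - rough_laplacian G H f (tension G H f) x
     - metric_trace G x (\<lambda>u v.
         curvature H (f x) (dmap f (\<lambda>_. u) x) (tension G H f x) (dmap f (\<lambda>_. v) x))"

definition c_bitension ::
  "(real^'m::finite \<Rightarrow> real^'m^'m) \<Rightarrow> (real^'n::finite \<Rightarrow> real^'n^'n) \<Rightarrow> (real^'m \<Rightarrow> real^'n) \<Rightarrow>
     real^'m \<Rightarrow> real^'n" where
  "c_bitension G H f x =
     bitension G H f x
     - ((2/3) * scal G x) *\<^sub>R tension G H f x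
     + 2 *\<^sub>R metric_trace G x (\<lambda>u v. second_fund G H f x (ricci_op G x u) v)
     + (1/3) *\<^sub>R dmap f (grad G (scal G)) x"

definition c_biharmonic ::
  "('p, 'm::finite) riem \<Rightarrow> ('q, 'n::finite) riem \<Rightarrow> ('p \<Rightarrow> 'q) \<Rightarrow> bool" where
  "c_biharmonic M N \<phi> \<longleftrightarrow>
     smooth_map M N \<phi> \<and>
     (\<forall>c\<in>atlas M. \<forall>d\<in>atlas N. \<forall>x\<in>local_dom c d \<phi>.
        c_bitension (mcoeff M c) (mcoeff N d) (local_rep c d \<phi>) x = 0)"


section \<open>Oriented hypersurfaces\<close>

definition isometric_immersion ::
  "('p, 'm::finite) riem \<Rightarrow> ('q, 'n::finite) riem \<Rightarrow> ('p \<Rightarrow> 'q) \<Rightarrow> bool" where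
  "isometric_immersion M N \<phi> \<longleftrightarrow>
     smooth_map M N \<phi> \<and>
     (\<forall>c\<in>atlas M. \<forall>d\<in>atlas N. \<forall>x\<in>local_dom c d \<phi>.
        mcoeff M c x = pullback_metric (local_rep c d \<phi>) (mcoeff N d) x)"

text \<open>A section of \<open>\<phi>\<^sup>-\<^sup>1TN\<close>: \<open>\<xi> d p\<close> are the components, in the chart \<open>d\<close> of \<open>N\<close>, of a vector
  tangent to \<open>N\<close> at \<open>\<phi> p\<close>.\<close>

definition smooth_section_along ::
  "('p, 'm::finite) riem \<Rightarrow> ('q, 'n::finite) riem \<Rightarrow> ('p \<Rightarrow> 'q) \<Rightarrow>
     (('q, 'n) chart \<Rightarrow> 'p \<Rightarrow> real^'n) \<Rightarrow> bool" where
  "smooth_section_along M N \<phi> \<xi> \<longleftrightarrow>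
     (\<forall>d\<in>atlas N. \<forall>d'\<in>atlas N. \<forall>p\<in>topspace (mtop M).
        \<phi> p \<in> cimage d \<inter> cimage d' \<longrightarrow>
        \<xi> d' p = frechet_derivative (local_rep d d' id) (at (coord d (\<phi> p))) (\<xi> d p)) \<and>
     (\<forall>c\<in>atlas M. \<forall>d\<in>atlas N. smooth_on (local_dom c d \<phi>) (\<xi> d \<circ> param c))"

text \<open>The orientation is recorded by the choice of a global smooth unit normal field \<open>\<xi>\<close>.\<close>

definition oriented_hypersurface ::
  "('p, 'm::finite) riem \<Rightarrow> ('q, 'n::finite) riem \<Rightarrow> ('p \<Rightarrow> 'q) \<Rightarrow>
     (('q, 'n) chart \<Rightarrow> 'p \<Rightarrow> real^'n) \<Rightarrow> bool" where
  "oriented_hypersurface M N \<phi> \<xi> \<longleftrightarrow>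
     CARD('n) = CARD('m) + 1 \<and>
     riemannian_manifold M \<and>
     isometric_immersion M N \<phi> \<and>
     smooth_section_along M N \<phi> \<xi> \<and>
     (\<forall>c\<in>atlas M. \<forall>d\<in>atlas N. \<forall>x\<in>local_dom c d \<phi>.
        let n = \<xi> d (param c x); y = local_rep c d \<phi> x in
        n \<bullet> (mcoeff N d y *v n) = 1 \<and>
        (\<forall>u. n \<bullet> (mcoeff N d y *v frechet_derivative (local_rep c d \<phi>) (at x) u) = 0))"

text \<open>The shape operator at the point \<open>param c x\<close>, in the coordinates of \<open>c\<close>: the Weingarten
  equation \<open>d\<phi>(A u) = - \<nabla>\<^sub>u \<xi>\<close>, solved for \<open>A u\<close> in the form
  \<open>g(A u, v) = - h(\<nabla>\<^sub>u \<xi>, d\<phi>(v))\<close> for all \<open>v\<close>.\<close>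

definition shape_operator ::
  "('p, 'm::finite) riem \<Rightarrow> ('q, 'n::finite) riem \<Rightarrow> ('p \<Rightarrow> 'q) \<Rightarrow>
     (('q, 'n) chart \<Rightarrow> 'p \<Rightarrow> real^'n) \<Rightarrow> ('p, 'm) chart \<Rightarrow> ('q, 'n) chart \<Rightarrow>
     real^'m \<Rightarrow> real^'m \<Rightarrow> real^'m" where
  "shape_operator M N \<phi> \<xi> c d x u =
     (let f = local_rep c d \<phi> in
      sharp (mcoeff M c) x (\<lambda>v.
        - (pull_cov (mcoeff N d) f (\<lambda>_. u) (\<xi> d \<circ> param c) x
             \<bullet> (mcoeff N d (f x) *v frechet_derivative f (at x) v))))"

definition minimal_hypersurface ::
  "('p, 'm::finite) riem \<Rightarrow> ('q, 'n::finite) riem \<Rightarrow> ('p \<Rightarrow> 'q) \<Rightarrow>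
     (('q, 'n) chart \<Rightarrow> 'p \<Rightarrow> real^'n) \<Rightarrow> bool" where
  "minimal_hypersurface M N \<phi> \<xi> \<longleftrightarrow>
     (\<forall>c\<in>atlas M. \<forall>d\<in>atlas N. \<forall>x\<in>local_dom c d \<phi>.
        trace (matrix (shape_operator M N \<phi> \<xi> c d x)) = 0)"

text \<open>The multiplicity of \<open>\<kappa>\<close> as a principal curvature, which is 0 if it is not one.\<close>

definition principal_multiplicity ::
  "('p, 'm::finite) riem \<Rightarrow> ('q, 'n::finite) riem \<Rightarrow> ('p \<Rightarrow> 'q) \<Rightarrow>
     (('q, 'n) chart \<Rightarrow> 'p \<Rightarrow> real^'n) \<Rightarrow> ('p, 'm) chart \<Rightarrow> ('q, 'n) chart \<Rightarrow>
     real^'m \<Rightarrow> real \<Rightarrow> nat" where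
  "principal_multiplicity M N \<phi> \<xi> c d x \<kappa> = dim {u. shape_operator M N \<phi> \<xi> c d x u = \<kappa> *\<^sub>R u}"

text \<open>The principal curvatures, counted with multiplicity, are the same at all points.\<close>

definition isoparametric ::
  "('p, 'm::finite) riem \<Rightarrow> ('q, 'n::finite) riem \<Rightarrow> ('p \<Rightarrow> 'q) \<Rightarrow>
     (('q, 'n) chart \<Rightarrow> 'p \<Rightarrow> real^'n) \<Rightarrow> bool" where
  "isoparametric M N \<phi> \<xi> \<longleftrightarrow>
     (\<exists>\<mu>. \<forall>c\<in>atlas M. \<forall>d\<in>atlas N. \<forall>x\<in>local_dom c d \<phi>.
        principal_multiplicity M N \<phi> \<xi> c d x = \<mu>)"

definition principal_curvatures ::
  "('p, 'm::finite) riem \<Rightarrow> ('q, 'n::finite) riem \<Rightarrow> ('p \<Rightarrow> 'q) \<Rightarrow>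
     (('q, 'n) chart \<Rightarrow> 'p \<Rightarrow> real^'n) \<Rightarrow> real set" where
  "principal_curvatures M N \<phi> \<xi> =
     {\<kappa>. \<exists>c\<in>atlas M. \<exists>d\<in>atlas N. \<exists>x\<in>local_dom c d \<phi>. \<exists>u. u \<noteq> 0 \<and>
          shape_operator M N \<phi> \<xi> c d x u = \<kappa> *\<^sub>R u}"

text \<open>Meaningful for isoparametric hypersurfaces, where the set of principal curvatures is the
  same at every point.\<close>

definition isoparametric_degree ::
  "('p, 'm::finite) riem \<Rightarrow> ('q, 'n::finite) riem \<Rightarrow> ('p \<Rightarrow> 'q) \<Rightarrow>
     (('q, 'n) chart \<Rightarrow> 'p \<Rightarrow> real^'n) \<Rightarrow> nat" where
  "isoparametric_degree M N \<phi> \<xi> = card (principal_curvatures M N \<phi> \<xi>)"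

end

theory Submission
  imports Defs
begin

text \<open>For a hypersurface of the sphere with constant principal curvatures, the \<open>c\<close>-bitension field is
  a constant multiple of the unit normal, the factor being a polynomial in \<open>m\<close> and the traces of the
  first three powers of the shape operator. In degree 3, the Codazzi and Gauss equations give
  Cartan's theorem: for orthogonal principal vectors \<open>U\<close>, \<open>V\<close> with curvatures \<open>a\<close>, \<open>b\<close>, the vector
  \<open>(\<nabla>\<^sub>U A)V\<close> is a principal vector for the third curvature \<open>c\<close>, and
  \<open>2|(\<nabla>\<^sub>U A)V|\<^sup>2 = (1 + ab)(a - c)(b - c)|U|\<^sup>2|V|\<^sup>2\<close>. As \<open>\<nabla>A\<close> is totally symmetric, this forces the three
  constants to agree and the multiplicities to be equal, say to \<open>k\<close>. Then \<open>ab + bc + ca = -3\<close> and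
  \<open>a + b + c = -3abc\<close>, and with \<open>e = a + b + c\<close> the factor becomes
  \<open>-ke((2k\<^sup>2 - 5k + 6)e\<^sup>2/3 + 3(2k - 3)(k - 2))\<close>, which vanishes for a positive integer \<open>k\<close> only if
  \<open>e = 0\<close>.\<close>

section \<open>Calculus of smooth functions\<close>

text \<open>Covariant calculus is traded for flat calculus in the Euclidean space of dimension m +
  2. As the metric of the sphere is induced, the immersion and its unit normal become ambient maps
  \<open>F\<close> and \<open>N\<close>, connections become projections of ordinary derivatives, and
  the shape operator becomes a function \<open>A\<close> with values in one fixed space of
  operators. The price is that \<open>A\<close>, extended by zero, has a nonzero derivative on the
  normals: \<open>-A U\<close> on \<open>F\<close> and \<open>A (A U)\<close> on \<open>N\<close>.
  These two terms are the source of the factor 1 + ab. Cartan's argument differentiates eigenvector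
  fields. Here they come from spectral projections, which up to a constant factor are polynomials in
  \<open>A\<close> and the tangent projection with constant coefficients, hence smooth without a
  choice of frame. The equivalence is pointwise: in each pair of charts the field vanishes at a
  point iff the trace of the shape operator does. Constancy of the multiplicities carries the three
  curvatures from the points where they are attained to every point.\<close>

lemma Ck_on_imp_differentiable:
  assumes "Ck_on (Suc k) S f" "open S" "x \<in> S"
  shows "f differentiable at x"
  using assms by (simp add: differentiable_on_eq_differentiable_at)

lemma smooth_on_differentiable:
  assumes "smooth_on S f" "open S" "x \<in> S"
  shows "f differentiable at x"
  using assms Ck_on_imp_differentiable[of 0 S f x] unfolding smooth_on_def by blast

lemma smooth_on_linear_derivative:
  assumes "smooth_on S f" "open S" "x \<in> S"
  shows "linear (frechet_derivative f (at x))"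
  using smooth_on_differentiable[OF assms] linear_frechet_derivative by blast

lemma smooth_on_frechet_derivative:
  assumes "smooth_on S f"
  shows "smooth_on S (\<lambda>x. frechet_derivative f (at x) v)"
  using assms unfolding smooth_on_def by (metis Ck_on.simps(2))

lemma smooth_on_continuous:
  assumes "smooth_on S f"
  shows "continuous_on S f"
  using assms unfolding smooth_on_def by (metis Ck_on.simps(1))

lemma Ck_on_cong:
  assumes "open S" "Ck_on k S f" "\<And>x. x \<in> S \<Longrightarrow> f x = g x"
  shows "Ck_on k S g"
  using assms(2,3)
proof (induction k arbitrary: f g)
  case 0
  then show ?case by (auto cong: continuous_on_cong)
next
  case (Suc k)
  have diff: "f differentiable at x" if "x \<in> S" for x
    using Ck_on_imp_differentiable[OF Suc.prems(1) \<open>open S\<close> that] .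
  have "g differentiable at x" if "x \<in> S" for x
    using diff[OF that] Suc.prems(2) \<open>open S\<close> that
    by (meson differentiable_def has_derivative_transform_within_open)
  moreover have "Ck_on k S (\<lambda>x. frechet_derivative g (at x) v)" for v
  proof (rule Suc.IH)
    show "Ck_on k S (\<lambda>x. frechet_derivative f (at x) v)" using Suc.prems by simp
    show "frechet_derivative f (at x) v = frechet_derivative g (at x) v" if "x \<in> S" for x
      using frechet_derivative_transform_within_open[OF diff[OF that] \<open>open S\<close> that Suc.prems(2)] by simp
  qed
  ultimately show ?case using \<open>open S\<close> by (simp add: differentiable_on_eq_differentiable_at)
qed

lemma Ck_on_Suc_imp: "Ck_on (Suc k) S f \<Longrightarrow> Ck_on k S f"
proof (induction k arbitrary: f)
  case 0
  then show ?case by (simp add: differentiable_imp_continuous_on)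
next
  case (Suc k)
  then show ?case by (metis Ck_on.simps(2))
qed

lemma Ck_on_const: "Ck_on k S (\<lambda>x. c)"
  by (induction k arbitrary: c) auto

text \<open>Lets any formula for the derivative stand in for \<open>frechet_derivative\<close>, so
  that each closure property below is a calculus rule followed by the induction hypothesis.\<close>

lemma Ck_on_SucI:
  assumes "open S" "\<And>x. x \<in> S \<Longrightarrow> (f has_derivative f' x) (at x)"
    and "\<And>v. Ck_on k S (\<lambda>x. f' x v)"
  shows "Ck_on (Suc k) S f"
proof -
  have eq: "f' x v = frechet_derivative f (at x) v" if "x \<in> S" for x v
    using frechet_derivative_at[OF assms(2)[OF that]] by simp
  have "Ck_on k S (\<lambda>x. frechet_derivative f (at x) v)" for v
    using Ck_on_cong[OF \<open>open S\<close> assms(3)[of v] eq] .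
  moreover have "f differentiable at x" if "x \<in> S" for x
    using assms(2)[OF that] by (rule differentiableI)
  ultimately show ?thesis
    using \<open>open S\<close> by (simp add: differentiable_on_eq_differentiable_at)
qed

lemma Ck_on_has_derivative:
  assumes "Ck_on (Suc k) S f" "open S" "x \<in> S"
  shows "(f has_derivative frechet_derivative f (at x)) (at x)"
  using Ck_on_imp_differentiable[OF assms] frechet_derivative_works by blast

lemma Ck_on_add:
  assumes "open S" "Ck_on k S f" "Ck_on k S g"
  shows "Ck_on k S (\<lambda>x. f x + g x)"
  using assms(2,3)
proof (induction k arbitrary: f g)
  case 0
  then show ?case by (auto intro: continuous_intros)
next
  case (Suc k)
  show ?case
  proof (rule Ck_on_SucI[OF \<open>open S\<close>])
    fix x assume "x \<in> S"
    show "((\<lambda>x. f x + g x) has_derivative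
        (\<lambda>v. frechet_derivative f (at x) v + frechet_derivative g (at x) v)) (at x)"
      by (rule has_derivative_add[OF Ck_on_has_derivative[OF Suc.prems(1) \<open>open S\<close> \<open>x \<in> S\<close>]
            Ck_on_has_derivative[OF Suc.prems(2) \<open>open S\<close> \<open>x \<in> S\<close>]])
  qed (use Suc in auto)
qed

lemma Ck_on_sum:
  assumes "open S" "\<And>i. i \<in> I \<Longrightarrow> Ck_on k S (f i)"
  shows "Ck_on k S (\<lambda>x. \<Sum>i\<in>I. f i x)"
  using assms(2)
  by (induction I rule: infinite_finite_induct) (auto intro: Ck_on_const Ck_on_add[OF \<open>open S\<close>])

lemma Ck_on_bilinear:
  assumes "bounded_bilinear h" "open S" "Ck_on k S f" "Ck_on k S g"
  shows "Ck_on k S (\<lambda>x. h (f x) (g x))"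
  using assms(3,4)
proof (induction k arbitrary: f g)
  case 0
  then show ?case by (simp add: bounded_bilinear.continuous_on[OF assms(1)])
next
  case (Suc k)
  show ?case
  proof (rule Ck_on_SucI[OF \<open>open S\<close>])
    fix x assume "x \<in> S"
    show "((\<lambda>x. h (f x) (g x)) has_derivative
        (\<lambda>v. h (f x) (frechet_derivative g (at x) v) + h (frechet_derivative f (at x) v) (g x))) (at x)"
      by (rule bounded_bilinear.FDERIV[OF assms(1)
            Ck_on_has_derivative[OF Suc.prems(1) \<open>open S\<close> \<open>x \<in> S\<close>]
            Ck_on_has_derivative[OF Suc.prems(2) \<open>open S\<close> \<open>x \<in> S\<close>]])
  next
    fix v
    show "Ck_on k S (\<lambda>x. h (f x) (frechet_derivative g (at x) v)
        + h (frechet_derivative f (at x) v) (g x))"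
      using Suc.prems Ck_on_Suc_imp[OF Suc.prems(1)] Ck_on_Suc_imp[OF Suc.prems(2)]
      by (intro Ck_on_add[OF \<open>open S\<close>] Suc.IH) auto
  qed
qed

text \<open>In the chain rule the point \<open>x\<close> enters both through the derivative of
  \<open>g\<close> at \<open>f x\<close> and through its argument. Expanding that argument in
  \<open>Basis\<close> turns the formula into a sum of products of functions of \<open>x\<close>, to
  which induction applies; hence the Euclidean type in the middle.\<close>

lemma Ck_on_compose:
  fixes f :: "'a::real_normed_vector \<Rightarrow> 'b::euclidean_space"
  assumes "open S" "open T" "f ` S \<subseteq> T" "Ck_on k T g" "Ck_on k S f"
  shows "Ck_on k S (\<lambda>x. g (f x))"
  using assms(4,5)
proof (induction k arbitrary: g)
  case 0
  then show ?case using continuous_on_compose2[OF _ _ \<open>f ` S \<subseteq> T\<close>] by auto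
next
  case (Suc k)
  have der: "(g has_derivative frechet_derivative g (at (f x))) (at (f x))" if "x \<in> S" for x
    using Ck_on_has_derivative[OF Suc.prems(1) \<open>open T\<close>] assms(3) that by auto
  show ?case
  proof (rule Ck_on_SucI[OF \<open>open S\<close>])
    fix x assume "x \<in> S"
    have "((\<lambda>x. g (f x)) has_derivative
        (\<lambda>v. frechet_derivative g (at (f x)) (frechet_derivative f (at x) v))) (at x)"
      using has_derivative_compose[OF Ck_on_has_derivative[OF Suc.prems(2) \<open>open S\<close> \<open>x \<in> S\<close>]
          der[OF \<open>x \<in> S\<close>]] .
    moreover have expand: "frechet_derivative g (at (f x)) w =
        (\<Sum>b\<in>Basis. (w \<bullet> b) *\<^sub>R frechet_derivative g (at (f x)) b)" for w
    proof -
      have lin: "linear (frechet_derivative g (at (f x)))"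
        using der[OF \<open>x \<in> S\<close>] has_derivative_linear by blast
      have "frechet_derivative g (at (f x)) w =
          frechet_derivative g (at (f x)) (\<Sum>b\<in>Basis. (w \<bullet> b) *\<^sub>R b)"
        by (simp add: euclidean_representation)
      then show ?thesis by (simp add: linear_sum[OF lin] linear_cmul[OF lin])
    qed
    have "(\<lambda>v. frechet_derivative g (at (f x)) (frechet_derivative f (at x) v)) =
        (\<lambda>v. \<Sum>b\<in>Basis. (frechet_derivative f (at x) v \<bullet> b) *\<^sub>R frechet_derivative g (at (f x)) b)"
      by (rule ext) (rule expand)
    ultimately show "((\<lambda>x. g (f x)) has_derivative
        (\<lambda>v. \<Sum>b\<in>Basis. (frechet_derivative f (at x) v \<bullet> b) *\<^sub>R frechet_derivative g (at (f x)) b)) (at x)"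
      by simp
  next
    fix v
    have "Ck_on k S f" using Suc.prems(2) Ck_on_Suc_imp by blast
    then have "Ck_on k S (\<lambda>x. frechet_derivative g (at (f x)) b)" for b
      using Suc.IH[of "\<lambda>y. frechet_derivative g (at y) b"] Suc.prems(1) by simp
    moreover have "Ck_on k S (\<lambda>x. frechet_derivative f (at x) v \<bullet> b)" for b
      using Suc.prems(2) by (intro Ck_on_bilinear[OF bounded_bilinear_inner \<open>open S\<close>] Ck_on_const) auto
    ultimately show "Ck_on k S (\<lambda>x. \<Sum>b\<in>Basis. (frechet_derivative f (at x) v \<bullet> b) *\<^sub>R
        frechet_derivative g (at (f x)) b)"
      by (intro Ck_on_sum[OF \<open>open S\<close>] Ck_on_bilinear[OF bounded_bilinear_scaleR \<open>open S\<close>])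
  qed
qed

lemma Ck_on_inverse: "Ck_on k (- {0}) (inverse :: real \<Rightarrow> real)"
proof (induction k)
  case 0
  then show ?case by (auto intro!: continuous_intros)
next
  case (Suc k)
  have op: "open (- {0::real})" by auto
  show ?case
  proof (rule Ck_on_SucI[OF op])
    fix x :: real assume "x \<in> - {0}"
    then show "(inverse has_derivative (\<lambda>v. - (inverse x * v * inverse x))) (at x)"
      using has_derivative_inverse'[of x UNIV] by simp
  next
    fix v :: real
    have "Ck_on k (- {0}) (\<lambda>x. (- v) * (inverse x * inverse x))"
      by (intro Ck_on_bilinear[OF bounded_bilinear_mult op] Suc Ck_on_const)
    then show "Ck_on k (- {0}) (\<lambda>x. - (inverse x * v * inverse x))"
      by (simp add: mult_ac)
  qed
qed

section \<open>Closure properties of smooth functions on an open set\<close>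

context
  fixes S :: "'s::real_normed_vector set"
  assumes S: "open S"
begin

lemma smooth_on_cong:
  "smooth_on S f \<Longrightarrow> (\<And>x. x \<in> S \<Longrightarrow> f x = g x) \<Longrightarrow> smooth_on S g"
  unfolding smooth_on_def using Ck_on_cong[OF S] by blast

lemma smooth_on_const: "smooth_on S (\<lambda>x. c)"
  unfolding smooth_on_def using Ck_on_const by blast

lemma smooth_on_ident: "smooth_on S (\<lambda>x. x)"
  unfolding smooth_on_def
proof
  fix k show "Ck_on k S (\<lambda>x. x)" by (cases k) (auto intro: Ck_on_const)
qed

lemma smooth_on_add: "smooth_on S f \<Longrightarrow> smooth_on S g \<Longrightarrow> smooth_on S (\<lambda>x. f x + g x)"
  unfolding smooth_on_def using Ck_on_add[OF S] by blast

lemma smooth_on_sum: "(\<And>i. i \<in> I \<Longrightarrow> smooth_on S (f i)) \<Longrightarrow> smooth_on S (\<lambda>x. \<Sum>i\<in>I. f i x)"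
  unfolding smooth_on_def by (blast intro: Ck_on_sum[OF S])

lemma smooth_on_bilinear:
  "bounded_bilinear h \<Longrightarrow> smooth_on S f \<Longrightarrow> smooth_on S g \<Longrightarrow> smooth_on S (\<lambda>x. h (f x) (g x))"
  unfolding smooth_on_def using Ck_on_bilinear[OF _ S] by blast

lemmas smooth_on_inner = smooth_on_bilinear[OF bounded_bilinear_inner]
lemmas smooth_on_scaleR = smooth_on_bilinear[OF bounded_bilinear_scaleR]
lemmas smooth_on_mult = smooth_on_bilinear[OF bounded_bilinear_mult]
lemmas smooth_on_blinfun_apply = smooth_on_bilinear[OF bounded_bilinear_blinfun_apply]
lemmas smooth_on_blinfun_compose = smooth_on_bilinear[OF bounded_bilinear_blinfun_compose]

lemma smooth_on_bounded_linear:
  assumes "bounded_linear L" "smooth_on S f"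
  shows "smooth_on S (\<lambda>x. L (f x))"
proof -
  have "smooth_on S (\<lambda>x. blinfun_apply (Blinfun L) (f x))"
    by (intro smooth_on_blinfun_apply smooth_on_const assms)
  then show ?thesis by (simp add: bounded_linear_Blinfun_apply[OF assms(1)])
qed

lemma smooth_on_minus: "smooth_on S f \<Longrightarrow> smooth_on S (\<lambda>x. - f x)"
  by (rule smooth_on_bounded_linear[OF bounded_linear_minus[OF bounded_linear_ident]])

lemma smooth_on_diff: "smooth_on S f \<Longrightarrow> smooth_on S g \<Longrightarrow> smooth_on S (\<lambda>x. f x - g x)"
  using smooth_on_add[OF _ smooth_on_minus, of f g] by simp

lemma smooth_on_compose:
  fixes f :: "'s \<Rightarrow> 'b::euclidean_space"
  assumes "open T" "\<And>x. x \<in> S \<Longrightarrow> f x \<in> T" "smooth_on T g" "smooth_on S f"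
  shows "smooth_on S (\<lambda>x. g (f x))"
proof -
  have "f ` S \<subseteq> T" using assms(2) by blast
  then show ?thesis
    using assms(3,4) Ck_on_compose[OF S assms(1)] unfolding smooth_on_def by blast
qed

lemma smooth_on_inverse:
  fixes f :: "'s \<Rightarrow> real"
  assumes "smooth_on S f" "\<And>x. x \<in> S \<Longrightarrow> f x \<noteq> 0"
  shows "smooth_on S (\<lambda>x. inverse (f x))"
proof (rule smooth_on_compose[of "- {0}" f inverse])
  show "open (- {0::real})" by auto
  show "smooth_on (- {0::real}) inverse" unfolding smooth_on_def using Ck_on_inverse by blast
qed (use assms in auto)

lemma smooth_on_prod:
  fixes f :: "'i \<Rightarrow> 's \<Rightarrow> real"
  shows "(\<And>i. i \<in> I \<Longrightarrow> smooth_on S (f i)) \<Longrightarrow> smooth_on S (\<lambda>x. \<Prod>i\<in>I. f i x)"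
  by (induction I rule: infinite_finite_induct) (auto intro: smooth_on_const smooth_on_mult)

lemma smooth_on_vec_nth:
  fixes f :: "'s \<Rightarrow> real^'k::finite"
  shows "smooth_on S f \<Longrightarrow> smooth_on S (\<lambda>x. f x $ i)"
  by (rule smooth_on_bounded_linear[OF bounded_linear_vec_nth])

lemma smooth_on_vec_lambda:
  fixes f :: "'k::finite \<Rightarrow> 's \<Rightarrow> real"
  assumes "\<And>i. smooth_on S (f i)"
  shows "smooth_on S (\<lambda>x. \<chi> i. f i x)"
proof -
  have "smooth_on S (\<lambda>x. \<Sum>i\<in>UNIV. f i x *\<^sub>R axis i (1::real))"
    by (intro smooth_on_sum smooth_on_scaleR smooth_on_const assms)
  moreover have "(\<Sum>i\<in>UNIV. f i x *\<^sub>R axis i (1::real)) = (\<chi> i. f i x)" for x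
    by (simp add: vec_eq_iff axis_def if_distrib[of "\<lambda>z. _ * z"] sum.delta' cong: if_cong)
  ultimately show ?thesis by simp
qed

lemma smooth_on_det:
  fixes f :: "'s \<Rightarrow> real^'k^'k::finite"
  assumes "\<And>i j. smooth_on S (\<lambda>x. f x $ i $ j)"
  shows "smooth_on S (\<lambda>x. det (f x))"
  unfolding det_def by (intro smooth_on_sum smooth_on_mult smooth_on_prod smooth_on_const assms)

end

section \<open>Smooth dependence of the inverse matrix\<close>

lemma matrix_inv_works:
  fixes A :: "real^'k^'k::finite"
  assumes "invertible A"
  shows "A ** matrix_inv A = mat 1" "matrix_inv A ** A = mat 1"
  using someI_ex[OF assms[unfolded invertible_def]] unfolding matrix_inv_def by auto

text \<open>Cramer's rule writes the entries of the inverse as quotients of polynomials in the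
  entries of the matrix, so smoothness of the inverse metric follows from sums, products and one
  reciprocal.\<close>

lemma matrix_inv_cramer:
  fixes A :: "real^'k^'k::finite"
  assumes "invertible A"
  shows "matrix_inv A $ k $ l =
    det (\<chi> i j. if j = k then axis l 1 $ i else A $ i $ j) * inverse (det A)"
proof -
  have "A *v (matrix_inv A *v axis l 1) = axis l 1"
    by (simp add: matrix_vector_mul_assoc matrix_inv_works[OF assms])
  then have "(matrix_inv A *v axis l 1) =
      (\<chi> k. det (\<chi> i j. if j = k then axis l 1 $ i else A $ i $ j) / det A)"
    using cramer[of A "matrix_inv A *v axis l 1" "axis l 1"] assms invertible_det_nz by blast
  moreover have "(matrix_inv A *v axis l 1) $ k = matrix_inv A $ k $ l"
    by (simp add: matrix_vector_mult_def axis_def if_distrib[of "\<lambda>z. _ * z"] sum.delta' cong: if_cong)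
  ultimately show ?thesis by (simp add: divide_inverse)
qed

lemma smooth_on_matrix_inv:
  fixes f :: "'s::real_normed_vector \<Rightarrow> real^'k^'k::finite"
  assumes "open S" "\<And>i j. smooth_on S (\<lambda>x. f x $ i $ j)" "\<And>x. x \<in> S \<Longrightarrow> invertible (f x)"
  shows "smooth_on S (\<lambda>x. matrix_inv (f x) $ k $ l)"
proof (rule smooth_on_cong[OF \<open>open S\<close>])
  show "smooth_on S (\<lambda>x. det (\<chi> i j. if j = k then axis l 1 $ i else f x $ i $ j)
      * inverse (det (f x)))"
  proof (intro smooth_on_mult smooth_on_inverse smooth_on_det \<open>open S\<close> assms(2))
    show "smooth_on S (\<lambda>x. (\<chi> i j. if j = k then axis l 1 $ i else f x $ i $ j) $ i $ j)" for i j
      by (cases "j = k") (simp_all add: smooth_on_const assms)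
  qed (use assms(3) invertible_det_nz in blast)
qed (simp add: matrix_inv_cramer assms(3))

section \<open>Rules for evaluating derivatives\<close>

lemma frechet_derivative_bilinear:
  assumes "bounded_bilinear h" "f differentiable at x" "g differentiable at x"
  shows "frechet_derivative (\<lambda>y. h (f y) (g y)) (at x) v =
    h (f x) (frechet_derivative g (at x) v) + h (frechet_derivative f (at x) v) (g x)"
proof -
  note der = assms(2,3)[unfolded frechet_derivative_works]
  show ?thesis
    using frechet_derivative_at[OF bounded_bilinear.FDERIV[OF assms(1) der]] by metis
qed

lemmas frechet_derivative_inner = frechet_derivative_bilinear[OF bounded_bilinear_inner]
lemmas frechet_derivative_scaleR = frechet_derivative_bilinear[OF bounded_bilinear_scaleR]
lemmas frechet_derivative_blinfun_apply = frechet_derivative_bilinear[OF bounded_bilinear_blinfun_apply]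

lemma frechet_derivative_bounded_linear:
  assumes "bounded_linear L" "f differentiable at x"
  shows "frechet_derivative (\<lambda>y. L (f y)) (at x) v = L (frechet_derivative f (at x) v)"
proof -
  note der = assms(2)[unfolded frechet_derivative_works]
  show ?thesis
    using frechet_derivative_at[OF bounded_linear.has_derivative[OF assms(1) der]] by metis
qed

lemma frechet_derivative_diff:
  assumes "f differentiable at x" "g differentiable at x"
  shows "frechet_derivative (\<lambda>y. f y - g y) (at x) v =
    frechet_derivative f (at x) v - frechet_derivative g (at x) v"
  using frechet_derivative_at[OF has_derivative_diff[OF assms[unfolded frechet_derivative_works]]]
  by metis

lemma frechet_derivative_minus:
  assumes "f differentiable at x"
  shows "frechet_derivative (\<lambda>y. - f y) (at x) v = - frechet_derivative f (at x) v"
  using frechet_derivative_at[OF has_derivative_minus[OF assms[unfolded frechet_derivative_works]]]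
  by metis

lemma frechet_derivative_sum:
  assumes "\<And>i. i \<in> I \<Longrightarrow> f i differentiable at x"
  shows "frechet_derivative (\<lambda>y. \<Sum>i\<in>I. f i y) (at x) v = (\<Sum>i\<in>I. frechet_derivative (f i) (at x) v)"
proof -
  have "((\<lambda>y. \<Sum>i\<in>I. f i y) has_derivative (\<lambda>v. \<Sum>i\<in>I. frechet_derivative (f i) (at x) v)) (at x)"
    using assms frechet_derivative_works by (intro has_derivative_sum) blast
  from fun_cong[OF frechet_derivative_at[OF this], of v] show ?thesis by simp
qed

lemma frechet_derivative_chain:
  assumes "f differentiable at x" "g differentiable at (f x)"
  shows "frechet_derivative (\<lambda>y. g (f y)) (at x) v =
    frechet_derivative g (at (f x)) (frechet_derivative f (at x) v)"
  using frechet_derivative_compose[OF assms] by (simp add: o_def)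

lemma frechet_derivative_cong_open:
  assumes "f differentiable at x" "open S" "x \<in> S" "\<And>y. y \<in> S \<Longrightarrow> f y = g y"
  shows "frechet_derivative g (at x) v = frechet_derivative f (at x) v"
  using frechet_derivative_transform_within_open[OF assms] by simp

text \<open>The means by which pointwise constraints, such as unit length, orthogonality or a
  constant trace, are turned into identities between derivatives.\<close>

lemma frechet_derivative_cong_const:
  assumes "open S" "x \<in> S" "\<And>y. y \<in> S \<Longrightarrow> f y = c"
  shows "frechet_derivative f (at x) v = 0"
proof -
  have "frechet_derivative f (at x) v = frechet_derivative (\<lambda>_. c) (at x) v"
    by (rule frechet_derivative_cong_open[OF _ assms(1,2)]) (simp_all add: assms(3))
  then show ?thesis by simp
qed

section \<open>Symmetry of second derivatives\<close>

lemma has_real_derivative_along_line: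
  fixes g :: "'a::real_normed_vector \<Rightarrow> real"
  assumes "g differentiable at (p + s *\<^sub>R u)"
  shows "((\<lambda>s. g (p + s *\<^sub>R u)) has_real_derivative frechet_derivative g (at (p + s *\<^sub>R u)) u) (at s)"
proof -
  have "((\<lambda>s. p + s *\<^sub>R u) has_derivative (\<lambda>h. h *\<^sub>R u)) (at s)"
    by (auto intro!: derivative_eq_intros)
  then have "((\<lambda>s. g (p + s *\<^sub>R u)) has_derivative
      (\<lambda>h. frechet_derivative g (at (p + s *\<^sub>R u)) (h *\<^sub>R u))) (at s)"
    using has_derivative_compose assms[unfolded frechet_derivative_works] by blast
  moreover have "frechet_derivative g (at (p + s *\<^sub>R u)) (h *\<^sub>R u) =
      frechet_derivative g (at (p + s *\<^sub>R u)) u * h" for h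
    using linear_cmul[OF linear_frechet_derivative[OF assms]] by simp
  ultimately show ?thesis unfolding has_field_derivative_def by simp
qed

text \<open>The mean value theorem is applied twice: in direction \<open>u\<close> to the difference
  of two translates of \<open>g\<close>, then in direction \<open>v\<close> to the derivative so
  obtained. The left side is symmetric in \<open>u\<close> and \<open>v\<close>, which is the point
  of the lemma.\<close>

lemma second_difference_mvt:
  fixes g :: "'a::real_normed_vector \<Rightarrow> real"
  assumes "smooth_on S g" "open S" "t > 0"
    and mem: "\<And>s r. \<lbrakk>0 \<le> s; s \<le> t; 0 \<le> r; r \<le> t\<rbrakk> \<Longrightarrow> x + s *\<^sub>R u + r *\<^sub>R v \<in> S"
  shows "\<exists>s r. 0 < s \<and> s < t \<and> 0 < r \<and> r < t \<and>
    g (x + t *\<^sub>R u + t *\<^sub>R v) - g (x + t *\<^sub>R u) - g (x + t *\<^sub>R v) + g x =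
    t * t * frechet_derivative (\<lambda>z. frechet_derivative g (at z) u) (at (x + s *\<^sub>R u + r *\<^sub>R v)) v"
proof -
  let ?gu = "\<lambda>z. frechet_derivative g (at z) u"
  have dg: "g differentiable at y" "?gu differentiable at y" if "y \<in> S" for y
    using smooth_on_differentiable[OF _ \<open>open S\<close> that] smooth_on_frechet_derivative assms(1) by blast+
  define \<phi> where "\<phi> s = g ((x + t *\<^sub>R v) + s *\<^sub>R u) - g (x + s *\<^sub>R u)" for s
  have "(\<phi> has_real_derivative ?gu ((x + t *\<^sub>R v) + s *\<^sub>R u) - ?gu (x + s *\<^sub>R u)) (at s)"
    if "0 \<le> s" "s \<le> t" for s
    unfolding \<phi>_def
    using mem[OF that, of t] mem[OF that, of 0] \<open>t > 0\<close>
    by (intro DERIV_diff has_real_derivative_along_line dg) (simp_all add: algebra_simps)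
  from MVT2[OF \<open>t > 0\<close> this] obtain s where s: "0 < s" "s < t"
    and \<phi>: "\<phi> t - \<phi> 0 = t * (?gu ((x + t *\<^sub>R v) + s *\<^sub>R u) - ?gu (x + s *\<^sub>R u))"
    by auto
  have "((\<lambda>r. ?gu ((x + s *\<^sub>R u) + r *\<^sub>R v)) has_real_derivative
      frechet_derivative ?gu (at (x + s *\<^sub>R u + r *\<^sub>R v)) v) (at r)"
    if "0 \<le> r" "r \<le> t" for r
    using mem[OF _ _ that, of s] s by (intro has_real_derivative_along_line dg) simp
  from MVT2[OF \<open>t > 0\<close> this] obtain r where r: "0 < r" "r < t"
    and gu: "?gu ((x + s *\<^sub>R u) + t *\<^sub>R v) - ?gu (x + s *\<^sub>R u) =
      t * frechet_derivative ?gu (at (x + s *\<^sub>R u + r *\<^sub>R v)) v"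
    by auto
  have "g (x + t *\<^sub>R u + t *\<^sub>R v) - g (x + t *\<^sub>R u) - g (x + t *\<^sub>R v) + g x = \<phi> t - \<phi> 0"
    by (simp add: \<phi>_def algebra_simps)
  also have "\<dots> = t * (t * frechet_derivative ?gu (at (x + s *\<^sub>R u + r *\<^sub>R v)) v)"
    using \<phi> gu by (simp add: algebra_simps)
  finally show ?thesis using s r by (auto simp: mult.assoc)
qed

text \<open>One second difference equals a value of each mixed derivative at points near
  \<open>x\<close>. By continuity both values are within half the supposed gap of the values at
  \<open>x\<close>, so the gap is smaller than itself.\<close>

lemma second_derivative_symmetric_real:
  fixes g :: "'a::real_normed_vector \<Rightarrow> real"
  assumes "smooth_on S g" "open S" "x \<in> S"
  shows "frechet_derivative (\<lambda>z. frechet_derivative g (at z) u) (at x) v =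
    frechet_derivative (\<lambda>z. frechet_derivative g (at z) v) (at x) u"
proof (rule ccontr)
  define P where "P u v y = frechet_derivative (\<lambda>z. frechet_derivative g (at z) u) (at y) v" for u v y
  assume "\<not> ?thesis"
  then have ne: "P u v x \<noteq> P v u x" by (simp add: P_def)
  define e where "e = \<bar>P u v x - P v u x\<bar> / 2"
  have "e > 0" using ne by (simp add: e_def)
  have cont: "continuous_on S (P u v)" for u v
    unfolding P_def by (intro smooth_on_continuous smooth_on_frechet_derivative assms)
  have near: "\<exists>d>0. \<forall>y. dist y x < d \<longrightarrow> y \<in> S \<and> \<bar>P u v y - P u v x\<bar> < e" for u v
  proof -
    obtain d1 where d1: "d1 > 0" "\<forall>y. dist y x < d1 \<longrightarrow> y \<in> S"
      using \<open>open S\<close> \<open>x \<in> S\<close> by (meson open_dist)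
    obtain d2 where "d2 > 0" "\<forall>y\<in>S. dist y x < d2 \<longrightarrow> dist (P u v y) (P u v x) < e"
      using cont[of u v] \<open>x \<in> S\<close> \<open>e > 0\<close> unfolding continuous_on_iff by blast
    then show ?thesis using d1 by (intro exI[of _ "min d1 d2"]) (auto simp: dist_real_def)
  qed
  obtain d1 where d1: "d1 > 0" "\<And>y. dist y x < d1 \<Longrightarrow> y \<in> S \<and> \<bar>P u v y - P u v x\<bar> < e"
    using near by metis
  obtain d2 where d2: "d2 > 0" "\<And>y. dist y x < d2 \<Longrightarrow> y \<in> S \<and> \<bar>P v u y - P v u x\<bar> < e"
    using near by metis
  define d where "d = min d1 d2"
  \<comment> \<open>The parallelogram with sides \<open>t u\<close> and \<open>t v\<close> has
    points at distance at most \<open>t * q = d / 2\<close> from \<open>x\<close>; the added 1 keeps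
    \<open>q\<close> positive when both vectors vanish.\<close>
  define q where "q = norm u + norm v + 1"
  define t where "t = d / (2 * q)"
  have "d > 0" using d1 d2 by (simp add: d_def)
  have nuv: "q > 0"
    using norm_ge_zero[of u] norm_ge_zero[of v] unfolding q_def by linarith
  then have "t > 0" using \<open>d > 0\<close> by (simp add: t_def)
  have small: "dist (x + s *\<^sub>R u + r *\<^sub>R v) x < d" if "0 \<le> s" "s \<le> t" "0 \<le> r" "r \<le> t" for s r
  proof -
    have "dist (x + s *\<^sub>R u + r *\<^sub>R v) x \<le> s * norm u + r * norm v"
      using norm_triangle_ineq[of "s *\<^sub>R u" "r *\<^sub>R v"] that by (simp add: dist_norm add.assoc)
    also have "\<dots> \<le> t * norm u + t * norm v"
      using that by (intro add_mono mult_right_mono) auto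
    also have "\<dots> \<le> t * q"
      using \<open>t > 0\<close> by (simp add: q_def algebra_simps)
    also have "\<dots> = d / 2" using nuv by (simp add: t_def)
    finally show ?thesis using \<open>d > 0\<close> by simp
  qed
  have inS: "x + s *\<^sub>R u + r *\<^sub>R v \<in> S" if "0 \<le> s" "s \<le> t" "0 \<le> r" "r \<le> t" for s r
    using small[OF that] d1(2) by (simp add: d_def)
  have inS': "x + s *\<^sub>R v + r *\<^sub>R u \<in> S" if "0 \<le> s" "s \<le> t" "0 \<le> r" "r \<le> t" for s r
    using inS[OF that(3,4,1,2)] by (simp add: add.commute add.left_commute)
  obtain s r where sr: "0 < s" "s < t" "0 < r" "r < t"
    and 1: "g (x + t *\<^sub>R u + t *\<^sub>R v) - g (x + t *\<^sub>R u) - g (x + t *\<^sub>R v) + g x =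
      t * t * P u v (x + s *\<^sub>R u + r *\<^sub>R v)"
    using second_difference_mvt[OF assms(1,2) \<open>t > 0\<close> inS] unfolding P_def by blast
  obtain s' r' where sr': "0 < s'" "s' < t" "0 < r'" "r' < t"
    and 2: "g (x + t *\<^sub>R v + t *\<^sub>R u) - g (x + t *\<^sub>R v) - g (x + t *\<^sub>R u) + g x =
      t * t * P v u (x + s' *\<^sub>R v + r' *\<^sub>R u)"
    using second_difference_mvt[OF assms(1,2) \<open>t > 0\<close> inS'] unfolding P_def by blast
  have "t * t * P u v (x + s *\<^sub>R u + r *\<^sub>R v) = t * t * P v u (x + s' *\<^sub>R v + r' *\<^sub>R u)"
    using 1 2 by (simp add: algebra_simps)
  then have "P u v (x + s *\<^sub>R u + r *\<^sub>R v) = P v u (x + s' *\<^sub>R v + r' *\<^sub>R u)"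
    using \<open>t > 0\<close> by simp
  moreover have "\<bar>P u v (x + s *\<^sub>R u + r *\<^sub>R v) - P u v x\<bar> < e"
    using small[of s r] sr d1(2) by (simp add: d_def)
  moreover have "\<bar>P v u (x + s' *\<^sub>R v + r' *\<^sub>R u) - P v u x\<bar> < e"
    using small[of r' s'] sr' d2(2) by (simp add: d_def algebra_simps)
  ultimately have "\<bar>P u v x - P v u x\<bar> < 2 * e" by linarith
  then show False by (simp add: e_def)
qed

text \<open>Testing with a functional reduces to real values. This form also covers functions into a
  space of operators, whose norm does not come from an inner product; it is applied there to matrix
  entries.\<close>

lemma second_derivative_symmetric_functional:
  assumes "smooth_on S g" "open S" "x \<in> S" "bounded_linear (L :: _ \<Rightarrow> real)"
  shows "L (frechet_derivative (\<lambda>z. frechet_derivative g (at z) u) (at x) v) =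
    L (frechet_derivative (\<lambda>z. frechet_derivative g (at z) v) (at x) u)"
proof -
  have dg: "g differentiable at y" "(\<lambda>z. frechet_derivative g (at z) w) differentiable at y"
    if "y \<in> S" for y w
    using smooth_on_differentiable[OF _ \<open>open S\<close> that] smooth_on_frechet_derivative assms(1) by blast+
  have sm: "smooth_on S (\<lambda>y. L (g y))"
    by (rule smooth_on_bounded_linear[OF \<open>open S\<close> assms(4,1)])
  have "L (frechet_derivative (\<lambda>z. frechet_derivative g (at z) u) (at x) v) =
      frechet_derivative (\<lambda>z. frechet_derivative (\<lambda>y. L (g y)) (at z) u) (at x) v" for u v
  proof -
    have "L (frechet_derivative (\<lambda>z. frechet_derivative g (at z) u) (at x) v) =
      frechet_derivative (\<lambda>z. L (frechet_derivative g (at z) u)) (at x) v"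
      using frechet_derivative_bounded_linear[OF assms(4) dg(2)[OF \<open>x \<in> S\<close>]] by simp
    also have "\<dots> = frechet_derivative (\<lambda>z. frechet_derivative (\<lambda>y. L (g y)) (at z) u) (at x) v"
    proof (rule frechet_derivative_cong_open[OF _ \<open>open S\<close> \<open>x \<in> S\<close>])
      show "(\<lambda>z. frechet_derivative (\<lambda>y. L (g y)) (at z) u) differentiable at x"
        using smooth_on_differentiable[OF _ \<open>open S\<close> \<open>x \<in> S\<close>] smooth_on_frechet_derivative sm by blast
    qed (rule frechet_derivative_bounded_linear[OF assms(4) dg(1)])
    finally show ?thesis .
  qed
  then show ?thesis using second_derivative_symmetric_real[OF sm assms(2,3)] by simp
qed

lemma second_derivative_symmetric:
  fixes g :: "'a::real_normed_vector \<Rightarrow> 'b::real_inner"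
  assumes "smooth_on S g" "open S" "x \<in> S"
  shows "frechet_derivative (\<lambda>z. frechet_derivative g (at z) u) (at x) v =
    frechet_derivative (\<lambda>z. frechet_derivative g (at z) v) (at x) u"
  by (rule vector_eq_rdot[THEN iffD1])
    (intro allI second_derivative_symmetric_functional[OF assms bounded_linear_inner_left])

section \<open>Self-adjoint operators\<close>

text \<open>A maximum of the Rayleigh quotient on the unit sphere of \<open>W\<close> is an
  eigenvector: the first variation in every direction of \<open>W\<close> vanishes, so
  \<open>\<kappa> *\<^sub>R b - L b\<close> is orthogonal to \<open>W\<close>, and it lies in
  \<open>W\<close> by invariance.\<close>

lemma selfadjoint_max_eigenvector:
  fixes L :: "'a::euclidean_space \<Rightarrow> 'a"
  assumes lin: "linear L" and sub: "subspace W" and inv: "\<And>x. x \<in> W \<Longrightarrow> L x \<in> W"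
    and sym: "\<And>x y. \<lbrakk>x \<in> W; y \<in> W\<rbrakk> \<Longrightarrow> L x \<bullet> y = x \<bullet> L y" and "W \<noteq> {0}"
  shows "\<exists>b\<in>W. norm b = 1 \<and> (\<exists>\<kappa>. L b = \<kappa> *\<^sub>R b)"
proof -
  obtain w where w: "w \<in> W" "w \<noteq> 0" using subspace_0[OF sub] \<open>W \<noteq> {0}\<close> by auto
  let ?K = "W \<inter> sphere 0 1"
  have "compact ?K"
    using closed_subspace[OF sub] compact_sphere by (simp add: closed_Int_compact)
  moreover have "(1 / norm w) *\<^sub>R w \<in> ?K" using w sub by (auto simp: subspace_scale)
  moreover have "continuous_on ?K (\<lambda>x. L x \<bullet> x)"
    using linear_continuous_on[OF lin[unfolded linear_conv_bounded_linear]]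
    by (intro continuous_intros)
  ultimately obtain b where b: "b \<in> ?K" and max: "\<And>x. x \<in> ?K \<Longrightarrow> L x \<bullet> x \<le> L b \<bullet> b"
    using continuous_attains_sup[of ?K "\<lambda>x. L x \<bullet> x"] by blast
  define \<kappa> where "\<kappa> = L b \<bullet> b"
  have bW: "b \<in> W" and bb: "b \<bullet> b = 1" using b by (auto simp: dot_square_norm)
  have le: "L x \<bullet> x \<le> \<kappa> * (x \<bullet> x)" if "x \<in> W" for x
  proof (cases "x = 0")
    case False
    have "(1 / norm x) *\<^sub>R x \<in> ?K" using that False sub by (auto simp: subspace_scale)
    from max[OF this] have "(1 / norm x)\<^sup>2 * (L x \<bullet> x) \<le> \<kappa>"
      by (simp add: linear_cmul[OF lin] power2_eq_square \<kappa>_def)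
    then have "L x \<bullet> x \<le> \<kappa> * (norm x)\<^sup>2" using False by (simp add: field_simps)
    then show ?thesis by (simp add: dot_square_norm)
  qed (simp add: linear_0[OF lin])
  have orth: "(\<kappa> *\<^sub>R b - L b) \<bullet> y = 0" if "y \<in> W" for y
  proof (rule ccontr)
    \<comment> \<open>Maximality says that \<open>2 * t * c + t\<^sup>2 * e\<close> is nonnegative
      for all \<open>t\<close>. The chosen \<open>t\<close> gives it the value
      \<open>- (t\<^sup>2 * (e + 2))\<close>; dividing by \<open>e + 1\<close> rather than
      \<open>e\<close> covers the case \<open>e = 0\<close>.\<close>
    define c e t where "c = (\<kappa> *\<^sub>R b - L b) \<bullet> y" and "e = \<kappa> * (y \<bullet> y) - L y \<bullet> y"
      and "t = - c / (e + 1)"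
    assume "\<not> ?thesis"
    then have "c \<noteq> 0" by (simp add: c_def)
    have "e \<ge> 0" using le[OF that] by (simp add: e_def)
    have "b + t *\<^sub>R y \<in> W" using bW that sub by (simp add: subspace_add subspace_scale)
    have Lby: "L y \<bullet> b = L b \<bullet> y" using sym[OF that bW] by (simp add: inner_commute)
    have "L (b + t *\<^sub>R y) \<bullet> (b + t *\<^sub>R y) = \<kappa> + 2 * t * (L b \<bullet> y) + t\<^sup>2 * (L y \<bullet> y)"
      by (simp add: linear_add[OF lin] linear_cmul[OF lin] inner_add_left inner_add_right
          Lby \<kappa>_def power2_eq_square algebra_simps)
    moreover have "(b + t *\<^sub>R y) \<bullet> (b + t *\<^sub>R y) = 1 + 2 * t * (b \<bullet> y) + t\<^sup>2 * (y \<bullet> y)"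
      by (simp add: inner_add_left inner_add_right bb inner_commute power2_eq_square)
    ultimately have "\<kappa> + 2 * t * (L b \<bullet> y) + t\<^sup>2 * (L y \<bullet> y) \<le>
        \<kappa> * (1 + 2 * t * (b \<bullet> y) + t\<^sup>2 * (y \<bullet> y))"
      using le[OF \<open>b + t *\<^sub>R y \<in> W\<close>] by simp
    then have "0 \<le> 2 * t * c + t\<^sup>2 * e"
      by (simp add: c_def e_def inner_diff_left algebra_simps)
    moreover have ct: "c = - (t * (e + 1))" using \<open>e \<ge> 0\<close> by (simp add: t_def)
    ultimately have "0 \<le> - (t\<^sup>2 * (e + 2))" by (simp add: power2_eq_square algebra_simps)
    moreover have "t \<noteq> 0" using ct \<open>c \<noteq> 0\<close> by auto
    then have "t\<^sup>2 * (e + 2) > 0" using \<open>e \<ge> 0\<close> by (intro mult_pos_pos) auto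
    ultimately show False by simp
  qed
  have "\<kappa> *\<^sub>R b - L b \<in> W" using inv[OF bW] bW sub by (simp add: subspace_diff subspace_scale)
  from orth[OF this] have "L b = \<kappa> *\<^sub>R b" by simp
  then show ?thesis using b by auto
qed

text \<open>The orthogonal complement of an eigenvector inside \<open>W\<close> is again invariant,
  which drives the induction on the dimension. The relative form is the one applied later, with the
  tangent space as \<open>W\<close> inside the ambient space.\<close>

lemma selfadjoint_eigenbasis:
  fixes L :: "'a::euclidean_space \<Rightarrow> 'a"
  assumes lin: "linear L" and "subspace W" "\<And>x. x \<in> W \<Longrightarrow> L x \<in> W"
    and "\<And>x y. \<lbrakk>x \<in> W; y \<in> W\<rbrakk> \<Longrightarrow> L x \<bullet> y = x \<bullet> L y"
  shows "\<exists>B\<subseteq>W. finite B \<and> pairwise orthogonal B \<and> (\<forall>b\<in>B. norm b = 1) \<and> span B = W \<and>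
    (\<forall>b\<in>B. \<exists>\<kappa>. L b = \<kappa> *\<^sub>R b)"
  using assms(2-)
proof (induction "dim W" arbitrary: W rule: less_induct)
  case less
  note sub = less.prems(1)
  show ?case
  proof (cases "W = {0}")
    case True
    then show ?thesis by (intro exI[of _ "{}"]) (auto simp: pairwise_def)
  next
    case False
    then obtain b \<kappa> where b: "b \<in> W" "norm b = 1" "L b = \<kappa> *\<^sub>R b"
      using selfadjoint_max_eigenvector[OF lin less.prems] by blast
    have bb: "b \<bullet> b = 1" using b(2) by (simp add: dot_square_norm)
    define W' where "W' = {w \<in> W. b \<bullet> w = 0}"
    have sub': "subspace W'"
      using sub unfolding W'_def subspace_def by (auto simp: inner_add_right)
    have "b \<notin> W'" using bb by (simp add: W'_def)
    moreover have "W' \<subseteq> W" by (auto simp: W'_def)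
    ultimately have "W' \<subset> W" using b(1) by blast
    then have "dim W' < dim W" using sub sub' by (metis dim_psubset span_eq_iff)
    moreover have "L w \<in> W'" if "w \<in> W'" for w
      using that less.prems(2) less.prems(3)[OF b(1), of w] b(3) by (auto simp: W'_def)
    ultimately obtain B where B: "B \<subseteq> W'" "finite B" "pairwise orthogonal B" "\<forall>b\<in>B. norm b = 1"
      "span B = W'" "\<forall>b\<in>B. \<exists>\<kappa>. L b = \<kappa> *\<^sub>R b"
      using less.hyps[of W'] sub' less.prems(3) by (auto simp: W'_def)
    have "span (insert b B) = W"
    proof
      show "span (insert b B) \<subseteq> W"
        using b(1) B(1) sub by (intro span_minimal) (auto simp: W'_def)
      show "W \<subseteq> span (insert b B)"
      proof
        fix w assume w: "w \<in> W"
        have "w - (b \<bullet> w) *\<^sub>R b \<in> W'"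
          using w b(1) sub bb by (simp add: W'_def subspace_diff subspace_scale inner_diff_right)
        then have "w - (b \<bullet> w) *\<^sub>R b \<in> span B" using B(5) by simp
        then show "w \<in> span (insert b B)" using span_breakdown_eq by blast
      qed
    qed
    moreover have "pairwise orthogonal (insert b B)"
      using B(1,3) by (auto simp: pairwise_insert W'_def orthogonal_def inner_commute)
    ultimately show ?thesis
      using B b \<open>W' \<subset> W\<close> by (intro exI[of _ "insert b B"]) auto
  qed
qed

lemma orthonormal_expansion:
  fixes B :: "'a::euclidean_space set"
  assumes "finite B" "pairwise orthogonal B" "\<forall>b\<in>B. norm b = 1" "w \<in> span B"
  shows "(\<Sum>b\<in>B. (w \<bullet> b) *\<^sub>R b) = w"
proof -
  define r where "r = w - (\<Sum>b\<in>B. (w \<bullet> b) *\<^sub>R b)"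
  have "r \<bullet> c = 0" if "c \<in> B" for c
  proof -
    have "(\<Sum>b\<in>B. (w \<bullet> b) * (b \<bullet> c)) = (\<Sum>b\<in>B. if b = c then w \<bullet> c else 0)"
      using assms(2,3) that
      by (intro sum.cong) (auto simp: pairwise_def orthogonal_def dot_square_norm)
    then show ?thesis using that assms(1) by (simp add: r_def inner_diff_left inner_sum_left)
  qed
  then have "orthogonal r y" if "y \<in> span B" for y
    using orthogonal_to_span[OF that] by (simp add: orthogonal_def)
  moreover have "r \<in> span B"
    unfolding r_def using assms(4) by (intro span_diff span_sum span_scale assms(4)) (rule span_base)
  ultimately have "r = 0" using orthogonal_self by blast
  then show ?thesis by (simp add: r_def)
qed

text \<open>Only one of the two vectors has to lie in the span, so the identity applies when the
  other one is the image of a tangent vector under an operator that may leave the tangent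
  space.\<close>

lemma orthonormal_parseval:
  fixes B :: "'a::euclidean_space set"
  assumes "finite B" "pairwise orthogonal B" "\<forall>b\<in>B. norm b = 1" "w \<in> span B"
  shows "(\<Sum>b\<in>B. (w \<bullet> b) * (z \<bullet> b)) = w \<bullet> z"
proof -
  have "w \<bullet> z = (\<Sum>b\<in>B. (w \<bullet> b) *\<^sub>R b) \<bullet> z" using orthonormal_expansion[OF assms] by simp
  also have "\<dots> = (\<Sum>b\<in>B. (w \<bullet> b) * (z \<bullet> b))"
    by (simp add: inner_sum_left inner_commute[of z])
  finally show ?thesis by simp
qed

section \<open>Immersions into Euclidean space\<close>

abbreviation "D f x \<equiv> frechet_derivative f (at x)"

abbreviation "D2 f x u v \<equiv> frechet_derivative (\<lambda>y. frechet_derivative f (at y) v) (at x) u"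

lemma vec_expand: "(\<Sum>i\<in>UNIV. u $ i *\<^sub>R axis i (1::real)) = u" for u :: "real^'m::finite"
  by (simp add: vec_eq_iff axis_def if_distrib[of "\<lambda>z. _ * z"] sum.delta' cong: if_cong)

lemma linear_vec_expand:
  fixes L :: "real^'m::finite \<Rightarrow> 'b::real_vector"
  assumes "linear L"
  shows "L u = (\<Sum>i\<in>UNIV. u $ i *\<^sub>R L (axis i 1))"
proof -
  have "L u = L (\<Sum>i\<in>UNIV. u $ i *\<^sub>R axis i 1)" by (simp add: vec_expand)
  then show ?thesis by (simp add: linear_sum[OF assms] linear_cmul[OF assms])
qed

lemma trace_matrix: "trace (matrix L) = (\<Sum>i\<in>UNIV. L (axis i 1) $ i)"
  for L :: "real^'m::finite \<Rightarrow> real^'m"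
  by (simp add: trace_def matrix_def)

lemma metric_trace_inner:
  "metric_trace G x b \<bullet> e = metric_trace G x (\<lambda>u v. b u v \<bullet> e)"
  for b :: "real^'m::finite \<Rightarrow> real^'m \<Rightarrow> 'a::real_inner"
  by (simp add: metric_trace_def inner_sum_left)

lemma metric_trace_uminus: "metric_trace G x (\<lambda>u v. - b u v) = - metric_trace G x b"
  by (simp add: metric_trace_def sum_negf)

lemma linear_metric_trace:
  assumes "linear L"
  shows "L (metric_trace G x b) = metric_trace G x (\<lambda>u v. L (b u v))"
  by (simp add: metric_trace_def linear_sum[OF assms] linear_cmul[OF assms])

lemma metric_trace_add:
  "metric_trace G x (\<lambda>u v. b u v + c u v) = metric_trace G x b + metric_trace G x c"
  by (simp add: metric_trace_def sum.distrib scaleR_add_right)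

lemma metric_trace_scaleR_right:
  "metric_trace G x (\<lambda>u v. t *\<^sub>R b u v) = t *\<^sub>R metric_trace G x b"
  by (simp add: metric_trace_def scaleR_sum_right mult.commute)

lemma metric_trace_scaleR_left:
  "metric_trace G x (\<lambda>u v. b u v *\<^sub>R e) = metric_trace G x b *\<^sub>R e"
  by (simp add: metric_trace_def scaleR_sum_left)

text \<open>Of arbitrary codimension, because it is instantiated twice: by the hypersurface, of
  codimension two in the ambient space, and by the parametrizations of the sphere, of codimension
  one.\<close>

locale immersion =
  fixes S :: "(real^'m::finite) set" and F :: "real^'m \<Rightarrow> 'a::euclidean_space"
    and G :: "real^'m \<Rightarrow> real^'m^'m"
  assumes open_S: "open S" and smooth_F: "smooth_on S F"
    and inj_dF: "x \<in> S \<Longrightarrow> inj (D F x)"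
    and G_eq: "x \<in> S \<Longrightarrow> G x = (\<chi> i j. D F x (axis i 1) \<bullet> D F x (axis j 1))"
begin

lemma smooth_dF: "smooth_on S (\<lambda>x. D F x u)"
  by (rule smooth_on_frechet_derivative[OF smooth_F])

lemma linear_dF: "x \<in> S \<Longrightarrow> linear (D F x)"
  by (rule smooth_on_linear_derivative[OF smooth_F open_S])

lemma linear_D2F_left: "x \<in> S \<Longrightarrow> linear (\<lambda>u. D2 F x u v)"
  by (rule smooth_on_linear_derivative[OF smooth_dF open_S])

lemma D2F_commute: "x \<in> S \<Longrightarrow> D2 F x u v = D2 F x v u"
  using second_derivative_symmetric[OF smooth_F open_S] by blast

lemma linear_D2F_right: "x \<in> S \<Longrightarrow> linear (\<lambda>v. D2 F x u v)"
proof -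
  assume x: "x \<in> S"
  have "(\<lambda>v. D2 F x u v) = (\<lambda>v. D2 F x v u)"
    by (rule ext) (rule D2F_commute[OF x])
  then show ?thesis using linear_D2F_left[OF x, of u] by simp
qed

lemma D2F_expand_right:
  "x \<in> S \<Longrightarrow> D2 F x u v = (\<Sum>j\<in>UNIV. v $ j *\<^sub>R D2 F x u (axis j 1))"
  using linear_vec_expand[OF linear_D2F_right] .

lemma inner_G: "x \<in> S \<Longrightarrow> u \<bullet> (G x *v v) = D F x u \<bullet> D F x v"
proof -
  assume x: "x \<in> S"
  have "(G x *v v) $ i = D F x (axis i 1) \<bullet> D F x v" for i
    unfolding linear_vec_expand[OF linear_dF[OF x], of v]
    by (simp add: G_eq[OF x] matrix_vector_mult_def inner_sum_right mult.commute)
  then show ?thesis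
    unfolding linear_vec_expand[OF linear_dF[OF x], of u]
    by (simp add: inner_vec_def inner_sum_left)
qed

lemma G_mult: "x \<in> S \<Longrightarrow> G x *v v = (\<chi> i. D F x (axis i 1) \<bullet> D F x v)"
  using inner_G[of x "axis _ 1" v] by (simp add: vec_eq_iff inner_axis')

lemma invertible_G: assumes x: "x \<in> S" shows "invertible (G x)"
proof -
  have "v = 0" if "G x *v v = 0" for v
  proof -
    have "D F x v \<bullet> D F x v = 0" using inner_G[OF x, of v v] that by simp
    then have "D F x v = D F x 0" by (simp add: linear_0[OF linear_dF[OF x]])
    then show ?thesis using inj_dF[OF x] by (simp add: inj_eq)
  qed
  then show ?thesis by (simp add: invertible_left_inverse matrix_left_invertible_ker)
qed

text \<open>The coordinates of the orthogonal projection of \<open>e\<close> to the tangent space.\<close>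

definition tcoord :: "real^'m \<Rightarrow> 'a \<Rightarrow> real^'m" where
  "tcoord x e = matrix_inv (G x) *v (\<chi> i. D F x (axis i 1) \<bullet> e)"

lemma tcoord_dF: "x \<in> S \<Longrightarrow> tcoord x (D F x u) = u"
  unfolding tcoord_def
  by (simp add: G_mult[symmetric] matrix_vector_mul_assoc matrix_inv_works(2)[OF invertible_G])

lemma dF_tcoord_inner: assumes x: "x \<in> S" shows "D F x (tcoord x e) \<bullet> D F x w = e \<bullet> D F x w"
proof -
  have "G x *v tcoord x e = (\<chi> i. D F x (axis i 1) \<bullet> e)"
    unfolding tcoord_def
    by (simp add: matrix_vector_mul_assoc matrix_inv_works(1)[OF invertible_G[OF x]])
  then have "w \<bullet> (G x *v tcoord x e) = D F x w \<bullet> e"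
    unfolding linear_vec_expand[OF linear_dF[OF x], of w]
    by (simp add: inner_vec_def inner_sum_left)
  then show ?thesis using inner_G[OF x, of w "tcoord x e"] by (simp add: inner_commute)
qed

lemma linear_tcoord: "linear (tcoord x)"
proof -
  have "linear (\<lambda>e. (\<chi> i. D F x (axis i 1) \<bullet> e))"
    by (rule linearI) (simp_all add: vec_eq_iff inner_add_right)
  then show ?thesis
    unfolding tcoord_def by (rule linear_compose[unfolded o_def]) (rule matrix_vector_mul_linear)
qed

lemma tcoord_normal: "(\<And>w. e \<bullet> D F x w = 0) \<Longrightarrow> tcoord x e = 0"
  unfolding tcoord_def by (simp add: inner_commute zero_vec_def[symmetric])

lemma dF_eqI:
  assumes x: "x \<in> S" and "\<And>w. D F x u \<bullet> D F x w = D F x v \<bullet> D F x w"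
  shows "u = v"
proof -
  have "(D F x u - D F x v) \<bullet> (D F x u - D F x v) = 0"
    using assms(2)[of u] assms(2)[of v] by (simp add: inner_diff_left inner_diff_right)
  then show ?thesis using inj_dF[OF x] by (simp add: inj_eq)
qed

lemma metric_trace_dF:
  "x \<in> S \<Longrightarrow> metric_trace G x (\<lambda>u v. e u \<bullet> D F x v) = (\<Sum>i\<in>UNIV. tcoord x (e (axis i 1)) $ i)"
  unfolding metric_trace_def tcoord_def by (simp add: matrix_vector_mult_def inner_commute)

lemma metric_trace_operator:
  "x \<in> S \<Longrightarrow> metric_trace G x (\<lambda>u v. D F x (L u) \<bullet> D F x v) = trace (matrix L)"
  by (simp add: metric_trace_dF[of x "\<lambda>u. D F x (L u)"] tcoord_dF trace_matrix)

lemma sharp_inner: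
  assumes x: "x \<in> S" shows "sharp G x (\<lambda>v. e \<bullet> D F x v) = tcoord x e"
  unfolding sharp_def tcoord_def by (simp add: inner_commute)

lemma sharp_dF: "x \<in> S \<Longrightarrow> sharp G x (\<lambda>v. D F x u \<bullet> D F x v) = u"
  by (simp add: sharp_inner tcoord_dF)

lemma smooth_tcoord:
  fixes f :: "'s::real_normed_vector \<Rightarrow> real^'m"
  assumes "open T" "smooth_on T f" "\<And>x. x \<in> T \<Longrightarrow> f x \<in> S" "smooth_on T W"
  shows "smooth_on T (\<lambda>x. tcoord (f x) (W x))"
proof -
  have G: "smooth_on S (\<lambda>x. G x $ i $ j)" for i j
    by (rule smooth_on_cong[OF open_S smooth_on_inner[OF open_S smooth_dF smooth_dF]])
      (simp add: G_eq)
  have inv: "smooth_on T (\<lambda>x. matrix_inv (G (f x)) $ i $ j)" for i j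
    by (rule smooth_on_compose[OF \<open>open T\<close> open_S assms(3) _ assms(2)])
      (use smooth_on_matrix_inv[OF open_S G invertible_G] in auto)
  have "smooth_on T (\<lambda>x. D F (f x) u)" for u
    by (rule smooth_on_compose[OF \<open>open T\<close> open_S assms(3) smooth_dF assms(2)])
  then show ?thesis
    unfolding tcoord_def matrix_vector_mult_def
    by (intro smooth_on_vec_lambda smooth_on_sum \<open>open T\<close> smooth_on_mult inv)
      (simp add: smooth_on_inner[OF \<open>open T\<close> _ assms(4)])
qed

text \<open>Each derivative of a metric coefficient is a sum of two products of second and first
  derivatives of \<open>F\<close>. In the Koszul combination, symmetry of the second derivative
  cancels all but one product, which appears twice.\<close>

lemma christoffel_eq:
  assumes x: "x \<in> S"
  shows "christoffel G k i j x =
    (\<Sum>l\<in>UNIV. matrix_inv (G x) $ k $ l * (D2 F x (axis i 1) (axis j 1) \<bullet> D F x (axis l 1)))"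
proof -
  have dG: "D (\<lambda>y. G y $ j $ l) x (axis i 1) =
      D2 F x (axis i 1) (axis j 1) \<bullet> D F x (axis l 1) + D2 F x (axis i 1) (axis l 1) \<bullet> D F x (axis j 1)"
    for i j l
  proof -
    have diff: "(\<lambda>y. D F y u) differentiable at x" for u
      using smooth_on_differentiable[OF smooth_dF open_S x] .
    have "D (\<lambda>y. G y $ j $ l) x (axis i 1) = D (\<lambda>y. D F y (axis j 1) \<bullet> D F y (axis l 1)) x (axis i 1)"
      using smooth_on_differentiable[OF smooth_on_inner[OF open_S smooth_dF smooth_dF] open_S x]
      by (rule frechet_derivative_cong_open[OF _ open_S x]) (simp add: G_eq)
    then show ?thesis by (simp add: frechet_derivative_inner[OF diff diff] inner_commute)
  qed
  have "D (\<lambda>y. G y $ j $ l) x (axis i 1) + D (\<lambda>y. G y $ i $ l) x (axis j 1)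
      - D (\<lambda>y. G y $ i $ j) x (axis l 1) = 2 * (D2 F x (axis i 1) (axis j 1) \<bullet> D F x (axis l 1))" for l
    using D2F_commute[OF x, of "axis i 1" "axis j 1"] D2F_commute[OF x, of "axis i 1" "axis l 1"]
      D2F_commute[OF x, of "axis j 1" "axis l 1"]
    unfolding dG by simp
  then show ?thesis unfolding christoffel_def by (simp add: sum_divide_distrib)
qed

text \<open>The Levi-Civita connection of an induced metric is the tangential part of the flat
  derivative. From here on Christoffel symbols are replaced by this projection.\<close>

lemma christoffel_map_eq:
  assumes x: "x \<in> S"
  shows "christoffel_map G x u v = tcoord x (D2 F x u v)"
proof -
  have "D2 F x u v = (\<Sum>i\<in>UNIV. \<Sum>j\<in>UNIV. (u $ i * v $ j) *\<^sub>R D2 F x (axis i 1) (axis j 1))"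
    unfolding linear_vec_expand[OF linear_D2F_left[OF x], where u = u]
    by (simp add: D2F_expand_right[OF x, where v = v] scaleR_sum_right)
  then have "tcoord x (D2 F x u v) =
      (\<Sum>i\<in>UNIV. \<Sum>j\<in>UNIV. (u $ i * v $ j) *\<^sub>R tcoord x (D2 F x (axis i 1) (axis j 1)))"
    by (simp add: linear_sum[OF linear_tcoord] linear_cmul[OF linear_tcoord])
  also have "\<dots> = christoffel_map G x u v"
    by (simp add: vec_eq_iff christoffel_map_def christoffel_eq[OF x] tcoord_def
        matrix_vector_mult_def inner_commute mult_ac)
  finally show ?thesis by simp
qed

lemma smooth_dF_along:
  fixes f :: "'s::real_normed_vector \<Rightarrow> real^'m"
  assumes "open T" "smooth_on T f" "\<And>y. y \<in> T \<Longrightarrow> f y \<in> S" "smooth_on T Y"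
  shows "smooth_on T (\<lambda>y. D F (f y) (Y y))"
proof (rule smooth_on_cong[OF \<open>open T\<close>])
  have "smooth_on T (\<lambda>y. D F (f y) u)" for u
    by (rule smooth_on_compose[OF \<open>open T\<close> open_S assms(3) smooth_dF assms(2)])
  then show "smooth_on T (\<lambda>y. \<Sum>i\<in>UNIV. Y y $ i *\<^sub>R D F (f y) (axis i 1))"
    by (intro smooth_on_sum smooth_on_scaleR smooth_on_vec_nth \<open>open T\<close> assms(4))
qed (use linear_vec_expand[OF linear_dF] assms(3) in metis)

text \<open>Base point and vector both move with \<open>y\<close>. Expanding \<open>Y\<close> in the
  coordinate basis separates the two, one by the chain rule and one by the product rule.\<close>

lemma D_dF_along:
  fixes f :: "'s::real_normed_vector \<Rightarrow> real^'m"
  assumes "open T" "x \<in> T" "smooth_on T f" "\<And>y. y \<in> T \<Longrightarrow> f y \<in> S" "smooth_on T Y"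
  shows "D (\<lambda>y. D F (f y) (Y y)) x u = D2 F (f x) (D f x u) (Y x) + D F (f x) (D Y x u)"
proof -
  have fx: "f x \<in> S" using assms by blast
  have Yi: "(\<lambda>y. Y y $ i) differentiable at x" for i
    by (rule smooth_on_differentiable[OF smooth_on_vec_nth[OF assms(1,5)] assms(1,2)])
  have smF: "smooth_on T (\<lambda>y. D F (f y) u)" for u
    by (rule smooth_on_compose[OF \<open>open T\<close> open_S assms(4) smooth_dF assms(3)])
  have Fi: "(\<lambda>y. D F (f y) (axis i 1)) differentiable at x" for i
    using smooth_on_differentiable[OF smF assms(1,2)] .
  have DFi: "D (\<lambda>y. D F (f y) (axis i 1)) x u = D2 F (f x) (D f x u) (axis i 1)" for i
    by (rule frechet_derivative_chain[OF smooth_on_differentiable[OF assms(3,1,2)]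
          smooth_on_differentiable[OF smooth_dF open_S fx]])
  have diff: "(\<lambda>y. \<Sum>i\<in>UNIV. Y y $ i *\<^sub>R D F (f y) (axis i 1)) differentiable at x"
    by (rule smooth_on_differentiable[OF _ assms(1,2)])
      (intro smooth_on_sum smooth_on_scaleR smooth_on_vec_nth smF assms)
  have "D (\<lambda>y. D F (f y) (Y y)) x u = D (\<lambda>y. \<Sum>i\<in>UNIV. Y y $ i *\<^sub>R D F (f y) (axis i 1)) x u"
    by (rule frechet_derivative_cong_open[OF diff assms(1,2)])
      (rule linear_vec_expand[OF linear_dF[OF assms(4)], symmetric])
  also have "\<dots> = (\<Sum>i\<in>UNIV. D (\<lambda>y. Y y $ i *\<^sub>R D F (f y) (axis i 1)) x u)"
    by (rule frechet_derivative_sum) (auto intro!: differentiable_scaleR Yi Fi)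
  also have "\<dots> = (\<Sum>i\<in>UNIV. Y x $ i *\<^sub>R D2 F (f x) (D f x u) (axis i 1)
      + D Y x u $ i *\<^sub>R D F (f x) (axis i 1))"
    using frechet_derivative_bounded_linear[OF bounded_linear_vec_nth
        smooth_on_differentiable[OF assms(5,1,2)]]
    by (simp add: frechet_derivative_scaleR[OF Yi Fi] DFi)
  also have "\<dots> = D2 F (f x) (D f x u) (Y x) + D F (f x) (D Y x u)"
    unfolding linear_vec_expand[OF linear_dF[OF fx], of "D Y x u"]
    by (simp add: sum.distrib D2F_expand_right[OF fx, where v = "Y x"])
  finally show ?thesis .
qed

lemma D_dF_field:
  assumes "x \<in> S" "smooth_on S Y"
  shows "D (\<lambda>y. D F y (Y y)) x u = D2 F x u (Y x) + D F x (D Y x u)"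
  using D_dF_along[OF open_S assms(1) smooth_on_ident[OF open_S] _ assms(2)] by simp

text \<open>The vector-valued second fundamental form in Euclidean space, evaluated on constant
  coordinate fields.\<close>

definition normal_part :: "real^'m \<Rightarrow> real^'m \<Rightarrow> real^'m \<Rightarrow> 'a" where
  "normal_part v w x = D2 F x v w - D F x (christoffel_map G x v w)"

lemma smooth_christoffel_map: "smooth_on S (\<lambda>x. christoffel_map G x v w)"
proof (rule smooth_on_cong[OF open_S])
  show "smooth_on S (\<lambda>x. tcoord x (D2 F x v w))"
    by (rule smooth_tcoord[OF open_S smooth_on_ident[OF open_S] _
          smooth_on_frechet_derivative[OF smooth_dF]])
qed (simp add: christoffel_map_eq)

text \<open>The ambient space is flat: writing the covariant derivative of a coordinate field as
  second derivative minus normal part, the third derivatives of \<open>F\<close> cancel in the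
  commutator, and only derivatives of normal parts survive.\<close>

lemma gauss_equation:
  assumes x: "x \<in> S"
  shows "D F x (curvature G x u v w) \<bullet> D F x z =
    D (normal_part u w) x v \<bullet> D F x z - D (normal_part v w) x u \<bullet> D F x z"
proof -
  have cov: "D F x (cov_deriv G (\<lambda>_. u) (cov_deriv G (\<lambda>_. v) (\<lambda>_. w)) x) \<bullet> D F x z =
      (D (\<lambda>y. D2 F y v w) x u - D (normal_part v w) x u) \<bullet> D F x z" for u v
  proof -
    define Y where "Y y = christoffel_map G y v w" for y
    have Y: "cov_deriv G (\<lambda>_. v) (\<lambda>_. w) = Y"
      by (rule ext) (simp add: cov_deriv_def Y_def)
    have smY: "smooth_on S Y" unfolding Y_def by (rule smooth_christoffel_map)
    have d2: "(\<lambda>y. D2 F y v w) differentiable at x"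
      by (rule smooth_on_differentiable[OF smooth_on_frechet_derivative[OF smooth_dF] open_S x])
    have dY: "(\<lambda>y. D F y (Y y)) differentiable at x"
      by (rule smooth_on_differentiable[OF smooth_dF_along[OF open_S smooth_on_ident[OF open_S] _ smY]
            open_S x])
    have "D F x (cov_deriv G (\<lambda>_. u) Y x) = D F x (D Y x u) + D F x (tcoord x (D2 F x u (Y x)))"
      by (simp add: cov_deriv_def linear_add[OF linear_dF[OF x]] christoffel_map_eq[OF x])
    then have "D F x (cov_deriv G (\<lambda>_. u) Y x) \<bullet> D F x z = D (\<lambda>y. D F y (Y y)) x u \<bullet> D F x z"
      by (simp add: D_dF_field[OF x smY] inner_add_left dF_tcoord_inner[OF x])
    moreover have "D (normal_part v w) x u = D (\<lambda>y. D2 F y v w) x u - D (\<lambda>y. D F y (Y y)) x u"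
      unfolding normal_part_def Y_def[symmetric] by (rule frechet_derivative_diff[OF d2 dY])
    ultimately show ?thesis unfolding Y by (simp add: inner_diff_left)
  qed
  have "lie_bracket (\<lambda>_. u) (\<lambda>_. v) = (\<lambda>_. 0)"
    by (rule ext) (simp add: lie_bracket_def)
  then have br: "cov_deriv G (lie_bracket (\<lambda>_. u) (\<lambda>_. v)) (\<lambda>_. w) x = 0"
    by (simp add: cov_deriv_def christoffel_map_def zero_vec_def[symmetric])
  \<comment> \<open>Flatness of the ambient space, as symmetry of the third derivative in its two
    outer directions.\<close>
  have "D (\<lambda>y. D2 F y v w) x u = D (\<lambda>y. D2 F y u w) x v"
    by (rule second_derivative_symmetric[OF smooth_dF open_S x])
  then show ?thesis
    unfolding curvature_def curvature_fields_def br
    by (simp add: linear_diff[OF linear_dF[OF x]] inner_diff_left cov)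
qed

end

section \<open>Hypersurfaces of the sphere\<close>

text \<open>Built from operators that are bounded linear in \<open>a\<close> and in
  \<open>b\<close>, so that smoothness in both vectors is inherited.\<close>

definition outer :: "'a::euclidean_space \<Rightarrow> 'a \<Rightarrow> 'a \<Rightarrow>\<^sub>L 'a" where
  "outer a b = blinfun_scaleR_left b o\<^sub>L blinfun_inner_left a"

lemma outer_apply [simp]: "blinfun_apply (outer a b) e = (e \<bullet> a) *\<^sub>R b"
  by (simp add: outer_def)

lemma smooth_on_outer:
  assumes "open S" "smooth_on S f" "smooth_on S g"
  shows "smooth_on S (\<lambda>x. outer (f x) (g x))"
  unfolding outer_def
  by (intro smooth_on_blinfun_compose assms smooth_on_bounded_linear[OF _ bounded_linear_blinfun_scaleR_left]
      smooth_on_bounded_linear[OF _ bounded_linear_blinfun_inner_left])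

text \<open>The hypersurface as a submanifold of codimension two in Euclidean space, with
  orthonormal normal frame \<open>F\<close>, \<open>N\<close>: the position vector is normal to the
  sphere, and \<open>N\<close> is normal to the hypersurface within it.\<close>

locale sphere_hypersurface = immersion S F G
  for S :: "(real^'m::finite) set" and F :: "real^'m \<Rightarrow> 'a::euclidean_space"
    and G :: "real^'m \<Rightarrow> real^'m^'m" +
  fixes N :: "real^'m \<Rightarrow> 'a"
  assumes smooth_N: "smooth_on S N"
    and FF: "x \<in> S \<Longrightarrow> F x \<bullet> F x = 1"
    and NN: "x \<in> S \<Longrightarrow> N x \<bullet> N x = 1"
    and FN: "x \<in> S \<Longrightarrow> F x \<bullet> N x = 0"
    and N_dF: "x \<in> S \<Longrightarrow> N x \<bullet> D F x u = 0"
    and dim_eq: "DIM('a) = CARD('m) + 2"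
begin

section \<open>Differentiated orthogonality relations and the ambient splitting\<close>

lemma smooth_dN: "smooth_on S (\<lambda>x. D N x u)"
  by (rule smooth_on_frechet_derivative[OF smooth_N])

lemma diff_F: "x \<in> S \<Longrightarrow> F differentiable at x"
  and diff_N: "x \<in> S \<Longrightarrow> N differentiable at x"
  and diff_dF: "x \<in> S \<Longrightarrow> (\<lambda>y. D F y u) differentiable at x"
  and diff_dN: "x \<in> S \<Longrightarrow> (\<lambda>y. D N y u) differentiable at x"
  by (rule smooth_on_differentiable[OF _ open_S]; simp add: smooth_F smooth_N smooth_dF smooth_dN)+

lemma linear_dN: "x \<in> S \<Longrightarrow> linear (D N x)"
  by (rule smooth_on_linear_derivative[OF smooth_N open_S])

lemma F_dF: assumes x: "x \<in> S" shows "F x \<bullet> D F x u = 0"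
proof -
  have "D (\<lambda>y. F y \<bullet> F y) x u = 0"
    by (rule frechet_derivative_cong_const[OF open_S x FF])
  then show ?thesis by (simp add: frechet_derivative_inner[OF diff_F[OF x] diff_F[OF x]] inner_commute)
qed

lemma N_dN: assumes x: "x \<in> S" shows "N x \<bullet> D N x u = 0"
proof -
  have "D (\<lambda>y. N y \<bullet> N y) x u = 0"
    by (rule frechet_derivative_cong_const[OF open_S x NN])
  then show ?thesis by (simp add: frechet_derivative_inner[OF diff_N[OF x] diff_N[OF x]] inner_commute)
qed

lemma F_dN: assumes x: "x \<in> S" shows "F x \<bullet> D N x u = 0"
proof -
  have "D (\<lambda>y. F y \<bullet> N y) x u = 0"
    by (rule frechet_derivative_cong_const[OF open_S x FN])
  then show ?thesis
    using N_dF[OF x] by (simp add: frechet_derivative_inner[OF diff_F[OF x] diff_N[OF x]] inner_commute)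
qed

lemma N_D2F: assumes x: "x \<in> S" shows "N x \<bullet> D2 F x u v = - (D N x u \<bullet> D F x v)"
proof -
  have "D (\<lambda>y. N y \<bullet> D F y v) x u = 0"
    by (rule frechet_derivative_cong_const[OF open_S x N_dF])
  then show ?thesis by (simp add: frechet_derivative_inner[OF diff_N[OF x] diff_dF[OF x]])
qed

text \<open>The position vector acts as a second unit normal whose shape operator is minus the
  identity; this is how the curvature of the sphere enters.\<close>

lemma F_D2F: assumes x: "x \<in> S" shows "F x \<bullet> D2 F x u v = - (D F x u \<bullet> D F x v)"
proof -
  have "D (\<lambda>y. F y \<bullet> D F y v) x u = 0"
    by (rule frechet_derivative_cong_const[OF open_S x F_dF])
  then show ?thesis by (simp add: frechet_derivative_inner[OF diff_F[OF x] diff_dF[OF x]])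
qed

text \<open>A dimension count: tangent space, \<open>F\<close> and \<open>N\<close> are mutually
  orthogonal and their dimensions add up to m + 2, so the remainder is orthogonal to
  everything.\<close>

lemma decomposition:
  assumes x: "x \<in> S"
  shows "e = D F x (tcoord x e) + (e \<bullet> F x) *\<^sub>R F x + (e \<bullet> N x) *\<^sub>R N x"
proof -
  let ?T = "range (D F x)"
  define r where "r = e - (D F x (tcoord x e) + (e \<bullet> F x) *\<^sub>R F x + (e \<bullet> N x) *\<^sub>R N x)"
  have orth: "r \<bullet> y = 0" if "y \<in> insert (F x) (insert (N x) ?T)" for y
    using that FF[OF x] NN[OF x] FN[OF x] F_dF[OF x] N_dF[OF x]
    by (auto simp: r_def inner_diff_left inner_add_left dF_tcoord_inner[OF x]
        inner_commute[of "N x" "F x"] inner_commute[of "D F x _" "F x"] inner_commute[of "D F x _" "N x"])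
  have "N x \<notin> span ?T"
    using orthogonal_to_span[of "N x" ?T "N x"] N_dF[OF x] NN[OF x] by (auto simp: orthogonal_def)
  moreover have "F x \<notin> span (insert (N x) ?T)"
    using orthogonal_to_span[of "F x" "insert (N x) ?T" "F x"] F_dF[OF x] FF[OF x] FN[OF x]
    by (auto simp: orthogonal_def)
  moreover have "dim ?T = CARD('m)"
    using dim_image_eq[OF linear_dF[OF x], of UNIV] inj_dF[OF x] by simp
  ultimately have "dim (insert (F x) (insert (N x) ?T)) = DIM('a)"
    using dim_eq by (simp add: dim_insert)
  then have "span (insert (F x) (insert (N x) ?T)) = UNIV" by (simp add: dim_eq_full)
  then have "r \<bullet> r = 0"
    using orthogonal_to_span[of r "insert (F x) (insert (N x) ?T)" r] orth
    by (auto simp: orthogonal_def)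
  then show ?thesis by (simp add: r_def)
qed

lemma tangentI:
  assumes "x \<in> S" "e \<bullet> F x = 0" "e \<bullet> N x = 0"
  shows "D F x (tcoord x e) = e"
  using decomposition[OF assms(1), of e] assms(2,3) by simp

section \<open>The shape operator, its ambient extension and the Codazzi equation\<close>

definition shape :: "real^'m \<Rightarrow> real^'m \<Rightarrow> real^'m" where
  "shape x u = tcoord x (- D N x u)"

lemma dF_shape: assumes x: "x \<in> S" shows "D F x (shape x u) = - D N x u"
  unfolding shape_def
  by (rule tangentI[OF x]) (simp_all add: F_dN[OF x] N_dN[OF x] inner_commute)

lemma linear_shape: "x \<in> S \<Longrightarrow> linear (shape x)"
  unfolding shape_def
  by (intro linear_compose[OF _ linear_tcoord, unfolded o_def] linear_compose_neg linear_dN)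

text \<open>The shape operator, transported to the ambient space and extended by zero to the normal
  directions \<open>F\<close> and \<open>N\<close>. Differentiating this extension in the flat ambient space replaces
  covariant differentiation of the shape operator.\<close>

definition A :: "real^'m \<Rightarrow> 'a \<Rightarrow>\<^sub>L 'a" where
  "A x = (\<Sum>b\<in>Basis. outer b (- (\<Sum>i\<in>UNIV. tcoord x b $ i *\<^sub>R D N x (axis i 1))))"

text \<open>The sum of rank-one operators makes \<open>A\<close> visibly smooth; expanding the
  argument in \<open>Basis\<close> recovers the Weingarten formula.\<close>

lemma A_apply: assumes x: "x \<in> S" shows "A x e = - D N x (tcoord x e)"
proof -
  have lin: "linear (\<lambda>e. - D N x (tcoord x e))"
    by (intro linear_compose_neg linear_compose[OF linear_tcoord linear_dN[OF x], unfolded o_def])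
  have "A x e = (\<Sum>b\<in>Basis. (e \<bullet> b) *\<^sub>R (- D N x (tcoord x b)))"
    unfolding A_def
    by (simp add: blinfun.sum_left linear_vec_expand[OF linear_dN[OF x], symmetric])
  also have "\<dots> = - D N x (tcoord x (\<Sum>b\<in>Basis. (e \<bullet> b) *\<^sub>R b))"
    by (simp only: linear_sum[OF lin] linear_cmul[OF lin])
  finally show ?thesis by (simp add: euclidean_representation)
qed

lemma smooth_A: "smooth_on S A"
proof -
  have "smooth_on S (\<lambda>x. tcoord x b)" for b
    by (rule smooth_tcoord[OF open_S smooth_on_ident[OF open_S] _ smooth_on_const[OF open_S]])
  then show ?thesis
    unfolding A_def
    by (intro smooth_on_sum smooth_on_outer smooth_on_minus smooth_on_scaleR smooth_on_vec_nth
        smooth_on_const smooth_dN open_S)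
qed

lemma smooth_dA: "smooth_on S (\<lambda>x. D A x u)"
  by (rule smooth_on_frechet_derivative[OF smooth_A])

lemma diff_A: "x \<in> S \<Longrightarrow> A differentiable at x"
  and diff_dA: "x \<in> S \<Longrightarrow> (\<lambda>y. D A y u) differentiable at x"
  by (rule smooth_on_differentiable[OF _ open_S]; simp add: smooth_A smooth_dA)+

lemma A_dF: "x \<in> S \<Longrightarrow> A x (D F x u) = - D N x u"
  by (simp add: A_apply tcoord_dF)

lemma A_dF_shape: "x \<in> S \<Longrightarrow> A x (D F x u) = D F x (shape x u)"
  by (simp add: A_dF dF_shape)

lemma A_F: "x \<in> S \<Longrightarrow> A x (F x) = 0"
  by (simp add: A_apply tcoord_normal F_dF linear_0[OF linear_dN])

lemma A_N: "x \<in> S \<Longrightarrow> A x (N x) = 0"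
  by (simp add: A_apply tcoord_normal N_dF linear_0[OF linear_dN])

lemma A_inner_F: "x \<in> S \<Longrightarrow> A x e \<bullet> F x = 0"
  by (simp add: A_apply F_dN inner_commute)

lemma A_inner_N: "x \<in> S \<Longrightarrow> A x e \<bullet> N x = 0"
  by (simp add: A_apply N_dN inner_commute)

text \<open>Self-adjointness on the whole ambient space is reduced to symmetry of the second
  derivative of \<open>F\<close>; normal components drop out on both sides.\<close>

lemma A_inner: assumes x: "x \<in> S" shows "A x a \<bullet> b = N x \<bullet> D2 F x (tcoord x a) (tcoord x b)"
proof -
  have "A x a \<bullet> b = A x a \<bullet> (D F x (tcoord x b) + (b \<bullet> F x) *\<^sub>R F x + (b \<bullet> N x) *\<^sub>R N x)"
    using decomposition[OF x, of b] by simp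
  also have "\<dots> = A x a \<bullet> D F x (tcoord x b)"
    by (simp add: inner_add_right A_inner_F[OF x] A_inner_N[OF x])
  finally show ?thesis by (simp add: A_apply[OF x] N_D2F[OF x])
qed

lemma A_sym: "x \<in> S \<Longrightarrow> A x a \<bullet> b = a \<bullet> A x b"
  using A_inner[of x a b] A_inner[of x b a] D2F_commute[of x "tcoord x a" "tcoord x b"]
  by (simp add: inner_commute)

lemma D2F_inner_N: "x \<in> S \<Longrightarrow> D2 F x u v \<bullet> N x = A x (D F x u) \<bullet> D F x v"
  by (simp add: A_inner tcoord_dF inner_commute[of _ "N x"])

lemma D2F_inner_F: "x \<in> S \<Longrightarrow> D2 F x u v \<bullet> F x = - (D F x u \<bullet> D F x v)"
  by (subst inner_commute) (rule F_D2F)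

lemma bounded_linear_functional: "bounded_linear (\<lambda>T :: 'a \<Rightarrow>\<^sub>L 'a. T a \<bullet> b)"
  by (rule bounded_linear_compose[OF bounded_linear_inner_left blinfun.bounded_linear_left])

lemma dA_sym: assumes x: "x \<in> S" shows "D A x u a \<bullet> b = a \<bullet> D A x u b"
proof -
  have "(\<lambda>y. A y b \<bullet> a) differentiable at x"
    by (rule smooth_on_differentiable[OF smooth_on_bounded_linear[OF open_S
            bounded_linear_functional smooth_A] open_S x])
  moreover have "A y b \<bullet> a = A y a \<bullet> b" if "y \<in> S" for y
    using A_sym[OF that, of b a] by (simp add: inner_commute)
  ultimately have "D (\<lambda>y. A y a \<bullet> b) x u = D (\<lambda>y. A y b \<bullet> a) x u"
    by (rule frechet_derivative_cong_open[OF _ open_S x])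
  then show ?thesis
    by (simp add: frechet_derivative_bounded_linear[OF bounded_linear_functional diff_A[OF x]]
        inner_commute[of a])
qed

lemma D2A_sym: assumes x: "x \<in> S" shows "D2 A x v u a \<bullet> b = a \<bullet> D2 A x v u b"
proof -
  have "(\<lambda>y. D A y u b \<bullet> a) differentiable at x"
    by (rule smooth_on_differentiable[OF smooth_on_bounded_linear[OF open_S
            bounded_linear_functional smooth_dA] open_S x])
  moreover have "D A y u b \<bullet> a = D A y u a \<bullet> b" if "y \<in> S" for y
    using dA_sym[OF that, of u b a] by (simp add: inner_commute)
  ultimately have "D (\<lambda>y. D A y u a \<bullet> b) x v = D (\<lambda>y. D A y u b \<bullet> a) x v"
    by (rule frechet_derivative_cong_open[OF _ open_S x])
  then show ?thesis
    by (simp add: frechet_derivative_bounded_linear[OF bounded_linear_functional diff_dA[OF x]]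
        inner_commute[of a])
qed

lemma D2A_commute: "x \<in> S \<Longrightarrow> D2 A x u v a \<bullet> b = D2 A x v u a \<bullet> b"
  using second_derivative_symmetric_functional[OF smooth_A open_S _ bounded_linear_functional] .

lemma dA_dF: assumes x: "x \<in> S" shows "D A x u (D F x v) = - D2 N x u v - A x (D2 F x u v)"
proof -
  have "D (\<lambda>y. A y (D F y v)) x u = D (\<lambda>y. - D N y v) x u"
    by (rule frechet_derivative_cong_open[OF _ open_S x])
      (auto intro: differentiable_minus diff_dN[OF x] simp: A_dF)
  then show ?thesis
    by (simp add: frechet_derivative_blinfun_apply[OF diff_A[OF x] diff_dF[OF x]]
        frechet_derivative_minus[OF diff_dN[OF x]] algebra_simps eq_diff_eq)
qed

text \<open>Differentiating \<open>A (dF v) = - dN v\<close> expresses the left side through second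
  derivatives of \<open>N\<close> and \<open>F\<close>, which are symmetric. The equation holds for
  the full ambient vectors, normal components included.\<close>

lemma codazzi: "x \<in> S \<Longrightarrow> D A x u (D F x v) = D A x v (D F x u)"
  using second_derivative_symmetric[OF smooth_N open_S, of x u v] D2F_commute[of x u v]
  by (simp add: dA_dF)

text \<open>This value and the one on \<open>N\<close> record how the tangent space turns in the
  ambient space. In Cartan's identity they produce the summands 1 and ab respectively.\<close>

lemma dA_F: assumes x: "x \<in> S" shows "D A x u (F x) = - A x (D F x u)"
proof -
  have "D (\<lambda>y. A y (F y)) x u = 0"
    by (rule frechet_derivative_cong_const[OF open_S x A_F])
  then show ?thesis
    by (simp add: frechet_derivative_blinfun_apply[OF diff_A[OF x] diff_F[OF x]] eq_neg_iff_add_eq_0 add.commute)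
qed

lemma dA_N: assumes x: "x \<in> S" shows "D A x u (N x) = A x (A x (D F x u))"
proof -
  have "D (\<lambda>y. A y (N y)) x u = 0"
    by (rule frechet_derivative_cong_const[OF open_S x A_N])
  then show ?thesis
    by (simp add: frechet_derivative_blinfun_apply[OF diff_A[OF x] diff_N[OF x]] A_dF[OF x]
        eq_neg_iff_add_eq_0 add.commute blinfun.minus_right)
qed

section \<open>Eigenspaces and smooth spectral projections\<close>

definition proj :: "real^'m \<Rightarrow> 'a \<Rightarrow>\<^sub>L 'a" where
  "proj x = id_blinfun - outer (F x) (F x) - outer (N x) (N x)"

lemma proj_eq: assumes "x \<in> S" shows "proj x e = D F x (tcoord x e)"
proof -
  have "t = e - p - q" if "e = t + p + q" for t p q :: 'a
    using that by simp
  from this[OF decomposition[OF assms]]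
  have "D F x (tcoord x e) = e - (e \<bullet> F x) *\<^sub>R F x - (e \<bullet> N x) *\<^sub>R N x" .
  then show ?thesis by (simp add: proj_def blinfun.diff_left)
qed

lemma smooth_proj: "smooth_on S proj"
  unfolding proj_def
  by (intro smooth_on_diff smooth_on_const smooth_on_outer open_S smooth_F smooth_N)

lemma A_proj: "x \<in> S \<Longrightarrow> A x (proj x e) = A x e"
  by (simp add: proj_def blinfun.diff_left blinfun.diff_right blinfun.scaleR_right A_F A_N)

text \<open>The identity (A - a)(A - b)(A - c) = 0 on the tangent space, where \<open>proj\<close>
  is the identity. The roots are the same at all points of \<open>S\<close>, which permits
  differentiating the resulting eigenvector fields without derivatives of eigenvalues.\<close>

definition annihilated :: "real \<Rightarrow> real \<Rightarrow> real \<Rightarrow> bool" where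
  "annihilated a b c \<longleftrightarrow> (\<forall>x\<in>S. \<forall>e. A x (A x (A x e)) - (a + b + c) *\<^sub>R A x (A x e)
     + (a * b + b * c + c * a) *\<^sub>R A x e - (a * b * c) *\<^sub>R proj x e = 0)"

lemma annihilated_commute:
  "annihilated a b c \<Longrightarrow> annihilated b a c" "annihilated a b c \<Longrightarrow> annihilated a c b"
  unfolding annihilated_def by (simp_all add: algebra_simps)

text \<open>If \<open>annihilated a b c\<close>, this is \<open>(b - a)(b - c)\<close> times the orthogonal projection to the eigenspace
  of \<open>b\<close>, and it depends smoothly on the point.\<close>

definition eproj :: "real \<Rightarrow> real \<Rightarrow> real^'m \<Rightarrow> 'a \<Rightarrow>\<^sub>L 'a" where
  "eproj a c x = (A x o\<^sub>L A x) - (a + c) *\<^sub>R A x + (a * c) *\<^sub>R proj x"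

lemma eproj_apply: "eproj a c x e = A x (A x e) - (a + c) *\<^sub>R A x e + (a * c) *\<^sub>R proj x e"
  by (simp add: eproj_def blinfun.add_left blinfun.diff_left blinfun.scaleR_left)

lemma smooth_eproj: "smooth_on S (eproj a c)"
  unfolding eproj_def
  by (intro smooth_on_add smooth_on_diff smooth_on_scaleR smooth_on_const smooth_on_blinfun_compose
      open_S smooth_A smooth_proj)

lemma A_eproj:
  assumes "annihilated a b c" "x \<in> S"
  shows "A x (eproj a c x e) = b *\<^sub>R eproj a c x e"
proof -
  have "A x (eproj a c x e) = A x (A x (A x e)) - (a + c) *\<^sub>R A x (A x e) + (a * c) *\<^sub>R A x e"
    by (simp add: eproj_apply blinfun.add_right blinfun.diff_right blinfun.scaleR_right A_proj[OF assms(2)])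
  also have "\<dots> = b *\<^sub>R A x (A x e) - (b * (a + c)) *\<^sub>R A x e + (b * (a * c)) *\<^sub>R proj x e"
  proof -
    have "p - (a + c) *\<^sub>R q + (a * c) *\<^sub>R r = b *\<^sub>R q - (b * (a + c)) *\<^sub>R r + (b * (a * c)) *\<^sub>R s"
      if "p - (a + b + c) *\<^sub>R q + (a * b + b * c + c * a) *\<^sub>R r - (a * b * c) *\<^sub>R s = 0"
      for p q r s :: 'a
      using that by (simp add: algebra_simps)
    then show ?thesis using assms unfolding annihilated_def by blast
  qed
  also have "\<dots> = b *\<^sub>R eproj a c x e"
    by (simp add: eproj_apply scaleR_add_right scaleR_diff_right)
  finally show ?thesis .
qed

definition eigen :: "real^'m \<Rightarrow> real \<Rightarrow> 'a set" where
  "eigen x \<kappa> = {y. y \<bullet> F x = 0 \<and> y \<bullet> N x = 0 \<and> A x y = \<kappa> *\<^sub>R y}"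

lemma eigen_dF: "x \<in> S \<Longrightarrow> y \<in> eigen x \<kappa> \<Longrightarrow> D F x (tcoord x y) = y"
  unfolding eigen_def by (simp add: tangentI)

lemma eigen_orthogonal:
  assumes "x \<in> S" "y \<in> eigen x a" "z \<in> eigen x b" "a \<noteq> b"
  shows "y \<bullet> z = 0"
proof -
  have "a * (y \<bullet> z) = b * (y \<bullet> z)"
    using A_sym[OF assms(1), of y z] assms(2,3) by (simp add: eigen_def)
  then show ?thesis using \<open>a \<noteq> b\<close> by simp
qed

lemma eproj_eigen:
  assumes "annihilated a b c" "x \<in> S"
  shows "eproj a c x e \<in> eigen x b"
  using A_eproj[OF assms] assms(2)
  by (simp add: eigen_def eproj_apply inner_add_left inner_diff_left A_inner_F A_inner_N proj_eq
      inner_commute[of "D F x _"] F_dF N_dF)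

lemma proj_eigen: "x \<in> S \<Longrightarrow> y \<in> eigen x \<kappa> \<Longrightarrow> proj x y = y"
  by (simp add: proj_eq eigen_dF)

lemma proj_sym: "proj x p \<bullet> r = p \<bullet> proj x r"
  by (simp add: proj_def blinfun.diff_left inner_diff_left inner_diff_right
      inner_commute[of "F x" r] inner_commute[of "N x" r] mult.commute)

lemma eproj_sym: "x \<in> S \<Longrightarrow> eproj a c x p \<bullet> r = p \<bullet> eproj a c x r"
  by (simp add: eproj_apply inner_add_left inner_diff_left inner_add_right inner_diff_right A_sym proj_sym)

lemma eproj_on_eigen:
  assumes "x \<in> S" "y \<in> eigen x b"
  shows "eproj a c x y = ((b - a) * (b - c)) *\<^sub>R y"
  using assms(2) proj_eigen[OF assms]
  by (simp add: eproj_apply eigen_def blinfun.scaleR_right algebra_simps)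

text \<open>Differentiates \<open>A E = b E\<close> for \<open>E = eproj a c\<close>. As
  \<open>b\<close> is constant, the derivative of \<open>A\<close> sends \<open>E e\<close> into the
  range of \<open>b - A\<close>.\<close>

lemma eproj_derivative:
  assumes "annihilated a b c" and x: "x \<in> S"
  shows "D A x u (eproj a c x e) = b *\<^sub>R D (eproj a c) x u e - A x (D (eproj a c) x u e)"
proof -
  have dE: "eproj a c differentiable at x"
    by (rule smooth_on_differentiable[OF smooth_eproj open_S x])
  have dEe: "(\<lambda>y. eproj a c y e) differentiable at x"
    by (rule smooth_on_differentiable[OF smooth_on_blinfun_apply[OF open_S smooth_eproj smooth_on_const[OF open_S]] open_S x])
  have e: "D (\<lambda>y. eproj a c y e) x u = D (eproj a c) x u e"
    by (rule frechet_derivative_bounded_linear[OF blinfun.bounded_linear_left dE])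
  have "D (\<lambda>y. A y (eproj a c y e)) x u = D (\<lambda>y. b *\<^sub>R eproj a c y e) x u"
    by (rule frechet_derivative_cong_open[OF _ open_S x])
      (auto intro: differentiable_scaleR[OF differentiable_const dEe] simp: A_eproj[OF assms(1)])
  then show ?thesis
    using frechet_derivative_bounded_linear[OF bounded_linear_scaleR_right dEe, of b]
    by (simp add: frechet_derivative_blinfun_apply[OF diff_A[OF x] dEe] e algebra_simps)
qed

text \<open>By self-adjointness the range of \<open>b - A\<close> is orthogonal to the eigenspace of
  \<open>b\<close>; and \<open>y\<close> is a nonzero multiple of
  \<open>eproj a c x y\<close>.\<close>

lemma dA_eigen_eigen:
  assumes ann: "annihilated a b c" and "b \<noteq> a" "b \<noteq> c" and x: "x \<in> S"
    and y: "y \<in> eigen x b" and z: "z \<in> eigen x b"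
  shows "D A x u y \<bullet> z = 0"
proof -
  have "D A x u (eproj a c x y) \<bullet> z =
      b * (D (eproj a c) x u y \<bullet> z) - A x (D (eproj a c) x u y) \<bullet> z"
    by (simp add: eproj_derivative[OF ann x] inner_diff_left)
  also have "\<dots> = 0" using z by (simp add: A_sym[OF x] eigen_def)
  finally show ?thesis
    using assms(2,3) by (simp add: eproj_on_eigen[OF x y] blinfun.scaleR_right)
qed

text \<open>The vector \<open>y\<close> is extended to the eigenvector field
  \<open>eproj a c x' y\<close>, along which the diagonal entry of the derivative of
  \<open>A\<close> vanishes identically. Differentiating that identity trades the second derivative
  of \<open>A\<close> for the derivative of the field.\<close>

lemma D2A_eigen_eigen:
  assumes ann: "annihilated a b c" and "b \<noteq> a" "b \<noteq> c" and x: "x \<in> S"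
    and y: "y \<in> eigen x b" and w: "D A x u y \<in> eigen x c"
  shows "(b - c) * (D2 A x u u y \<bullet> y) = - 2 * (D A x u y \<bullet> D A x u y)"
proof -
  define q where "q = (b - a) * (b - c)"
  have "q \<noteq> 0" using assms(2,3) by (simp add: q_def)
  let ?W = "\<lambda>x'. eproj a c x' y"
  let ?e = "D (eproj a c) x u y"
  have dE: "eproj a c differentiable at x"
    by (rule smooth_on_differentiable[OF smooth_eproj open_S x])
  have dW: "?W differentiable at x"
    by (rule smooth_on_differentiable[OF smooth_on_blinfun_apply[OF open_S smooth_eproj smooth_on_const[OF open_S]] open_S x])
  have W': "D ?W x u = ?e"
    by (rule frechet_derivative_bounded_linear[OF blinfun.bounded_linear_left dE])
  have W: "?W x = q *\<^sub>R y" by (simp add: eproj_on_eigen[OF x y] q_def)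
  have dBW: "(\<lambda>x'. D A x' u (?W x')) differentiable at x"
    by (rule smooth_on_differentiable[OF smooth_on_blinfun_apply[OF open_S smooth_dA
            smooth_on_blinfun_apply[OF open_S smooth_eproj smooth_on_const[OF open_S]]] open_S x])
  have "D (\<lambda>x'. D A x' u (?W x') \<bullet> ?W x') x u = 0"
  proof (rule frechet_derivative_cong_const[OF open_S x])
    fix x' assume x': "x' \<in> S"
    show "D A x' u (?W x') \<bullet> ?W x' = 0"
      by (rule dA_eigen_eigen[OF ann assms(2,3) x' eproj_eigen[OF ann x'] eproj_eigen[OF ann x']])
  qed
  then have "q\<^sup>2 * (D2 A x u u y \<bullet> y) + 2 * q * (?e \<bullet> D A x u y) = 0"
    using dA_sym[OF x, of u ?e y]
    by (simp add: frechet_derivative_inner[OF dBW dW] W' W blinfun.scaleR_right inner_add_left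
        frechet_derivative_blinfun_apply[OF diff_dA[OF x] dW] inner_commute[of "D A x u y" ?e]
        power2_eq_square algebra_simps)
  then have "q * (q * (D2 A x u u y \<bullet> y) + 2 * (?e \<bullet> D A x u y)) = 0"
    by (simp add: power2_eq_square algebra_simps)
  then have 1: "q * (D2 A x u u y \<bullet> y) = - 2 * (?e \<bullet> D A x u y)"
    using \<open>q \<noteq> 0\<close> by simp
  \<comment> \<open>The derivative \<open>?e\<close> of the field is needed only in its product with
    \<open>D A x u y\<close>. As that vector lies in the eigenspace of \<open>c\<close>, the factor
    \<open>b - A\<close> acts there as \<open>b - c\<close>.\<close>
  have "q * (D A x u y \<bullet> D A x u y) = D A x u (?W x) \<bullet> D A x u y"
    by (simp add: W blinfun.scaleR_right)
  also have "\<dots> = b * (?e \<bullet> D A x u y) - ?e \<bullet> A x (D A x u y)"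
    by (simp add: eproj_derivative[OF ann x] inner_diff_left A_sym[OF x])
  also have "\<dots> = (b - c) * (?e \<bullet> D A x u y)"
    using w by (simp add: eigen_def algebra_simps)
  finally have "q * ((b - c) * (D2 A x u u y \<bullet> y)) = q * (- 2 * (D A x u y \<bullet> D A x u y))"
    using 1 by (simp add: algebra_simps)
  then show ?thesis using \<open>q \<noteq> 0\<close> by (simp only: mult_cancel_left) simp
qed

section \<open>Cartan's identity\<close>

lemma dA_eigen_inner_normal:
  assumes x: "x \<in> S" and u: "D F x u \<in> eigen x a" and y: "y \<in> eigen x b"
  shows "D A x u y \<bullet> F x = - a * (D F x u \<bullet> y)" "D A x u y \<bullet> N x = a\<^sup>2 * (D F x u \<bullet> y)"
  using u y
  by (simp_all add: dA_sym[OF x] dA_F[OF x] dA_N[OF x] eigen_def blinfun.scaleR_right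
      inner_commute[of y] power2_eq_square)

text \<open>The vector is orthogonal to the eigenspace of \<open>b\<close> directly, and to that of
  \<open>a\<close> after Codazzi exchanges the two arguments. Orthogonality of \<open>U\<close> and
  \<open>y\<close> removes the normal components, so only the eigenspace of \<open>c\<close> is
  left.\<close>

lemma dA_eigen:
  assumes ann: "annihilated a b c" and "a \<noteq> b" "a \<noteq> c" "b \<noteq> c" and x: "x \<in> S"
    and u: "D F x u \<in> eigen x a" and y: "y \<in> eigen x b"
  shows "D A x u y \<in> eigen x c"
proof -
  define v where "v = tcoord x y"
  have yv: "y = D F x v" by (simp add: v_def eigen_dF[OF x y])
  define w where "w = D A x u y"
  have w': "w = D A x v (D F x u)" unfolding w_def yv by (rule codazzi[OF x])
  have "D F x u \<bullet> y = 0" by (rule eigen_orthogonal[OF x u y \<open>a \<noteq> b\<close>])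
  then have wF: "w \<bullet> F x = 0" and wN: "w \<bullet> N x = 0"
    using dA_eigen_inner_normal[OF x u y] by (simp_all add: w_def)
  have ann': "annihilated b a c" by (rule annihilated_commute(1)[OF ann])
  have E: "eproj a' c x w = 0"
    if "annihilated a' b' c" and orth: "\<And>z. z \<in> eigen x b' \<Longrightarrow> w \<bullet> z = 0" for a' b'
  proof -
    have "eproj a' c x w \<bullet> eproj a' c x w = 0"
      using orth[OF eproj_eigen[OF that(1) x]] by (simp add: eproj_sym[OF x])
    then show ?thesis by simp
  qed
  have "w \<bullet> z = 0" if "z \<in> eigen x b" for z
    unfolding w_def using dA_eigen_eigen[OF ann _ \<open>b \<noteq> c\<close> x y that] \<open>a \<noteq> b\<close> by simp
  then have Ea: "eproj a c x w = 0" by (rule E[OF ann])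
  have "w \<bullet> z = 0" if "z \<in> eigen x a" for z
    unfolding w' using dA_eigen_eigen[OF ann' \<open>a \<noteq> b\<close> \<open>a \<noteq> c\<close> x u that] .
  then have Eb: "eproj b c x w = 0" by (rule E[OF ann'])
  have pw: "proj x w = w" using wF wN by (simp add: proj_def blinfun.diff_left)
  \<comment> \<open>The polynomials (t - b)(t - c) and (t - a)(t - c) differ by (a - b)(t -
    c).\<close>
  have "(a - b) *\<^sub>R (A x w - c *\<^sub>R w) = eproj b c x w - eproj a c x w"
    by (simp add: eproj_apply pw algebra_simps)
  then have "A x w = c *\<^sub>R w" using Ea Eb \<open>a \<noteq> b\<close> by simp
  then show ?thesis using wF wN by (simp add: eigen_def w_def)
qed

text \<open>For a principal vector \<open>V\<close> the tangential part of \<open>D A x v V\<close>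
  vanishes, by Codazzi and \<open>dA_eigen_eigen\<close>. What remains is |V|^2 (b^2 N - b F), to be
  paired with the normal part |U|^2 (a N - F) of \<open>D2 F x u u\<close>.\<close>

lemma D2F_inner_dA_diagonal:
  assumes ann: "annihilated a b c" and "b \<noteq> a" "b \<noteq> c" and x: "x \<in> S"
    and u: "A x (D F x u) = a *\<^sub>R D F x u" and v: "D F x v \<in> eigen x b"
  shows "D2 F x u u \<bullet> D A x v (D F x v) =
    b * (1 + a * b) * (D F x u \<bullet> D F x u) * (D F x v \<bullet> D F x v)"
proof -
  let ?z = "D A x v (D F x v)"
  have "?z \<bullet> D F x w = 0" for w
  proof -
    have "?z \<bullet> D F x w = D F x v \<bullet> D A x w (D F x v)"
      by (simp add: dA_sym[OF x] codazzi[OF x, of v w])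
    then show ?thesis
      using dA_eigen_eigen[OF ann assms(2,3) x v v] by (simp add: inner_commute)
  qed
  then have "?z = (?z \<bullet> F x) *\<^sub>R F x + (?z \<bullet> N x) *\<^sub>R N x"
    using decomposition[OF x, of ?z] by (simp add: tcoord_normal linear_0[OF linear_dF[OF x]])
  also have "\<dots> = (D F x v \<bullet> D F x v) *\<^sub>R (b\<^sup>2 *\<^sub>R N x - b *\<^sub>R F x)"
    by (simp add: dA_eigen_inner_normal[OF x v v] algebra_simps)
  finally have "D2 F x u u \<bullet> ?z =
      D2 F x u u \<bullet> ((D F x v \<bullet> D F x v) *\<^sub>R (b\<^sup>2 *\<^sub>R N x - b *\<^sub>R F x))"
    by (rule arg_cong)
  then show ?thesis
    by (simp add: inner_diff_right D2F_inner_N[OF x] D2F_inner_F[OF x] u power2_eq_square algebra_simps)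
qed

text \<open>The two mixed second derivatives of the extended shape operator, evaluated on \<open>U\<close> and \<open>V\<close>,
  agree; comparing them through the differentiated Codazzi equation replaces the Gauss equation.\<close>

lemma cartan_identity:
  assumes ann: "annihilated a b c" and ne: "a \<noteq> b" "a \<noteq> c" "b \<noteq> c" and x: "x \<in> S"
    and u: "D F x u \<in> eigen x a" and v: "D F x v \<in> eigen x b"
  shows "2 * (D A x u (D F x v) \<bullet> D A x u (D F x v)) =
    (1 + a * b) * (a - c) * (b - c) * (D F x u \<bullet> D F x u) * (D F x v \<bullet> D F x v)"
proof -
  have ann': "annihilated b a c" by (rule annihilated_commute(1)[OF ann])
  let ?U = "D F x u" and ?V = "D F x v"
  define w where "w = D A x u ?V"
  have w': "D A x v ?U = w" unfolding w_def by (rule codazzi[OF x])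
  have wc: "w \<in> eigen x c" unfolding w_def by (rule dA_eigen[OF ann ne x u v])
  define X Y where "X = D2 A x u u ?V \<bullet> ?V" and "Y = D2 A x v v ?U \<bullet> ?U"
  have X: "(b - c) * X = - 2 * (w \<bullet> w)"
    unfolding X_def w_def
    using D2A_eigen_eigen[OF ann _ ne(3) x v] wc ne(1) unfolding w_def by simp
  have Y: "(a - c) * Y = - 2 * (w \<bullet> w)"
    using D2A_eigen_eigen[OF ann' ne(1,2) x u, where u = v] wc unfolding Y_def w' by simp
  \<comment> \<open>Codazzi holds throughout \<open>S\<close>, so it may be differentiated. The
    terms with \<open>D2 F\<close> appear because \<open>u\<close> and \<open>v\<close> are constant
    in the chart while the tangent vectors they represent turn in the ambient space.\<close>
  have dcod: "D2 A x t u ?V + D A x u (D2 F x t v) = D2 A x t v ?U + D A x v (D2 F x t u)" for t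
  proof -
    have diff: "(\<lambda>y. D A y v (D F y u)) differentiable at x"
      by (rule smooth_on_differentiable[OF smooth_on_blinfun_apply[OF open_S smooth_dA smooth_dF] open_S x])
    have "D (\<lambda>y. D A y u (D F y v)) x t = D (\<lambda>y. D A y v (D F y u)) x t"
      by (rule frechet_derivative_cong_open[OF diff open_S x]) (rule codazzi)
    then show ?thesis
      by (simp add: frechet_derivative_blinfun_apply[OF diff_dA[OF x] diff_dF[OF x]] add.commute)
  qed
  have "X + D2 F x u v \<bullet> w = D2 A x u v ?U \<bullet> ?V + D2 F x u u \<bullet> D A x v ?V"
    using arg_cong[OF dcod[of u], of "\<lambda>z. z \<bullet> ?V"]
    by (simp add: X_def inner_add_left dA_sym[OF x] w_def)
  moreover have "D2 A x v u ?V \<bullet> ?U + D2 F x v v \<bullet> D A x u ?U = Y + D2 F x v u \<bullet> w"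
    using arg_cong[OF dcod[of v], of "\<lambda>z. z \<bullet> ?U"]
    by (simp add: Y_def inner_add_left dA_sym[OF x] w')
  \<comment> \<open>The link between the two versions of the differentiated Codazzi equation: second
    derivatives of \<open>A\<close> commute and are self-adjoint.\<close>
  moreover have "D2 A x u v ?U \<bullet> ?V = D2 A x v u ?V \<bullet> ?U"
    using D2A_commute[OF x] D2A_sym[OF x] by (simp add: inner_commute)
  ultimately have "X - D2 F x u u \<bullet> D A x v ?V = Y - D2 F x v v \<bullet> D A x u ?U"
    using D2F_commute[OF x, of u v] by simp
  moreover have "D2 F x u u \<bullet> D A x v ?V = b * (1 + a * b) * (?U \<bullet> ?U) * (?V \<bullet> ?V)"
    using D2F_inner_dA_diagonal[OF ann _ ne(3) x _ v, of u] ne(1) u by (simp add: eigen_def)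
  moreover have "D2 F x v v \<bullet> D A x u ?U = a * (1 + b * a) * (?V \<bullet> ?V) * (?U \<bullet> ?U)"
    using D2F_inner_dA_diagonal[OF ann' ne(1,2) x _ u, of v] v by (simp add: eigen_def)
  ultimately have XY: "X - Y = (b - a) * ((1 + a * b) * (?U \<bullet> ?U) * (?V \<bullet> ?V))"
    by (simp add: algebra_simps)
  \<comment> \<open>This combination clears the denominators of \<open>X\<close> and
    \<open>Y\<close>; the factor arises as (b - c) - (a - c) = b - a.\<close>
  have "(b - a) * (2 * (w \<bullet> w)) = (a - c) * ((b - c) * X) - (b - c) * ((a - c) * Y)"
    unfolding X Y by (simp add: algebra_simps)
  also have "\<dots> = (b - a) * ((1 + a * b) * (a - c) * (b - c) * (?U \<bullet> ?U) * (?V \<bullet> ?V))"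
    using arg_cong[OF XY, of "\<lambda>z. (a - c) * (b - c) * z"] by (simp add: algebra_simps)
  finally show ?thesis using ne(1) unfolding w_def by simp
qed

text \<open>With \<open>w\<close> the derivative of \<open>A\<close> along \<open>U\<close> applied
  to \<open>V\<close>, self-adjointness gives |w|^2 = <D A w, V>, the derivative again being along
  \<open>U\<close>. Cauchy-Schwarz bounds this by |D A w| |V|, and Cartan's identity evaluates |D A
  w|, with \<open>b\<close> and \<open>c\<close> exchanged, and |w| itself.\<close>

lemma cartan_constant_le:
  assumes ann: "annihilated a b c" and ne: "a \<noteq> b" "a \<noteq> c" "b \<noteq> c" and x: "x \<in> S"
    and u: "D F x u \<in> eigen x a" "D F x u \<noteq> 0" and v: "D F x v \<in> eigen x b" "D F x v \<noteq> 0"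
    and z: "D F x z \<in> eigen x c" "D F x z \<noteq> 0"
  shows "(1 + a * b) * (a - c) * (b - c) \<le> (1 + a * c) * (a - b) * (c - b)"
    (is "?kb \<le> ?kc")
proof -
  let ?U = "D F x u" and ?V = "D F x v"
  have pos: "?U \<bullet> ?U > 0" "?V \<bullet> ?V > 0" using u v by auto
  have ann': "annihilated a c b" by (rule annihilated_commute(2)[OF ann])
  define w where "w = D A x u ?V"
  have wc: "w \<in> eigen x c" unfolding w_def by (rule dA_eigen[OF ann ne x u(1) v(1)])
  have kb: "2 * (w \<bullet> w) = ?kb * (?U \<bullet> ?U) * (?V \<bullet> ?V)"
    unfolding w_def by (rule cartan_identity[OF ann ne x u(1) v(1)])
  have kc: "2 * (D A x u y \<bullet> D A x u y) = ?kc * (?U \<bullet> ?U) * (y \<bullet> y)" if "y \<in> eigen x c" for y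
    using cartan_identity[OF ann' ne(2,1) _ x u(1), of "tcoord x y"] ne(3) that
    by (simp add: eigen_dF[OF x that])
  \<comment> \<open>Settles the case \<open>w = 0\<close>, where the comparison through
    \<open>w\<close> is void: the identity for the pair \<open>u\<close>, \<open>z\<close> makes
    \<open>?kc\<close> times a positive number a squared length.\<close>
  have "?kc \<ge> 0"
  proof -
    have "0 \<le> ?kc * (?U \<bullet> ?U * (D F x z \<bullet> D F x z))"
    proof -
      have "0 \<le> 2 * (D A x u (D F x z) \<bullet> D A x u (D F x z))" by simp
      then show ?thesis unfolding kc[OF z(1)] by (simp only: mult.assoc)
    qed
    moreover have "?U \<bullet> ?U * (D F x z \<bullet> D F x z) > 0" using pos z by simp
    ultimately show ?thesis by (simp add: zero_le_mult_iff)
  qed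
  show ?thesis
  proof (cases "w = 0")
    case True
    then have "?kb = 0" using kb pos by simp
    then show ?thesis using \<open>?kc \<ge> 0\<close> by linarith
  next
    case False
    have "w \<bullet> w = D A x u w \<bullet> ?V" by (simp add: w_def dA_sym[OF x])
    then have "(w \<bullet> w) * (w \<bullet> w) \<le> (D A x u w \<bullet> D A x u w) * (?V \<bullet> ?V)"
      using Cauchy_Schwarz_ineq[of "D A x u w" ?V] by (simp add: power2_eq_square)
    then have "2 * ((w \<bullet> w) * (w \<bullet> w)) \<le> 2 * (D A x u w \<bullet> D A x u w) * (?V \<bullet> ?V)" by simp
    also have "\<dots> = (w \<bullet> w) * (?kc * (?U \<bullet> ?U) * (?V \<bullet> ?V))"
      unfolding kc[OF wc] by (simp add: mult_ac)
    finally have "(w \<bullet> w) * (2 * (w \<bullet> w)) \<le> (w \<bullet> w) * (?kc * (?U \<bullet> ?U) * (?V \<bullet> ?V))"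
      by (simp add: mult_ac)
    moreover have "w \<bullet> w > 0" using False by simp
    ultimately have "2 * (w \<bullet> w) \<le> ?kc * (?U \<bullet> ?U) * (?V \<bullet> ?V)"
      using mult_le_cancel_left_pos by blast
    then have "?kb * (?U \<bullet> ?U * (?V \<bullet> ?V)) \<le> ?kc * (?U \<bullet> ?U * (?V \<bullet> ?V))"
      unfolding kb by (simp add: mult.assoc)
    then show ?thesis using pos mult_le_cancel_right_pos mult_pos_pos by blast
  qed
qed

section \<open>Equality of Cartan's constants and of the multiplicities\<close>

lemma shape_eigen:
  assumes x: "x \<in> S"
  shows "shape x u = \<kappa> *\<^sub>R u \<longleftrightarrow> D F x u \<in> eigen x \<kappa>"
proof -
  have "shape x u = \<kappa> *\<^sub>R u \<longleftrightarrow> D F x (shape x u) = D F x (\<kappa> *\<^sub>R u)"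
    using inj_dF[OF x] by (simp add: inj_eq)
  then show ?thesis
    using F_dF[OF x, of u] N_dF[OF x, of u]
    by (simp add: eigen_def A_dF_shape[OF x] linear_cmul[OF linear_dF[OF x]] inner_commute)
qed

text \<open>Differentiation of \<open>A\<close> along \<open>U\<close> maps the eigenspace of
  \<open>b\<close> into that of \<open>c\<close>, and by Cartan's identity it multiplies squared
  lengths by a fixed nonzero factor, so it is injective.\<close>

lemma dim_eigenspace_le:
  assumes ann: "annihilated a b c" and ne: "a \<noteq> b" "a \<noteq> c" "b \<noteq> c" and x: "x \<in> S"
    and u: "D F x u \<in> eigen x a" "D F x u \<noteq> 0" and "(1 + a * b) * (a - c) * (b - c) \<noteq> 0"
  shows "dim {v. shape x v = b *\<^sub>R v} \<le> dim {v. shape x v = c *\<^sub>R v}"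
proof -
  let ?E = "\<lambda>\<kappa>. {v. shape x v = \<kappa> *\<^sub>R v}"
  let ?L = "\<lambda>v. tcoord x (D A x u (D F x v))"
  have lin: "linear ?L"
    by (intro linear_compose[OF _ linear_tcoord, unfolded o_def]
        linear_compose[OF linear_dF[OF x] bounded_linear.linear[OF blinfun.bounded_linear_right[of "D A x u"]], unfolded o_def])
  have sub: "subspace (?E b)"
    using linear_shape[OF x]
    by (auto simp: subspace_def linear_0 linear_add linear_cmul scaleR_add_right)
  have dFL: "D F x (?L v) = D A x u (D F x v)" and L: "?L v \<in> ?E c" if "v \<in> ?E b" for v
  proof -
    have "D F x v \<in> eigen x b" using that by (simp add: shape_eigen[OF x])
    then have "D A x u (D F x v) \<in> eigen x c" by (rule dA_eigen[OF ann ne x u(1)])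
    then show "D F x (?L v) = D A x u (D F x v)" "?L v \<in> ?E c"
      by (simp_all add: shape_eigen[OF x] eigen_dF[OF x])
  qed
  have "v = 0" if "v \<in> ?E b" "?L v = 0" for v
  proof -
    have "D A x u (D F x v) = 0"
      using dFL[OF that(1)] that(2) by (simp add: linear_0[OF linear_dF[OF x]])
    then have "(1 + a * b) * (a - c) * (b - c) * (D F x u \<bullet> D F x u) * (D F x v \<bullet> D F x v) = 0"
      using cartan_identity[OF ann ne x u(1), of v] that(1) by (simp add: shape_eigen[OF x])
    then have "D F x v = D F x 0" using assms(8) u(2) by (simp add: linear_0[OF linear_dF[OF x]])
    then show ?thesis using inj_dF[OF x] by (simp add: inj_eq)
  qed
  then have "inj_on ?L (?E b)"
    unfolding linear_injective_on_subspace_0[OF lin sub] by blast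
  moreover have "span (?E b) = ?E b" using sub by (simp only: span_eq_iff)
  ultimately have "inj_on ?L (span (?E b))" by (simp only:)
  from dim_image_eq[OF lin this] have "dim (?E b) = dim (?L ` ?E b)" by (rule sym)
  also have "\<dots> \<le> dim (?E c)" using L by (intro dim_subset) blast
  finally show ?thesis .
qed

text \<open>The comparison of constants, applied with each of the three curvatures in turn as the
  shared one, closes a cycle of inequalities. Equality of multiplicities then comes from injections
  in both directions.\<close>

lemma cartan_equal_multiplicities:
  assumes ann: "annihilated a b c" and ne: "a \<noteq> b" "a \<noteq> c" "b \<noteq> c" and x: "x \<in> S"
    and "\<And>\<kappa>. \<kappa> \<in> {a, b, c} \<Longrightarrow> \<exists>u. u \<noteq> 0 \<and> shape x u = \<kappa> *\<^sub>R u"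
  shows "(1 + a * b) * (a - c) = (1 + a * c) * (b - a)"
    "(1 + b * c) * (b - a) = (1 + b * a) * (c - b)"
    "dim {v. shape x v = b *\<^sub>R v} = dim {v. shape x v = c *\<^sub>R v}"
    "dim {v. shape x v = a *\<^sub>R v} = dim {v. shape x v = b *\<^sub>R v}"
proof -
  have ev: "\<exists>u. D F x u \<in> eigen x \<kappa> \<and> D F x u \<noteq> 0" if "\<kappa> \<in> {a, b, c}" for \<kappa>
  proof -
    obtain u where u: "u \<noteq> 0" "shape x u = \<kappa> *\<^sub>R u" using assms(6)[OF \<open>\<kappa> \<in> {a, b, c}\<close>] by blast
    have "D F x u \<noteq> D F x 0" using inj_dF[OF x] u(1) by (simp add: inj_eq)
    then show ?thesis using u(2) by (auto simp: shape_eigen[OF x] linear_0[OF linear_dF[OF x]])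
  qed
  obtain u v z where u: "D F x u \<in> eigen x a" "D F x u \<noteq> 0" and v: "D F x v \<in> eigen x b" "D F x v \<noteq> 0"
    and z: "D F x z \<in> eigen x c" "D F x z \<noteq> 0"
    using ev[of a] ev[of b] ev[of c] by auto
  note p = annihilated_commute
  note abc = ann and acb = p(2)[OF ann] and bac = p(1)[OF ann]
  have bca: "annihilated b c a" by (rule p(2)[OF bac])
  have cab: "annihilated c a b" by (rule p(1)[OF acb])
  have cba: "annihilated c b a" by (rule p(2)[OF cab])
  note ne' = ne ne[symmetric]
  define K1 K2 K3 where "K1 = (1 + a * b) * (a - c) * (b - c)" and "K2 = (1 + a * c) * (a - b) * (c - b)"
    and "K3 = (1 + b * c) * (b - a) * (c - a)"
  have "K1 \<le> K2" using cartan_constant_le[OF abc ne x u v z] by (simp add: K1_def K2_def)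
  moreover have "K2 \<le> K3"
    using cartan_constant_le[OF cab ne'(5,6,1) x z u v] by (simp add: K2_def K3_def mult_ac)
  moreover have "K3 \<le> K1"
    using cartan_constant_le[OF bca ne'(3,4,5) x v z u] by (simp add: K1_def K3_def mult_ac)
  ultimately have K: "K1 = K2" "K2 = K3" by auto
  have "(b - c) * ((1 + a * b) * (a - c)) = (b - c) * ((1 + a * c) * (b - a))"
    using K(1) by (simp add: K1_def K2_def algebra_simps)
  then show 1: "(1 + a * b) * (a - c) = (1 + a * c) * (b - a)" using ne(3) by simp
  have "(c - a) * ((1 + b * c) * (b - a)) = (c - a) * ((1 + b * a) * (c - b))"
    using K by (simp add: K1_def K3_def algebra_simps)
  then show 2: "(1 + b * c) * (b - a) = (1 + b * a) * (c - b)" using ne(2) by simp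
  \<comment> \<open>If the common value were zero, both ab and ac would equal -1; since
    \<open>b\<close> and \<open>c\<close> differ, this forces \<open>a = 0\<close>, which is
    absurd.\<close>
  have "K1 \<noteq> 0"
  proof
    assume "K1 = 0"
    then have "1 + a * b = 0" "1 + a * c = 0" using K ne by (auto simp: K1_def K2_def)
    then have "a * b = a * c" by linarith
    then have "a = 0" using ne(3) by simp
    then show False using \<open>1 + a * b = 0\<close> by simp
  qed
  then have nz: "(1 + a * b) * (a - c) * (b - c) \<noteq> 0" "(1 + a * c) * (a - b) * (c - b) \<noteq> 0"
    "(1 + c * a) * (c - b) * (a - b) \<noteq> 0" "(1 + c * b) * (c - a) * (b - a) \<noteq> 0"
    using K by (auto simp: K1_def K2_def K3_def mult_ac)
  show "dim {v. shape x v = b *\<^sub>R v} = dim {v. shape x v = c *\<^sub>R v}"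
    using dim_eigenspace_le[OF abc ne x u nz(1)] dim_eigenspace_le[OF acb ne(2,1) ne'(6) x u nz(2)] by simp
  show "dim {v. shape x v = a *\<^sub>R v} = dim {v. shape x v = b *\<^sub>R v}"
    using dim_eigenspace_le[OF cab ne'(5,6,1) x z nz(3)] dim_eigenspace_le[OF cba ne'(6,5,4) x z nz(4)]
    by simp
qed

subsection \<open>Traces\<close>

text \<open>Bridges the chart trace and traces in an orthonormal set. The set may be the fixed
  ambient \<open>Basis\<close>, which makes traces easy to differentiate, or a basis of the tangent
  space by eigenvectors, which makes them easy to evaluate.\<close>

lemma sum_orthonormal_eq_metric_trace:
  assumes x: "x \<in> S" and B: "finite B" "pairwise orthogonal B" "\<forall>b\<in>B. norm b = 1"
    and span: "range (D F x) \<subseteq> span B" and K: "linear K"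
  shows "(\<Sum>b\<in>B. K (D F x (tcoord x b)) \<bullet> b) = metric_trace G x (\<lambda>u v. K (D F x u) \<bullet> D F x v)"
proof -
  have lin: "linear (\<lambda>u. K (D F x u))"
    using linear_compose[OF linear_dF[OF x] K] by (simp add: o_def)
  have "(\<Sum>b\<in>B. K (D F x (tcoord x b)) \<bullet> b) =
      (\<Sum>b\<in>B. \<Sum>i\<in>UNIV. \<Sum>j\<in>UNIV. matrix_inv (G x) $ i $ j *
        ((D F x (axis j 1) \<bullet> b) * (K (D F x (axis i 1)) \<bullet> b)))"
    by (rule sum.cong[OF refl], subst linear_vec_expand[OF lin])
      (simp add: inner_sum_left tcoord_def matrix_vector_mult_def sum_distrib_right mult.assoc)
  also have "\<dots> = (\<Sum>i\<in>UNIV. \<Sum>j\<in>UNIV. matrix_inv (G x) $ i $ j *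
        (\<Sum>b\<in>B. (D F x (axis j 1) \<bullet> b) * (K (D F x (axis i 1)) \<bullet> b)))"
    by (simp add: sum_distrib_left sum.swap[of _ UNIV B])
  also have "\<dots> = metric_trace G x (\<lambda>u v. K (D F x u) \<bullet> D F x v)"
  proof -
    have "(\<Sum>b\<in>B. (D F x p \<bullet> b) * (q \<bullet> b)) = q \<bullet> D F x p" for p q
      using orthonormal_parseval[OF B, of "D F x p" q] span
      by (simp add: image_subset_iff inner_commute[of q])
    then show ?thesis by (simp add: metric_trace_def)
  qed
  finally show ?thesis .
qed

lemma metric_trace_A: "x \<in> S \<Longrightarrow> metric_trace G x (\<lambda>u v. A x (D F x u) \<bullet> D F x v) = trace (matrix (shape x))"
  by (simp add: A_dF_shape metric_trace_operator)

lemma metric_trace_AA: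
  "x \<in> S \<Longrightarrow> metric_trace G x (\<lambda>u v. A x (A x (D F x u)) \<bullet> D F x v) =
    trace (matrix (\<lambda>u. shape x (shape x u)))"
  by (simp add: A_dF_shape metric_trace_operator)

text \<open>The trace of the shape operator equals the trace of \<open>A\<close> in the fixed
  ambient basis, where it can be differentiated term by term; being constant, it has derivative
  zero.\<close>

lemma metric_trace_dA_tangent:
  assumes x: "x \<in> S" and const: "\<And>y. y \<in> S \<Longrightarrow> trace (matrix (shape y)) = T"
  shows "metric_trace G x (\<lambda>u v. D A x w (D F x u) \<bullet> D F x v) = 0"
proof -
  have basis: "finite (Basis :: 'a set)" "pairwise orthogonal (Basis :: 'a set)"
    "\<forall>b\<in>(Basis :: 'a set). norm b = 1" "range (D F x) \<subseteq> span (Basis :: 'a set)" for x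
    by (auto simp: pairwise_def orthogonal_def inner_Basis)
  have tr: "(\<Sum>b\<in>Basis. A y b \<bullet> b) = T" if y: "y \<in> S" for y
  proof -
    have "A y b = A y (D F y (tcoord y b))" for b
      using A_proj[OF y, of b] by (simp add: proj_eq[OF y])
    then have "(\<Sum>b\<in>Basis. A y b \<bullet> b) = (\<Sum>b\<in>Basis. A y (D F y (tcoord y b)) \<bullet> b)"
      by simp
    also have "\<dots> = T"
      using sum_orthonormal_eq_metric_trace[OF y basis, of "A y"] const[OF y]
      by (simp add: metric_trace_A[OF y] bounded_linear.linear[OF blinfun.bounded_linear_right])
    finally show ?thesis .
  qed
  have "(\<Sum>b\<in>Basis. D A x w b \<bullet> b) = D (\<lambda>y. \<Sum>b\<in>Basis. A y b \<bullet> b) x w"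
  proof -
    have "(\<lambda>y. A y b \<bullet> b) differentiable at x" for b
      by (rule smooth_on_differentiable[OF smooth_on_bounded_linear[OF open_S
            bounded_linear_functional smooth_A] open_S x])
    then show ?thesis
      by (simp add: frechet_derivative_sum
          frechet_derivative_bounded_linear[OF bounded_linear_functional diff_A[OF x]])
  qed
  also have "\<dots> = 0"
    by (rule frechet_derivative_cong_const[OF open_S x tr])
  finally have sum0: "(\<Sum>b\<in>Basis. D A x w b \<bullet> b) = 0" .
  have "D A x w b \<bullet> b = D A x w (D F x (tcoord x b)) \<bullet> b
      + (b \<bullet> F x) * (D A x w (F x) \<bullet> b) + (b \<bullet> N x) * (D A x w (N x) \<bullet> b)" for b
    using arg_cong[OF decomposition[OF x, of b], of "\<lambda>z. D A x w z \<bullet> b"]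
    by (simp add: blinfun.add_right blinfun.scaleR_right inner_add_left)
  moreover have "(\<Sum>b\<in>Basis. (b \<bullet> p) * (q \<bullet> b)) = p \<bullet> q" for p q :: 'a
    unfolding euclidean_inner[of p q] by (simp only: inner_commute[of _ p])
  ultimately have "(\<Sum>b\<in>Basis. D A x w b \<bullet> b) = (\<Sum>b\<in>Basis. D A x w (D F x (tcoord x b)) \<bullet> b)
      + F x \<bullet> D A x w (F x) + N x \<bullet> D A x w (N x)"
    by (simp only: sum.distrib)
  \<comment> \<open>The derivative of \<open>A\<close> sends both normals into the tangent space, so
    the normal directions contribute nothing to its trace.\<close>
  moreover have "F x \<bullet> D A x w (F x) = 0" "N x \<bullet> D A x w (N x) = 0"
    using A_inner_F[OF x] A_inner_N[OF x] by (simp_all add: dA_F[OF x] dA_N[OF x] inner_commute)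
  ultimately show ?thesis
    using sum0 sum_orthonormal_eq_metric_trace[OF x basis, of "D A x w"]
    by (simp add: bounded_linear.linear[OF blinfun.bounded_linear_right])
qed

text \<open>The divergence of \<open>A\<close>: by Codazzi its tangential part is the gradient of
  the trace, hence zero, and the values of the derivative on the normals give the rest.\<close>

lemma metric_trace_dA:
  assumes x: "x \<in> S" and const: "\<And>y. y \<in> S \<Longrightarrow> trace (matrix (shape y)) = T"
  shows "metric_trace G x (\<lambda>u v. D A x u (D F x v)) =
    trace (matrix (\<lambda>u. shape x (shape x u))) *\<^sub>R N x - T *\<^sub>R F x"
proof -
  let ?\<beta> = "metric_trace G x (\<lambda>u v. D A x u (D F x v))"
  have "?\<beta> \<bullet> D F x w = 0" for w
  proof -
    have "D A x u (D F x v) \<bullet> D F x w = D A x w (D F x u) \<bullet> D F x v" for u v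
      using dA_sym[OF x, of u "D F x v" "D F x w"] codazzi[OF x, of u w]
      by (simp add: inner_commute)
    then show ?thesis
      using metric_trace_dA_tangent[OF assms] by (simp add: metric_trace_inner)
  qed
  moreover have "?\<beta> \<bullet> F x = - T"
  proof -
    have "D A x u (D F x v) \<bullet> F x = - (A x (D F x u) \<bullet> D F x v)" for u v
      by (simp add: dA_sym[OF x] dA_F[OF x] inner_commute[of "D F x v"])
    then show ?thesis
      by (simp add: metric_trace_inner metric_trace_uminus metric_trace_A[OF x] const[OF x])
  qed
  moreover have "?\<beta> \<bullet> N x = trace (matrix (\<lambda>u. shape x (shape x u)))"
  proof -
    have "D A x u (D F x v) \<bullet> N x = A x (A x (D F x u)) \<bullet> D F x v" for u v
      by (simp add: dA_sym[OF x] dA_N[OF x] inner_commute[of "D F x v"])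
    then show ?thesis by (simp add: metric_trace_inner metric_trace_AA[OF x])
  qed
  ultimately show ?thesis
    using decomposition[OF x, of ?\<beta>] by (simp add: tcoord_normal linear_0[OF linear_dF[OF x]])
qed

subsection \<open>Diagonalization of the shape operator\<close>

lemma shape_eigenbasis:
  assumes x: "x \<in> S"
  obtains B where "finite B" "pairwise orthogonal B" "\<forall>b\<in>B. norm b = 1" "span B = range (D F x)"
    "\<forall>b\<in>B. \<exists>\<kappa>. b \<in> eigen x \<kappa> \<and> (\<exists>u. u \<noteq> 0 \<and> shape x u = \<kappa> *\<^sub>R u)"
proof -
  have "subspace (range (D F x))"
    by (rule linear_subspace_image[OF linear_dF[OF x] subspace_UNIV])
  moreover have "A x y \<in> range (D F x)" if "y \<in> range (D F x)" for y
    using that A_dF_shape[OF x] by auto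
  ultimately obtain B where B: "B \<subseteq> range (D F x)" "finite B" "pairwise orthogonal B"
    "\<forall>b\<in>B. norm b = 1" "span B = range (D F x)" "\<forall>b\<in>B. \<exists>\<kappa>. A x b = \<kappa> *\<^sub>R b"
    using selfadjoint_eigenbasis[of "A x" "range (D F x)"] A_sym[OF x]
      bounded_linear.linear[OF blinfun.bounded_linear_right[of "A x"]] by blast
  have "\<exists>\<kappa>. b \<in> eigen x \<kappa> \<and> (\<exists>u. u \<noteq> 0 \<and> shape x u = \<kappa> *\<^sub>R u)" if b: "b \<in> B" for b
  proof -
    obtain \<kappa> where \<kappa>: "A x b = \<kappa> *\<^sub>R b" using B(6) b by blast
    obtain u where u: "b = D F x u" using B(1) b by blast
    have e: "b \<in> eigen x \<kappa>"
      using F_dF[OF x, of u] N_dF[OF x, of u] \<kappa> by (simp add: eigen_def u inner_commute)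
    have "u \<noteq> 0" using B(4) b u by (auto simp: linear_0[OF linear_dF[OF x]])
    then show ?thesis using e by (auto simp: shape_eigen[OF x] u)
  qed
  then show ?thesis using that[OF B(2-5)] by blast
qed

text \<open>Diagonalizability turns information on the eigenvalues alone into a polynomial identity:
  the cubic kills every member of an eigenbasis, hence the tangent space.\<close>

lemma annihilatedI:
  assumes "\<And>x u \<kappa>. \<lbrakk>x \<in> S; u \<noteq> 0; shape x u = \<kappa> *\<^sub>R u\<rbrakk> \<Longrightarrow> \<kappa> \<in> {a, b, c}"
  shows "annihilated a b c"
  unfolding annihilated_def
proof (intro ballI allI)
  fix x e assume x: "x \<in> S"
  define f where "f y = A x (A x (A x y)) - (a + b + c) *\<^sub>R A x (A x y)
     + (a * b + b * c + c * a) *\<^sub>R A x y - (a * b * c) *\<^sub>R y" for y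
  have lin: "linear f"
    by (rule linearI) (simp_all add: f_def blinfun.add_right blinfun.scaleR_right algebra_simps)
  obtain B where "finite B" "pairwise orthogonal B" "\<forall>b\<in>B. norm b = 1" and B: "span B = range (D F x)"
    and ev: "\<forall>y\<in>B. \<exists>\<kappa>. y \<in> eigen x \<kappa> \<and> (\<exists>u. u \<noteq> 0 \<and> shape x u = \<kappa> *\<^sub>R u)"
    by (rule shape_eigenbasis[OF x])
  have "f y = 0" if yB: "y \<in> B" for y
  proof -
    obtain \<kappa> where y: "A x y = \<kappa> *\<^sub>R y" and "\<kappa> \<in> {a, b, c}"
      using bspec[OF ev yB] assms[OF x] unfolding eigen_def by blast
    have "f y = ((\<kappa> - a) * (\<kappa> - b) * (\<kappa> - c)) *\<^sub>R y"
      by (simp add: f_def y blinfun.scaleR_right algebra_simps)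
    then show ?thesis using \<open>\<kappa> \<in> {a, b, c}\<close> by auto
  qed
  moreover have "proj x e \<in> span B" by (simp add: B proj_eq[OF x])
  ultimately have "f (proj x e) = 0" using linear_eq_0_on_span[OF lin] by blast
  then show "A x (A x (A x e)) - (a + b + c) *\<^sub>R A x (A x e)
     + (a * b + b * c + c * a) *\<^sub>R A x e - (a * b * c) *\<^sub>R proj x e = 0"
    by (simp add: f_def A_proj[OF x])
qed

text \<open>The trace is taken in an eigenbasis, which splits into bases of the three eigenspaces.
  Exponent 0 is included: with \<open>0 ^ 0 = 1\<close> it gives m as the sum of the
  multiplicities.\<close>

lemma trace_shape_power:
  assumes x: "x \<in> S" and ne: "a \<noteq> b" "a \<noteq> c" "b \<noteq> c"
    and eig: "\<And>u \<kappa>. \<lbrakk>u \<noteq> 0; shape x u = \<kappa> *\<^sub>R u\<rbrakk> \<Longrightarrow> \<kappa> \<in> {a, b, c}"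
  shows "trace (matrix (shape x ^^ k)) =
    (\<Sum>\<kappa>\<in>{a, b, c}. real (dim {u. shape x u = \<kappa> *\<^sub>R u}) * \<kappa> ^ k)"
proof -
  obtain B where B: "finite B" "pairwise orthogonal B" "\<forall>b\<in>B. norm b = 1" "span B = range (D F x)"
    and ev: "\<forall>y\<in>B. \<exists>\<kappa>. y \<in> eigen x \<kappa> \<and> (\<exists>u. u \<noteq> 0 \<and> shape x u = \<kappa> *\<^sub>R u)"
    by (rule shape_eigenbasis[OF x])
  define C where "C \<kappa> = B \<inter> eigen x \<kappa>" for \<kappa>
  have nz: "0 \<notin> B" using B(3) by auto
  have dimC: "dim {u. shape x u = \<kappa> *\<^sub>R u} = card (C \<kappa>)" for \<kappa>
  proof -
    have sub: "subspace (eigen x \<kappa>)"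
      unfolding subspace_def eigen_def
      by (auto simp: inner_add_left blinfun.add_right blinfun.scaleR_right blinfun.zero_right algebra_simps)
    have "eigen x \<kappa> = span (C \<kappa>)"
    proof
      show "span (C \<kappa>) \<subseteq> eigen x \<kappa>" by (rule span_minimal) (auto simp: C_def sub)
      show "eigen x \<kappa> \<subseteq> span (C \<kappa>)"
      proof
        fix y assume y: "y \<in> eigen x \<kappa>"
        have "y \<in> span B" using eigen_dF[OF x y] B(4) by (metis rangeI)
        have "(y \<bullet> b) *\<^sub>R b \<in> span (C \<kappa>)" if b: "b \<in> B" for b
        proof (cases "b \<in> eigen x \<kappa>")
          case True
          then show ?thesis using b by (simp add: C_def span_base span_scale)
        next
          case False
          obtain \<kappa>' where "b \<in> eigen x \<kappa>'" using bspec[OF ev b] by blast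
          then have "y \<bullet> b = 0" using eigen_orthogonal[OF x y] False by metis
          then show ?thesis by (simp add: span_zero)
        qed
        then have "(\<Sum>b\<in>B. (y \<bullet> b) *\<^sub>R b) \<in> span (C \<kappa>)" by (intro span_sum)
        then show "y \<in> span (C \<kappa>)"
          using orthonormal_expansion[OF B(1-3) \<open>y \<in> span B\<close>] by simp
      qed
    qed
    moreover have "independent (C \<kappa>)"
      by (rule pairwise_orthogonal_independent)
        (use B(2) nz in \<open>auto simp: C_def intro: pairwise_subset\<close>)
    ultimately have "dim (eigen x \<kappa>) = card (C \<kappa>)" by (simp add: dim_eq_card_independent)
    moreover have "eigen x \<kappa> = D F x ` {u. shape x u = \<kappa> *\<^sub>R u}"
    proof
      show "eigen x \<kappa> \<subseteq> D F x ` {u. shape x u = \<kappa> *\<^sub>R u}"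
      proof
        fix y assume y: "y \<in> eigen x \<kappa>"
        then have "shape x (tcoord x y) = \<kappa> *\<^sub>R tcoord x y"
          by (simp add: shape_eigen[OF x] eigen_dF[OF x])
        then show "y \<in> D F x ` {u. shape x u = \<kappa> *\<^sub>R u}"
          using eigen_dF[OF x y] by (metis (mono_tags, lifting) image_eqI mem_Collect_eq)
      qed
    qed (auto simp: shape_eigen[OF x])
    moreover have "inj_on (D F x) (span {u. shape x u = \<kappa> *\<^sub>R u})"
      using inj_dF[OF x] by (rule inj_on_subset) simp
    ultimately show ?thesis using dim_image_eq[OF linear_dF[OF x]] by metis
  qed
  have linA: "linear (A x)" by (rule bounded_linear.linear[OF blinfun.bounded_linear_right])
  have linAk: "linear (blinfun_apply (A x) ^^ k)"
    by (induction k) (use linear_compose[OF _ linA] in \<open>simp_all add: linear_id[unfolded id_def] o_def\<close>)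
  have dFk: "D F x ((shape x ^^ k) u) = (blinfun_apply (A x) ^^ k) (D F x u)" for u
    by (induction k) (simp_all add: A_dF_shape[OF x, symmetric])
  have Bt: "D F x (tcoord x y) = y" if "y \<in> B" for y
    using bspec[OF ev that] eigen_dF[OF x] by blast
  have "trace (matrix (shape x ^^ k)) =
      metric_trace G x (\<lambda>u v. (blinfun_apply (A x) ^^ k) (D F x u) \<bullet> D F x v)"
    using metric_trace_operator[OF x, of "shape x ^^ k"] by (simp add: dFk)
  also have "\<dots> = (\<Sum>y\<in>B. (blinfun_apply (A x) ^^ k) y \<bullet> y)"
    using sum_orthonormal_eq_metric_trace[OF x B(1-3) _ linAk] B(4) by (simp add: Bt)
  also have "\<dots> = (\<Sum>y\<in>B. \<Sum>\<kappa>\<in>{a, b, c}. if y \<in> eigen x \<kappa> then \<kappa> ^ k else 0)"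
  proof (rule sum.cong[OF refl])
    fix y assume y: "y \<in> B"
    obtain \<kappa> where \<kappa>: "y \<in> eigen x \<kappa>" "\<kappa> \<in> {a, b, c}" using bspec[OF ev y] eig by blast
    have "y \<noteq> 0" using nz y by blast
    have iff: "y \<in> eigen x \<kappa>' \<longleftrightarrow> \<kappa>' = \<kappa>" for \<kappa>'
      using \<kappa>(1) \<open>y \<noteq> 0\<close> unfolding eigen_def by auto
    have "(blinfun_apply (A x) ^^ k) y = \<kappa> ^ k *\<^sub>R y"
      using \<kappa>(1) by (induction k) (auto simp: eigen_def blinfun.scaleR_right mult.commute)
    then have "(blinfun_apply (A x) ^^ k) y \<bullet> y = \<kappa> ^ k"
      using B(3) y by (simp add: dot_square_norm)
    moreover have "(\<Sum>\<kappa>'\<in>{a, b, c}. if y \<in> eigen x \<kappa>' then \<kappa>' ^ k else 0) = \<kappa> ^ k"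
      unfolding iff using \<kappa>(2) by (simp add: sum.delta)
    ultimately show "(blinfun_apply (A x) ^^ k) y \<bullet> y =
        (\<Sum>\<kappa>\<in>{a, b, c}. if y \<in> eigen x \<kappa> then \<kappa> ^ k else 0)" by simp
  qed
  also have "\<dots> = (\<Sum>\<kappa>\<in>{a, b, c}. real (card (C \<kappa>)) * \<kappa> ^ k)"
    by (subst sum.swap) (simp add: sum.If_cases[OF B(1)] C_def Int_def)
  finally show ?thesis unfolding dimC .
qed

end

section \<open>The bitension field in the charts of the sphere\<close>

locale sphere_param = immersion V \<psi> H
  for V :: "(real^'n::finite) set" and \<psi> :: "real^'n \<Rightarrow> 'a::euclidean_space"
    and H :: "real^'n \<Rightarrow> real^'n^'n" +
  assumes unit: "y \<in> V \<Longrightarrow> \<psi> y \<bullet> \<psi> y = 1" and dim_param: "DIM('a) = CARD('n) + 1"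
begin

lemma diff_param: "y \<in> V \<Longrightarrow> \<psi> differentiable at y"
  and diff_dparam: "y \<in> V \<Longrightarrow> (\<lambda>y. D \<psi> y u) differentiable at y"
  by (rule smooth_on_differentiable[OF _ open_S]; simp add: smooth_F smooth_dF)+

lemma param_orth: assumes y: "y \<in> V" shows "\<psi> y \<bullet> D \<psi> y u = 0"
proof -
  have "D (\<lambda>y. \<psi> y \<bullet> \<psi> y) y u = 0"
    by (rule frechet_derivative_cong_const[OF open_S y unit])
  then show ?thesis
    by (simp add: frechet_derivative_inner[OF diff_param[OF y] diff_param[OF y]] inner_commute)
qed

lemma param_D2: assumes y: "y \<in> V" shows "D2 \<psi> y u v \<bullet> \<psi> y = - (D \<psi> y u \<bullet> D \<psi> y v)"
proof -
  have "D (\<lambda>y. \<psi> y \<bullet> D \<psi> y v) y u = 0"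
    by (rule frechet_derivative_cong_const[OF open_S y param_orth])
  then show ?thesis
    by (simp add: frechet_derivative_inner[OF diff_param[OF y] diff_dparam[OF y]] inner_commute)
qed

lemma param_decomposition:
  assumes y: "y \<in> V"
  shows "e = D \<psi> y (tcoord y e) + (e \<bullet> \<psi> y) *\<^sub>R \<psi> y"
proof -
  let ?T = "range (D \<psi> y)"
  define r where "r = e - (D \<psi> y (tcoord y e) + (e \<bullet> \<psi> y) *\<^sub>R \<psi> y)"
  have orth: "r \<bullet> z = 0" if "z \<in> insert (\<psi> y) ?T" for z
    using that unit[OF y] param_orth[OF y]
    by (auto simp: r_def inner_diff_left inner_add_left dF_tcoord_inner[OF y]
        inner_commute[of "D \<psi> y _" "\<psi> y"])
  have "\<psi> y \<notin> span ?T"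
    using orthogonal_to_span[of "\<psi> y" ?T "\<psi> y"] param_orth[OF y] unit[OF y]
    by (auto simp: orthogonal_def)
  moreover have "dim ?T = CARD('n)"
    using dim_image_eq[OF linear_dF[OF y], of UNIV] inj_dF[OF y] by simp
  ultimately have "dim (insert (\<psi> y) ?T) = DIM('a)"
    using dim_param by (simp add: dim_insert)
  then have "span (insert (\<psi> y) ?T) = UNIV" by (simp add: dim_eq_full)
  then have "r \<bullet> r = 0"
    using orthogonal_to_span[of r "insert (\<psi> y) ?T" r] orth by (auto simp: orthogonal_def)
  then show ?thesis by (simp add: r_def)
qed

text \<open>In codimension one the only normal is the position vector, so the tangential projection
  is given explicitly.\<close>

lemma dparam_christoffel:
  assumes y: "y \<in> V"
  shows "D \<psi> y (christoffel_map H y u v) = D2 \<psi> y u v + (D \<psi> y u \<bullet> D \<psi> y v) *\<^sub>R \<psi> y"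
proof -
  have "e = d - c *\<^sub>R p" if "d = e + c *\<^sub>R p" for d e p :: 'a and c using that by simp
  from this[OF param_decomposition[OF y]] show ?thesis
    by (simp add: christoffel_map_eq[OF y] param_D2[OF y])
qed

text \<open>Constant curvature one: the normal part is minus the metric times the position vector,
  and only the derivative of that vector has a tangential component in the Gauss equation.\<close>

lemma dparam_curvature:
  assumes y: "y \<in> V"
  shows "D \<psi> y (curvature H y u v w) =
    (D \<psi> y v \<bullet> D \<psi> y w) *\<^sub>R D \<psi> y u - (D \<psi> y u \<bullet> D \<psi> y w) *\<^sub>R D \<psi> y v"
proof -
  have "D (normal_part v w) y u \<bullet> D \<psi> y z = - (D \<psi> y v \<bullet> D \<psi> y w) * (D \<psi> y u \<bullet> D \<psi> y z)" for u v z
  proof -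
    let ?c = "\<lambda>x. D \<psi> x v \<bullet> D \<psi> x w"
    have dc: "?c differentiable at y"
      by (rule smooth_on_differentiable[OF smooth_on_inner[OF open_S smooth_dF smooth_dF] open_S y])
    have "D (normal_part v w) y u = D (\<lambda>x. - (?c x *\<^sub>R \<psi> x)) y u"
      by (rule frechet_derivative_cong_open[OF _ open_S y])
        (rule differentiable_minus[OF differentiable_scaleR[OF dc diff_param[OF y]]],
          simp add: normal_part_def dparam_christoffel)
    also have "\<dots> = - (?c y *\<^sub>R D \<psi> y u + D ?c y u *\<^sub>R \<psi> y)"
      using frechet_derivative_minus[OF differentiable_scaleR[OF dc diff_param[OF y]]]
      by (simp add: frechet_derivative_scaleR[OF dc diff_param[OF y]])
    finally show ?thesis by (simp add: inner_add_left inner_diff_left param_orth[OF y])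
  qed
  then have "curvature H y u v w = (D \<psi> y v \<bullet> D \<psi> y w) *\<^sub>R u - (D \<psi> y u \<bullet> D \<psi> y w) *\<^sub>R v"
    by (intro dF_eqI[OF y])
      (simp add: gauss_equation[OF y] linear_diff[OF linear_dF[OF y]] linear_cmul[OF linear_dF[OF y]]
        inner_diff_left)
  then show ?thesis by (simp add: linear_diff[OF linear_dF[OF y]] linear_cmul[OF linear_dF[OF y]])
qed

end

section \<open>Gauss equation, Ricci and scalar curvature of the hypersurface\<close>

context sphere_hypersurface
begin

lemma D2F_decomposition:
  "x \<in> S \<Longrightarrow> D2 F x u v = D F x (christoffel_map G x u v) - (D F x u \<bullet> D F x v) *\<^sub>R F x
    + (A x (D F x u) \<bullet> D F x v) *\<^sub>R N x"
  using decomposition[of x "D2 F x u v"] by (simp add: christoffel_map_eq D2F_inner_F D2F_inner_N)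

text \<open>The normal part has two components. The one along \<open>F\<close> gives the curvature
  of the sphere, the one along \<open>N\<close> the quadratic terms in the shape operator.\<close>

lemma curvature_hypersurface:
  assumes x: "x \<in> S"
  shows "curvature G x u v w = (D F x v \<bullet> D F x w) *\<^sub>R u - (D F x u \<bullet> D F x w) *\<^sub>R v
    + (A x (D F x v) \<bullet> D F x w) *\<^sub>R shape x u - (A x (D F x u) \<bullet> D F x w) *\<^sub>R shape x v"
proof -
  have "D (normal_part v w) x u \<bullet> D F x z =
      - (D F x v \<bullet> D F x w) * (D F x u \<bullet> D F x z) + (A x (D F x v) \<bullet> D F x w) * (D N x u \<bullet> D F x z)"
    for u v z
  proof -
    let ?c = "\<lambda>x. D F x v \<bullet> D F x w" and ?h = "\<lambda>x. A x (D F x v) \<bullet> D F x w"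
    have dc: "?c differentiable at x"
      by (rule smooth_on_differentiable[OF smooth_on_inner[OF open_S smooth_dF smooth_dF] open_S x])
    have dh: "?h differentiable at x"
      by (rule smooth_on_differentiable[OF smooth_on_inner[OF open_S
              smooth_on_blinfun_apply[OF open_S smooth_A smooth_dF] smooth_dF] open_S x])
    have d1: "(\<lambda>x. ?c x *\<^sub>R F x) differentiable at x"
      by (rule differentiable_scaleR[OF dc diff_F[OF x]])
    have d2: "(\<lambda>x. ?h x *\<^sub>R N x) differentiable at x"
      by (rule differentiable_scaleR[OF dh diff_N[OF x]])
    have "D (normal_part v w) x u = D (\<lambda>x. ?h x *\<^sub>R N x - ?c x *\<^sub>R F x) x u"
      by (rule frechet_derivative_cong_open[OF _ open_S x])
        (rule differentiable_diff[OF d2 d1], simp add: normal_part_def D2F_decomposition)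
    also have "\<dots> = (?h x *\<^sub>R D N x u + D ?h x u *\<^sub>R N x) - (?c x *\<^sub>R D F x u + D ?c x u *\<^sub>R F x)"
      by (simp add: frechet_derivative_diff[OF d2 d1] frechet_derivative_scaleR[OF dc diff_F[OF x]]
          frechet_derivative_scaleR[OF dh diff_N[OF x]])
    finally show ?thesis by (simp add: inner_add_left inner_diff_left F_dF[OF x] N_dF[OF x])
  qed
  then show ?thesis
    by (intro dF_eqI[OF x])
      (simp add: gauss_equation[OF x] linear_diff[OF linear_dF[OF x]] linear_add[OF linear_dF[OF x]]
        linear_cmul[OF linear_dF[OF x]] inner_diff_left inner_add_left dF_shape[OF x])
qed

text \<open>Evaluates the two Gauss terms in which the traced variable enters through a linear
  form.\<close>

lemma trace_rank_one:
  fixes u :: "real^'m" and g :: "real^'m \<Rightarrow> real"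
  assumes "linear g"
  shows "trace (matrix (\<lambda>w. g w *\<^sub>R u)) = g u"
  using linear_vec_expand[OF assms, of u] by (simp add: trace_matrix mult.commute)

lemma ricci_hypersurface:
  assumes x: "x \<in> S"
  shows "ricci G x u v = D F x ((real CARD('m) - 1) *\<^sub>R u + trace (matrix (shape x)) *\<^sub>R shape x u
    - shape x (shape x u)) \<bullet> D F x v"
proof -
  have g: "linear (\<lambda>w. D F x w \<bullet> D F x v)" and h: "linear (\<lambda>w. A x (D F x w) \<bullet> D F x v)"
    by (rule linearI; simp add: linear_add[OF linear_dF[OF x]] linear_cmul[OF linear_dF[OF x]]
        blinfun.add_right blinfun.scaleR_right inner_add_left)+
  have "ricci G x u v = (\<Sum>i\<in>(UNIV :: 'm set). D F x u \<bullet> D F x v) - trace (matrix (\<lambda>w. (D F x w \<bullet> D F x v) *\<^sub>R u))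
      + (A x (D F x u) \<bullet> D F x v) * trace (matrix (shape x))
      - trace (matrix (\<lambda>w. (A x (D F x w) \<bullet> D F x v) *\<^sub>R shape x u))"
    unfolding ricci_def curvature_hypersurface[OF x] trace_matrix
    by (simp add: sum.distrib sum_subtractf sum_distrib_left axis_def)
  also have "\<dots> = real CARD('m) * (D F x u \<bullet> D F x v) - D F x u \<bullet> D F x v
      + (A x (D F x u) \<bullet> D F x v) * trace (matrix (shape x)) - A x (D F x (shape x u)) \<bullet> D F x v"
    by (simp add: trace_rank_one[OF g] trace_rank_one[OF h])
  finally show ?thesis
    by (simp add: A_dF_shape[OF x] linear_diff[OF linear_dF[OF x]] linear_add[OF linear_dF[OF x]]
        linear_cmul[OF linear_dF[OF x]] inner_diff_left inner_add_left algebra_simps)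
qed

lemma ricci_op_hypersurface:
  assumes x: "x \<in> S"
  shows "ricci_op G x u = (real CARD('m) - 1) *\<^sub>R u + trace (matrix (shape x)) *\<^sub>R shape x u
    - shape x (shape x u)"
  unfolding ricci_op_def ricci_hypersurface[OF x] by (rule sharp_dF[OF x])

lemma scal_hypersurface:
  assumes x: "x \<in> S"
  shows "scal G x = real CARD('m) * (real CARD('m) - 1) + (trace (matrix (shape x)))\<^sup>2
    - trace (matrix (\<lambda>u. shape x (shape x u)))"
  unfolding scal_def
  by (simp add: trace_matrix ricci_op_hypersurface[OF x] sum.distrib sum_subtractf
      sum_distrib_left[symmetric] power2_eq_square axis_def)

end

text \<open>Couples the chart expressions \<open>f\<close>, \<open>n\<close> with their ambient
  images \<open>F\<close>, \<open>N\<close>. As the differential of \<open>\<psi>\<close> is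
  injective, an identity between fields along \<open>f\<close> may be checked after mapping both
  sides to the ambient space.\<close>

locale charted_hypersurface = hyp: sphere_hypersurface S F G N + sph: sphere_param V \<psi> H
  for S :: "(real^'m::finite) set" and F :: "real^'m \<Rightarrow> 'a::euclidean_space"
    and G :: "real^'m \<Rightarrow> real^'m^'m" and N :: "real^'m \<Rightarrow> 'a"
    and V :: "(real^'n::finite) set" and \<psi> :: "real^'n \<Rightarrow> 'a" and H :: "real^'n \<Rightarrow> real^'n^'n" +
  fixes f :: "real^'m \<Rightarrow> real^'n" and n :: "real^'m \<Rightarrow> real^'n"
  assumes smooth_f: "smooth_on S f" and f_in: "x \<in> S \<Longrightarrow> f x \<in> V"
    and F_eq: "x \<in> S \<Longrightarrow> F x = \<psi> (f x)"
    and smooth_n: "smooth_on S n" and N_eq: "x \<in> S \<Longrightarrow> N x = D \<psi> (f x) (n x)"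
begin

lemma diff_f: "x \<in> S \<Longrightarrow> f differentiable at x"
  by (rule smooth_on_differentiable[OF smooth_f hyp.open_S])

lemma linear_df: "x \<in> S \<Longrightarrow> linear (D f x)"
  by (rule linear_frechet_derivative[OF diff_f])

lemma linear_dparam: "x \<in> S \<Longrightarrow> linear (D \<psi> (f x))"
  by (rule sph.linear_dF[OF f_in])

lemma dparam_inject: "x \<in> S \<Longrightarrow> D \<psi> (f x) u = D \<psi> (f x) v \<longleftrightarrow> u = v"
  using sph.inj_dF[OF f_in] by (simp add: inj_eq)

lemma dF_eq: assumes x: "x \<in> S" shows "D F x u = D \<psi> (f x) (D f x u)"
proof -
  have "D F x u = D (\<lambda>y. \<psi> (f y)) x u"
    by (rule frechet_derivative_cong_open[OF _ hyp.open_S x])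
      (auto intro: smooth_on_differentiable[OF smooth_on_compose[OF hyp.open_S sph.open_S f_in
            sph.smooth_F smooth_f] hyp.open_S x] simp: F_eq)
  then show ?thesis
    by (simp add: frechet_derivative_chain[OF diff_f[OF x] sph.diff_param[OF f_in[OF x]]])
qed

text \<open>The pull-back connection is the flat derivative projected to the tangent space of the
  sphere. The component removed along \<open>F\<close> is minus the inner product of
  \<open>W x\<close> and \<open>D F x (X x)\<close>, because \<open>W\<close> is orthogonal to
  \<open>F\<close>.\<close>

lemma dparam_pull_cov:
  assumes x: "x \<in> S" and Y: "smooth_on S Y" and W: "\<And>y. y \<in> S \<Longrightarrow> D \<psi> (f y) (Y y) = W y"
  shows "D \<psi> (f x) (pull_cov H f X Y x) = D W x (X x) + (W x \<bullet> D F x (X x)) *\<^sub>R F x"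
proof -
  have "D W x (X x) = D (\<lambda>y. D \<psi> (f y) (Y y)) x (X x)"
    by (rule frechet_derivative_cong_open[OF _ hyp.open_S x])
      (auto intro: smooth_on_differentiable[OF sph.smooth_dF_along[OF hyp.open_S smooth_f f_in Y]
          hyp.open_S x] simp: W)
  also have "\<dots> = D2 \<psi> (f x) (D f x (X x)) (Y x) + D \<psi> (f x) (D Y x (X x))"
    by (rule sph.D_dF_along[OF hyp.open_S x smooth_f f_in Y])
  finally show ?thesis
    by (simp add: pull_cov_def dmap_def linear_add[OF linear_dparam[OF x]] dF_eq[OF x] F_eq[OF x]
        sph.dparam_christoffel[OF f_in[OF x]] W[OF x, symmetric] inner_commute)
qed

lemma second_fund_eq:
  assumes x: "x \<in> S"
  shows "second_fund G H f x u v = (hyp.A x (D F x u) \<bullet> D F x v) *\<^sub>R n x"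
proof -
  have "D \<psi> (f x) (pull_cov H f (\<lambda>_. u) (dmap f (\<lambda>_. v)) x) = D2 F x u v + (D F x v \<bullet> D F x u) *\<^sub>R F x"
    unfolding dmap_def
    by (rule dparam_pull_cov[OF x smooth_on_frechet_derivative[OF smooth_f]]) (simp add: dF_eq)
  moreover have "D \<psi> (f x) (dmap f (cov_deriv G (\<lambda>_. u) (\<lambda>_. v)) x) = D F x (christoffel_map G x u v)"
    by (simp add: dmap_def cov_deriv_def dF_eq[OF x])
  ultimately have "D \<psi> (f x) (second_fund G H f x u v) =
      D \<psi> (f x) ((hyp.A x (D F x u) \<bullet> D F x v) *\<^sub>R n x)"
    by (simp add: second_fund_def linear_diff[OF linear_dparam[OF x]] linear_cmul[OF linear_dparam[OF x]]
        N_eq[OF x, symmetric] hyp.D2F_decomposition[OF x] inner_commute)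
  then show ?thesis by (simp add: dparam_inject[OF x])
qed

lemma tension_eq:
  assumes x: "x \<in> S"
  shows "tension G H f x = trace (matrix (hyp.shape x)) *\<^sub>R n x"
proof -
  have "second_fund G H f x = (\<lambda>u v. (hyp.A x (D F x u) \<bullet> D F x v) *\<^sub>R n x)"
    by (intro ext second_fund_eq[OF x])
  then show ?thesis by (simp add: tension_def metric_trace_scaleR_left hyp.metric_trace_A[OF x])
qed

text \<open>The left side is the body of \<open>shape_operator\<close> in the given charts; this
  transfers hypotheses on principal curvatures to the ambient picture.\<close>

lemma shape_operator_eq:
  assumes x: "x \<in> S"
  shows "sharp G x (\<lambda>v. - (pull_cov H f (\<lambda>_. u) n x \<bullet> (H (f x) *v D f x v))) = hyp.shape x u"
proof -
  have "D \<psi> (f x) (pull_cov H f (\<lambda>_. u) n x) = D N x u"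
    using dparam_pull_cov[OF x smooth_n N_eq[symmetric]] hyp.N_dF[OF x] by simp
  then have "- (pull_cov H f (\<lambda>_. u) n x \<bullet> (H (f x) *v D f x v)) = - D N x u \<bullet> D F x v" for v
    by (simp add: sph.inner_G[OF f_in[OF x]] dF_eq[OF x])
  then show ?thesis unfolding hyp.shape_def by (simp only: hyp.sharp_inner[OF x])
qed

context
  fixes T p\<^sub>2 :: real
  assumes trace_const: "\<And>x. x \<in> S \<Longrightarrow> trace (matrix (hyp.shape x)) = T"
    and trace2_const: "\<And>x. x \<in> S \<Longrightarrow> trace (matrix (\<lambda>u. hyp.shape x (hyp.shape x u))) = p\<^sub>2"
begin

lemma tension_const: "x \<in> S \<Longrightarrow> tension G H f x = T *\<^sub>R n x"
  by (simp add: tension_eq trace_const)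

lemma smooth_tension: "smooth_on S (tension G H f)"
  by (rule smooth_on_cong[OF hyp.open_S smooth_on_scaleR[OF hyp.open_S
          smooth_on_const[OF hyp.open_S, of T] smooth_n]])
    (simp add: tension_const)

lemma dparam_tension: "x \<in> S \<Longrightarrow> D \<psi> (f x) (tension G H f x) = T *\<^sub>R N x"
  by (simp add: tension_const linear_cmul[OF linear_dparam] N_eq)

lemma dparam_pull_cov_tension:
  assumes x: "x \<in> S"
  shows "D \<psi> (f x) (pull_cov H f X (tension G H f) x) = T *\<^sub>R D N x (X x)"
  using dparam_pull_cov[OF x smooth_tension dparam_tension, of X] hyp.N_dF[OF x]
    frechet_derivative_bounded_linear[OF bounded_linear_scaleR_right hyp.diff_N[OF x], of T]
  by simp

lemma smooth_pull_cov_tension: "smooth_on S (pull_cov H f (\<lambda>_. v) (tension G H f))"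
proof (rule smooth_on_cong[OF hyp.open_S])
  show "smooth_on S (\<lambda>y. sph.tcoord (f y) (T *\<^sub>R D N y v))"
    by (intro sph.smooth_tcoord[OF hyp.open_S smooth_f f_in] smooth_on_scaleR smooth_on_const
        hyp.open_S hyp.smooth_dN)
  show "sph.tcoord (f y) (T *\<^sub>R D N y v) = pull_cov H f (\<lambda>_. v) (tension G H f) y" if "y \<in> S" for y
    using sph.tcoord_dF[OF f_in[OF that]] dparam_pull_cov_tension[OF that, of "\<lambda>_. v"] by metis
qed

text \<open>The second covariant derivative of the normal is minus the derivative of
  \<open>A\<close>, up to the projection to the sphere. Its trace is governed by the divergence
  formula \<open>metric_trace_dA\<close>.\<close>

lemma dparam_rough_laplacian:
  assumes x: "x \<in> S"
  shows "D \<psi> (f x) (rough_laplacian G H f (tension G H f) x) = (T * p\<^sub>2) *\<^sub>R N x"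
proof -
  let ?R = "\<lambda>u v. pull_cov H f (\<lambda>_. u) (pull_cov H f (\<lambda>_. v) (tension G H f)) x
         - pull_cov H f (cov_deriv G (\<lambda>_. u) (\<lambda>_. v)) (tension G H f) x"
  \<comment> \<open>The last summand comes from projecting to the sphere. After tracing, it cancels
    the component along \<open>F\<close> of the divergence of \<open>A\<close>, and only
    \<open>p\<^sub>2\<close> times \<open>N\<close> is left.\<close>
  have R: "D \<psi> (f x) (?R u v) =
      - T *\<^sub>R (D hyp.A x u (D F x v) + (hyp.A x (D F x u) \<bullet> D F x v) *\<^sub>R F x)" for u v
  proof -
    have "D \<psi> (f x) (pull_cov H f (\<lambda>_. u) (pull_cov H f (\<lambda>_. v) (tension G H f)) x) =
        D (\<lambda>y. T *\<^sub>R D N y v) x u + ((T *\<^sub>R D N x v) \<bullet> D F x u) *\<^sub>R F x"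
      by (rule dparam_pull_cov[OF x smooth_pull_cov_tension dparam_pull_cov_tension])
    also have "\<dots> = T *\<^sub>R (D2 N x u v + (D N x v \<bullet> D F x u) *\<^sub>R F x)"
      using frechet_derivative_bounded_linear[OF bounded_linear_scaleR_right hyp.diff_dN[OF x], of T]
      by (simp add: scaleR_add_right)
    finally have 1: "D \<psi> (f x) (pull_cov H f (\<lambda>_. u) (pull_cov H f (\<lambda>_. v) (tension G H f)) x) =
      T *\<^sub>R (D2 N x u v + (D N x v \<bullet> D F x u) *\<^sub>R F x)" .
    have 2: "D \<psi> (f x) (pull_cov H f (cov_deriv G (\<lambda>_. u) (\<lambda>_. v)) (tension G H f) x) =
        T *\<^sub>R D N x (christoffel_map G x u v)"
      by (simp add: dparam_pull_cov_tension[OF x] cov_deriv_def)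
    have "D2 N x u v - D N x (christoffel_map G x u v) = - D hyp.A x u (D F x v)"
      by (simp add: hyp.dA_dF[OF x] hyp.christoffel_map_eq[OF x] hyp.A_apply[OF x])
    moreover have "D N x v \<bullet> D F x u = - (hyp.A x (D F x u) \<bullet> D F x v)"
      using hyp.A_dF[OF x, of v] hyp.A_sym[OF x, of "D F x u" "D F x v"] by (simp add: inner_commute)
    moreover have "T *\<^sub>R (p + c *\<^sub>R z) - T *\<^sub>R q = - T *\<^sub>R (r + h *\<^sub>R z)"
      if "p - q = - r" "c = - h" for p q r z :: 'a and c h
    proof -
      have "p = q - r" using that(1) by (simp add: diff_eq_eq)
      then show ?thesis unfolding that(2) by (simp only:) (simp add: algebra_simps)
    qed
    ultimately show ?thesis unfolding linear_diff[OF linear_dparam[OF x]] 1 2 by blast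
  qed
  show ?thesis
    unfolding rough_laplacian_def
    by (simp add: linear_neg[OF linear_dparam[OF x]] linear_metric_trace[OF linear_dparam[OF x]] R
        metric_trace_uminus metric_trace_scaleR_right metric_trace_add metric_trace_scaleR_left
        hyp.metric_trace_dA[OF x trace_const] hyp.metric_trace_A[OF x] trace_const[OF x] trace2_const[OF x])
qed

text \<open>The curvature of the unit sphere contributes \<open>m * T\<close>, the rough Laplacian
  \<open>- T * p\<^sub>2\<close>, both along the normal.\<close>

lemma bitension_eq:
  assumes x: "x \<in> S"
  shows "bitension G H f x = (T * (real CARD('m) - p\<^sub>2)) *\<^sub>R n x"
proof -
  let ?K = "\<lambda>u v. curvature H (f x) (dmap f (\<lambda>_. u) x) (tension G H f x) (dmap f (\<lambda>_. v) x)"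
  have K: "D \<psi> (f x) (?K u v) = (D F x u \<bullet> D F x v) *\<^sub>R (- T *\<^sub>R N x)" for u v
    by (simp add: dmap_def sph.dparam_curvature[OF f_in[OF x]] dF_eq[OF x, symmetric]
        dparam_tension[OF x] hyp.N_dF[OF x])
  have "metric_trace G x (\<lambda>u v. D F x u \<bullet> D F x v) = real CARD('m)"
    using hyp.metric_trace_operator[OF x, of "\<lambda>u. u"] by (simp add: trace_matrix axis_def)
  then have "D \<psi> (f x) (metric_trace G x ?K) = - (real CARD('m) * T) *\<^sub>R N x"
    unfolding linear_metric_trace[OF linear_dparam[OF x]] K metric_trace_scaleR_left by simp
  then have "D \<psi> (f x) (bitension G H f x) = D \<psi> (f x) ((T * (real CARD('m) - p\<^sub>2)) *\<^sub>R n x)"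
    by (simp add: bitension_def linear_diff[OF linear_dparam[OF x]] linear_neg[OF linear_dparam[OF x]]
        dparam_rough_laplacian[OF x] linear_cmul[OF linear_dparam[OF x]] N_eq[OF x, symmetric] algebra_simps)
  then show ?thesis by (simp add: dparam_inject[OF x])
qed

text \<open>With two constant traces the scalar curvature is constant and its gradient drops out.
  The cubic trace \<open>p\<^sub>3\<close> comes from composing the shape operator with the square
  in the Ricci operator.\<close>

lemma c_bitension_eq:
  assumes x: "x \<in> S"
    and p\<^sub>3: "trace (matrix (\<lambda>u. hyp.shape x (hyp.shape x (hyp.shape x u)))) = p\<^sub>3"
  shows "c_bitension G H f x = (let m = real CARD('m) in
    T * (m - p\<^sub>2) - 2 / 3 * (m * (m - 1) + T\<^sup>2 - p\<^sub>2) * T + 2 * ((m - 1) * T + T * p\<^sub>2 - p\<^sub>3)) *\<^sub>R n x"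
proof -
  have scal: "scal G y = real CARD('m) * (real CARD('m) - 1) + T\<^sup>2 - p\<^sub>2" if "y \<in> S" for y
    by (simp add: hyp.scal_hypersurface[OF that] trace_const[OF that] trace2_const[OF that])
  have "D (scal G) x v = 0" for v
    by (rule frechet_derivative_cong_const[OF hyp.open_S x scal])
  then have "grad G (scal G) x = 0" by (simp add: grad_def sharp_def zero_vec_def[symmetric])
  then have grad: "dmap f (grad G (scal G)) x = 0" by (simp add: dmap_def linear_0[OF linear_df[OF x]])
  have "hyp.A x (D F x (ricci_op G x u)) = D F x ((real CARD('m) - 1) *\<^sub>R hyp.shape x u
      + T *\<^sub>R hyp.shape x (hyp.shape x u) - hyp.shape x (hyp.shape x (hyp.shape x u)))" for u
    by (simp add: hyp.A_dF_shape[OF x] hyp.ricci_op_hypersurface[OF x] trace_const[OF x]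
        linear_diff[OF hyp.linear_shape[OF x]] linear_add[OF hyp.linear_shape[OF x]]
        linear_cmul[OF hyp.linear_shape[OF x]])
  then have ric: "metric_trace G x (\<lambda>u v. second_fund G H f x (ricci_op G x u) v) =
      ((real CARD('m) - 1) * T + T * p\<^sub>2 - p\<^sub>3) *\<^sub>R n x"
    using trace_const[OF x] trace2_const[OF x] p\<^sub>3
    by (simp add: second_fund_eq[OF x] metric_trace_scaleR_left hyp.metric_trace_operator[OF x]
        trace_matrix sum.distrib sum_subtractf sum_distrib_left[symmetric])
  show ?thesis
    unfolding c_bitension_def Let_def bitension_eq[OF x] scal[OF x] tension_const[OF x] ric grad
      scaleR_scaleR scaleR_zero_right add_0_right scaleR_left_distrib[symmetric]
      scaleR_left_diff_distrib[symmetric]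
    by simp
qed

end

end

section \<open>Isoparametric hypersurfaces of degree 3\<close>

text \<open>These are the relations satisfied by cot t, cot(t + pi/3), cot(t + 2 pi/3), the
  classical form of the three principal curvatures; the algebraic form avoids the angle.\<close>

lemma cartan_symmetric_functions:
  fixes a b c :: real
  assumes "a \<noteq> b" "(1 + a * b) * (a - c) = (1 + a * c) * (b - a)"
    "(1 + b * c) * (b - a) = (1 + b * a) * (c - b)"
  shows "a * b + b * c + c * a = - 3" "a + b + c = - 3 * (a * b * c)"
proof -
  have 1: "2 * a - b - c + a * (a * b + a * c) - 2 * (a * b * c) = 0"
    using assms(2) by (simp add: algebra_simps)
  have 2: "2 * b - a - c + b * (a * b + b * c) - 2 * (a * b * c) = 0"
    using assms(3) by (simp add: algebra_simps)
  \<comment> \<open>The difference of the two preceding equations, in which the terms in abc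
    cancel.\<close>
  have "(a - b) * (a * b + b * c + c * a + 3) = 0"
    using 1 2 by (simp add: algebra_simps)
  then show e2: "a * b + b * c + c * a = - 3" using assms(1) by simp
  then have "a * b + a * c = - 3 - b * c" by (simp add: algebra_simps)
  then have "2 * a - b - c + a * (- 3 - b * c) - 2 * (a * b * c) = 0" using 1 by simp
  then show "a + b + c = - 3 * (a * b * c)" by (simp add: algebra_simps)
qed

lemma c_biharmonic_polynomial:
  fixes a b c :: real and k :: nat
  assumes e2: "a * b + b * c + c * a = - 3" and e3: "a + b + c = - 3 * (a * b * c)" and "k > 0"
  defines "m \<equiv> real (k + k + k)" and "T \<equiv> real k * a + real k * b + real k * c"
    and "p2 \<equiv> real k * a\<^sup>2 + real k * b\<^sup>2 + real k * c\<^sup>2"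
    and "p3 \<equiv> real k * a ^ 3 + real k * b ^ 3 + real k * c ^ 3"
  shows "T * (m - p2) - 2 / 3 * (m * (m - 1) + T\<^sup>2 - p2) * T + 2 * ((m - 1) * T + T * p2 - p3) = 0
    \<longleftrightarrow> T = 0"
proof -
  define e where "e = a + b + c"
  define r where "r = real k"
  have "r \<ge> 1" using \<open>k > 0\<close> by (simp add: r_def)
  have T: "T = r * e" by (simp add: T_def e_def r_def algebra_simps)
  have "a\<^sup>2 + b\<^sup>2 + c\<^sup>2 = e\<^sup>2 - 2 * (a * b + b * c + c * a)"
    by (simp add: e_def power2_eq_square algebra_simps)
  then have "a\<^sup>2 + b\<^sup>2 + c\<^sup>2 = e\<^sup>2 + 6" by (simp add: e2)
  moreover have "p2 = r * (a\<^sup>2 + b\<^sup>2 + c\<^sup>2)" by (simp add: p2_def r_def algebra_simps)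
  ultimately have p2: "p2 = r * (e\<^sup>2 + 6)" by simp
  have "a ^ 3 + b ^ 3 + c ^ 3 = e ^ 3 - 3 * e * (a * b + b * c + c * a) + 3 * (a * b * c)"
    by (simp add: e_def power3_eq_cube algebra_simps)
  also have "\<dots> = e ^ 3 + 8 * e" using e3 by (simp add: e2 e_def[symmetric])
  finally have "a ^ 3 + b ^ 3 + c ^ 3 = e ^ 3 + 8 * e" .
  moreover have "p3 = r * (a ^ 3 + b ^ 3 + c ^ 3)" by (simp add: p3_def r_def algebra_simps)
  ultimately have p3: "p3 = r * (e ^ 3 + 8 * e)" by simp
  have m: "m = 3 * r" by (simp add: m_def r_def)
  define q where "q = (2 * r\<^sup>2 - 5 * r + 6) * e\<^sup>2 / 3 + 3 * ((2 * r - 3) * (r - 2))"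
  have eq: "T * (m - p2) - 2 / 3 * (m * (m - 1) + T\<^sup>2 - p2) * T + 2 * ((m - 1) * T + T * p2 - p3) =
      - (r * e * q)"
    unfolding T m p2 p3 q_def
    by (simp add: power2_eq_square power3_eq_cube field_simps)
  \<comment> \<open>The product is negative only strictly between 3/2 and 2, where there is no
    integer. This is where integrality of the multiplicity is used.\<close>
  have "(2 * r - 3) * (r - 2) \<ge> 0"
  proof (cases "k = 1")
    case False
    then have "r \<ge> 2" using \<open>k > 0\<close> by (simp add: r_def)
    then show ?thesis by simp
  qed (simp add: r_def)
  \<comment> \<open>The discriminant is 25 - 48, so the coefficient of \<open>e\<^sup>2\<close> is
    positive for every real \<open>r\<close>, and \<open>q\<close> is strictly positive unless
    \<open>e = 0\<close>.\<close>
  moreover have "2 * r\<^sup>2 - 5 * r + 6 > 0"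
  proof -
    have "2 * r\<^sup>2 - 5 * r + 6 = 2 * (r - 5 / 4)\<^sup>2 + 23 / 8"
      by (simp add: power2_eq_square algebra_simps)
    then show ?thesis using zero_le_power2[of "r - 5 / 4"] by linarith
  qed
  ultimately have "q > 0" if "e \<noteq> 0"
    unfolding q_def using that by (intro add_pos_nonneg) (auto intro!: divide_pos_pos mult_pos_pos)
  then show ?thesis unfolding eq using \<open>r \<ge> 1\<close> by (auto simp: T)
qed

section \<open>From the charts of the manifold to the ambient picture\<close>

lemma round_sphere_chart:
  assumes "d \<in> atlas (round_sphere :: ('a::euclidean_space, 'n::finite) riem)"
    and "DIM('a) = CARD('n) + 1"
  shows "sphere_param (cdom d) (param d) (mcoeff (round_sphere :: ('a, 'n) riem) d)"
proof -
  obtain V \<psi> where d: "d = (V, \<psi>)" by (cases d)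
  have "open V" "openin (top_of_set (sphere 0 1)) (\<psi> ` V)" "smooth_on V \<psi>"
    "\<forall>x\<in>V. inj (D \<psi> x)"
    using assms(1) by (auto simp: d round_sphere_def)
  moreover have "\<psi> ` V \<subseteq> sphere 0 1"
    using openin_subset[OF \<open>openin _ (\<psi> ` V)\<close>] by simp
  then have "\<psi> y \<bullet> \<psi> y = 1" if "y \<in> V" for y
    using that by (auto simp: dot_square_norm image_subset_iff)
  ultimately show ?thesis
    using assms(2) by unfold_locales (auto simp: d round_sphere_def)
qed

lemma open_local_dom:
  assumes "riemannian_manifold M" "smooth_map M (round_sphere :: ('a::euclidean_space, 'n::finite) riem) \<phi>"
    and c: "c \<in> atlas M" and d: "d \<in> atlas (round_sphere :: ('a, 'n) riem)"
  shows "open (local_dom c d \<phi>)"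
proof -
  have "open (cdom c)" and "homeomorphic_map (top_of_set (cdom c)) (subtopology (mtop M) (cimage c)) (param c)"
    using assms(1) c unfolding riemannian_manifold_def by blast+
  then have "continuous_map (top_of_set (cdom c)) (mtop M) (param c)"
    using homeomorphic_imp_continuous_map continuous_map_into_fulltopology by blast
  moreover have "continuous_map (mtop M) (top_of_set (sphere 0 1)) \<phi>"
    using assms(2) unfolding smooth_map_def round_sphere_def by simp
  ultimately have cont: "continuous_map (top_of_set (cdom c)) (top_of_set (sphere 0 1)) (\<phi> \<circ> param c)"
    by (rule continuous_map_compose)
  have "openin (top_of_set (sphere 0 1)) (cimage d)"
    using d by (auto simp: round_sphere_def)
  from openin_continuous_map_preimage[OF cont this]
  have "openin (top_of_set (cdom c)) (local_dom c d \<phi>)"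
    by (simp add: local_dom_def)
  then show ?thesis using \<open>open (cdom c)\<close> openin_open_eq by blast
qed

lemma inner_pullback_metric:
  fixes f :: "real^'m::finite \<Rightarrow> real^'n::finite"
  assumes "f differentiable at x"
  shows "u \<bullet> (pullback_metric f H x *v v) = D f x u \<bullet> (H (f x) *v D f x v)"
proof -
  have "(f has_derivative (\<lambda>h. jacobian f (at x) *v h)) (at x)"
    using assms jacobian_works by blast
  from fun_cong[OF frechet_derivative_at[OF this]] have J: "jacobian f (at x) *v w = D f x w" for w .
  have "u \<bullet> (transpose (jacobian f (at x)) *v z) = D f x u \<bullet> z" for z
    using dot_lmul_matrix[of z "jacobian f (at x)" u]
    by (simp add: transpose_matrix_vector J inner_commute)
  then show ?thesis
    by (simp add: pullback_metric_def matrix_vector_mul_assoc[symmetric] J)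
qed

text \<open>The metric of the sphere is induced from the ambient space, so the isometry and
  unit-normal conditions, stated with chart matrices, become ambient inner products.\<close>

lemma charted_hypersurface_local_rep:
  fixes M :: "('p, 'm::finite) riem" and \<phi> :: "'p \<Rightarrow> 'a::euclidean_space"
    and \<xi> :: "('a, 'n::finite) chart \<Rightarrow> 'p \<Rightarrow> real^'n"
  assumes "DIM('a) = CARD('m) + 2"
    and hyp: "oriented_hypersurface M (round_sphere :: ('a, 'n) riem) \<phi> \<xi>"
    and c: "c \<in> atlas M" and d: "d \<in> atlas (round_sphere :: ('a, 'n) riem)"
  defines "f \<equiv> local_rep c d \<phi>" and "n \<equiv> \<xi> d \<circ> param c"
  shows "charted_hypersurface (local_dom c d \<phi>) (\<lambda>x. param d (f x)) (mcoeff M c)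
    (\<lambda>x. D (param d) (f x) (n x)) (cdom d) (param d) (mcoeff (round_sphere :: ('a, 'n) riem) d) f n"
proof -
  let ?N = "round_sphere :: ('a, 'n) riem" and ?S = "local_dom c d \<phi>" and ?F = "\<lambda>x. param d (f x)"
  let ?H = "mcoeff ?N d"
  have card: "CARD('n) = CARD('m) + 1" and M: "riemannian_manifold M" and im: "isometric_immersion M ?N \<phi>"
    and sec: "smooth_section_along M ?N \<phi> \<xi>"
    and norm: "\<And>x. x \<in> ?S \<Longrightarrow> n x \<bullet> (?H (f x) *v n x) = 1"
      "\<And>x u. x \<in> ?S \<Longrightarrow> n x \<bullet> (?H (f x) *v D f x u) = 0"
    using hyp c d unfolding oriented_hypersurface_def Let_def f_def n_def by auto
  have sm: "smooth_map M ?N \<phi>" and G: "\<And>x. x \<in> ?S \<Longrightarrow> mcoeff M c x = pullback_metric f ?H x"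
    using im c d unfolding isometric_immersion_def f_def by auto
  interpret sph: sphere_param "cdom d" "param d" ?H
    using round_sphere_chart[OF d] assms(1) card by simp
  have S: "open ?S" by (rule open_local_dom[OF M sm c d])
  have f: "smooth_on ?S f" using sm c d unfolding smooth_map_def f_def by blast
  have n: "smooth_on ?S n" using sec c d unfolding smooth_section_along_def n_def by blast
  have f_in: "f x \<in> cdom d" if "x \<in> ?S" for x
    using that unfolding f_def local_rep_def local_dom_def coord_def by (auto intro: inv_into_into)
  have F: "smooth_on ?S ?F"
    by (rule smooth_on_compose[OF S sph.open_S f_in sph.smooth_F f])
  have df: "f differentiable at x" if "x \<in> ?S" for x
    by (rule smooth_on_differentiable[OF f S that])
  have dF: "D ?F x u = D (param d) (f x) (D f x u)" if "x \<in> ?S" for x u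
    by (rule frechet_derivative_chain[OF df[OF that] sph.diff_param[OF f_in[OF that]]])
  have G_inner: "u \<bullet> (mcoeff M c x *v v) = D ?F x u \<bullet> D ?F x v" if "x \<in> ?S" for x u v
    by (simp add: G[OF that] inner_pullback_metric[OF df[OF that]] sph.inner_G[OF f_in[OF that]] dF[OF that])
  have inj: "inj (D ?F x)" if x: "x \<in> ?S" for x
  proof -
    have "linear (D ?F x)" by (rule smooth_on_linear_derivative[OF F S x])
    \<comment> \<open>An isometric map is automatically an immersion: positive definiteness of the
      metric of \<open>M\<close> excludes a kernel.\<close>
    moreover have "u = 0" if "D ?F x u = 0" for u
    proof (rule ccontr)
      assume "u \<noteq> 0"
      then have "u \<bullet> (mcoeff M c x *v u) > 0"
        using M c x unfolding riemannian_manifold_def local_dom_def by blast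
      then show False using that by (simp add: G_inner[OF x])
    qed
    ultimately show ?thesis using linear_injective_0 by blast
  qed
  show ?thesis
  proof unfold_locales
    show "mcoeff M c x = (\<chi> i j. D ?F x (axis i 1) \<bullet> D ?F x (axis j 1))" if "x \<in> ?S" for x
    proof -
      have "mcoeff M c x $ i $ j = axis i 1 \<bullet> (mcoeff M c x *v axis j 1)" for i j
        by (simp add: inner_axis' matrix_vector_mult_basis column_def)
      then show ?thesis by (simp add: vec_eq_iff G_inner[OF that])
    qed
    show "smooth_on ?S (\<lambda>x. D (param d) (f x) (n x))"
      by (rule sph.smooth_dF_along[OF S f f_in n])
    show "D (param d) (f x) (n x) \<bullet> D (param d) (f x) (n x) = 1" if "x \<in> ?S" for x
      using norm(1)[OF that] by (simp add: sph.inner_G[OF f_in[OF that]])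
    show "D (param d) (f x) (n x) \<bullet> D ?F x u = 0" if "x \<in> ?S" for x u
      using norm(2)[OF that] by (simp add: sph.inner_G[OF f_in[OF that]] dF[OF that])
  qed (use S F inj f n f_in sph.unit sph.param_orth assms(1) in auto)
qed

text \<open>The pointwise form of the result within one pair of charts. Cartan's relations are
  obtained at the single point \<open>x\<close>, while constant multiplicities on \<open>S\<close>
  supply the constant traces.\<close>

lemma (in charted_hypersurface) c_bitension_eq_0_iff:
  fixes a b c :: real and \<mu> :: "real \<Rightarrow> nat"
  assumes ne: "a \<noteq> b" "a \<noteq> c" "b \<noteq> c"
    and eig: "\<And>x u \<kappa>. \<lbrakk>x \<in> S; u \<noteq> 0; hyp.shape x u = \<kappa> *\<^sub>R u\<rbrakk> \<Longrightarrow> \<kappa> \<in> {a, b, c}"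
    and mult: "\<And>x \<kappa>. x \<in> S \<Longrightarrow> dim {u. hyp.shape x u = \<kappa> *\<^sub>R u} = \<mu> \<kappa>"
    and pos: "\<And>\<kappa>. \<kappa> \<in> {a, b, c} \<Longrightarrow> \<mu> \<kappa> \<noteq> 0" and x: "x \<in> S"
  shows "c_bitension G H f x = 0 \<longleftrightarrow> trace (matrix (hyp.shape x)) = 0"
proof -
  have ann: "hyp.annihilated a b c" by (rule hyp.annihilatedI) (rule eig)
  have "\<exists>u. u \<noteq> 0 \<and> hyp.shape x u = \<kappa> *\<^sub>R u" if "\<kappa> \<in> {a, b, c}" for \<kappa>
  proof -
    have "\<not> {u. hyp.shape x u = \<kappa> *\<^sub>R u} \<subseteq> {0}"
      using pos[OF that] mult[OF x, of \<kappa>] by (metis dim_eq_0)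
    then show ?thesis by blast
  qed
  note cartan = hyp.cartan_equal_multiplicities[OF ann ne x this]
  define k where "k = \<mu> a"
  have k: "\<mu> a = k" "\<mu> b = k" "\<mu> c = k"
    using cartan(3,4) by (simp_all add: k_def mult[OF x])
  have "k > 0" using pos[of a] k by simp
  note sym = cartan_symmetric_functions[OF ne(1) cartan(1,2)]
  have power: "trace (matrix (hyp.shape y ^^ j)) = real k * a ^ j + real k * b ^ j + real k * c ^ j"
    if "y \<in> S" for y j
    using hyp.trace_shape_power[OF that ne eig[OF that], where k = j] ne by (simp add: mult[OF that] k)
  have "hyp.shape y ^^ 0 = (\<lambda>u. u)" "hyp.shape y ^^ 1 = hyp.shape y"
    "hyp.shape y ^^ 2 = (\<lambda>u. hyp.shape y (hyp.shape y u))"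
    "hyp.shape y ^^ 3 = (\<lambda>u. hyp.shape y (hyp.shape y (hyp.shape y u)))" for y
    by (simp_all add: fun_eq_iff numeral_2_eq_2 numeral_3_eq_3)
  note funpow = this
  have "trace (matrix (\<lambda>u :: real^'m. u)) = real CARD('m)"
    by (simp add: trace_matrix axis_def)
  \<comment> \<open>The trace formula with exponent 0 counts the dimension, giving m = 3k.\<close>
  then have m: "real CARD('m) = real (k + k + k)"
    using power[OF x, of 0] unfolding funpow by simp
  have T: "trace (matrix (hyp.shape y)) = real k * a + real k * b + real k * c" if "y \<in> S" for y
    using power[OF that, of 1] unfolding funpow by simp
  have p2: "trace (matrix (\<lambda>u. hyp.shape y (hyp.shape y u))) = real k * a\<^sup>2 + real k * b\<^sup>2 + real k * c\<^sup>2"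
    if "y \<in> S" for y
    using power[OF that, of 2] unfolding funpow .
  have p3: "trace (matrix (\<lambda>u. hyp.shape x (hyp.shape x (hyp.shape x u)))) =
      real k * a ^ 3 + real k * b ^ 3 + real k * c ^ 3"
    using power[OF x, of 3] unfolding funpow .
  have "n x \<noteq> 0"
    using hyp.NN[OF x] N_eq[OF x] linear_0[OF linear_dparam[OF x]] by auto
  define t q\<^sub>2 q\<^sub>3 where "t = real k * a + real k * b + real k * c"
    and "q\<^sub>2 = real k * a\<^sup>2 + real k * b\<^sup>2 + real k * c\<^sup>2"
    and "q\<^sub>3 = real k * a ^ 3 + real k * b ^ 3 + real k * c ^ 3"
  let ?m = "real (k + k + k)"
  have "c_bitension G H f x = (t * (?m - q\<^sub>2) - 2 / 3 * (?m * (?m - 1) + t\<^sup>2 - q\<^sub>2) * t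
      + 2 * ((?m - 1) * t + t * q\<^sub>2 - q\<^sub>3)) *\<^sub>R n x"
    using c_bitension_eq[of t q\<^sub>2 x q\<^sub>3] T p2 p3 x unfolding Let_def m t_def q\<^sub>2_def q\<^sub>3_def by blast
  then show ?thesis
    using c_biharmonic_polynomial[OF sym \<open>k > 0\<close>] \<open>n x \<noteq> 0\<close> T[OF x]
    unfolding t_def q\<^sub>2_def q\<^sub>3_def by (simp only: scaleR_eq_0_iff simp_thms)
qed

theorem proposition4p3:
  fixes M :: "('p, 'm::finite) riem"
    and \<phi> :: "'p \<Rightarrow> 'a::euclidean_space"
    and \<xi> :: "('a, 'n::finite) chart \<Rightarrow> 'p \<Rightarrow> real^'n"
  assumes "DIM('a) = CARD('m) + 2" and "CARD('n) = CARD('m) + 1"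
    and "oriented_hypersurface M (round_sphere :: ('a, 'n) riem) \<phi> \<xi>"
    and "isoparametric M (round_sphere :: ('a, 'n) riem) \<phi> \<xi>"
    and "isoparametric_degree M (round_sphere :: ('a, 'n) riem) \<phi> \<xi> = 3"
  shows "c_biharmonic M (round_sphere :: ('a, 'n) riem) \<phi> \<longleftrightarrow>
         minimal_hypersurface M (round_sphere :: ('a, 'n) riem) \<phi> \<xi>"
proof -
  let ?N = "round_sphere :: ('a, 'n) riem"
  let ?A = "shape_operator M ?N \<phi> \<xi>"
  obtain \<mu> where \<mu>: "\<And>c d x \<kappa>. \<lbrakk>c \<in> atlas M; d \<in> atlas ?N; x \<in> local_dom c d \<phi>\<rbrakk> \<Longrightarrow>
      dim {u. ?A c d x u = \<kappa> *\<^sub>R u} = \<mu> \<kappa>"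
    using assms(4) unfolding isoparametric_def principal_multiplicity_def fun_eq_iff by blast
  obtain k1 k2 k3 where PC: "principal_curvatures M ?N \<phi> \<xi> = {k1, k2, k3}"
    and ne: "k1 \<noteq> k2" "k1 \<noteq> k3" "k2 \<noteq> k3"
    using assms(5) unfolding isoparametric_degree_def card_3_iff by blast
  \<comment> \<open>A principal curvature is by definition attained at some point of
    \<open>M\<close>. Its multiplicity there is nonzero, and since \<open>\<mu>\<close> does not
    depend on the point, it is a principal curvature everywhere.\<close>
  have pos: "\<mu> \<kappa> \<noteq> 0" if "\<kappa> \<in> {k1, k2, k3}" for \<kappa>
  proof -
    have "\<kappa> \<in> principal_curvatures M ?N \<phi> \<xi>" using that by (simp only: PC)
    then obtain c d x u where cdx: "c \<in> atlas M" "d \<in> atlas ?N" "x \<in> local_dom c d \<phi>"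
      and u: "u \<noteq> 0" "?A c d x u = \<kappa> *\<^sub>R u"
      unfolding principal_curvatures_def mem_Collect_eq by (elim bexE exE conjE)
    then have "\<not> {u. ?A c d x u = \<kappa> *\<^sub>R u} \<subseteq> {0}" by blast
    then show ?thesis unfolding \<mu>[OF cdx, symmetric] dim_eq_0 .
  qed
  \<comment> \<open>Both properties quantify over the same charts and points, so an equivalence at
    each point suffices.\<close>
  have "c_bitension (mcoeff M c) (mcoeff ?N d) (local_rep c d \<phi>) x = 0 \<longleftrightarrow>
      trace (matrix (?A c d x)) = 0"
    if c: "c \<in> atlas M" and d: "d \<in> atlas ?N" and x: "x \<in> local_dom c d \<phi>" for c d x
  proof -
    interpret charted_hypersurface "local_dom c d \<phi>" "\<lambda>x. param d (local_rep c d \<phi> x)" "mcoeff M c"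
      "\<lambda>x. D (param d) (local_rep c d \<phi> x) ((\<xi> d \<circ> param c) x)" "cdom d" "param d" "mcoeff ?N d"
      "local_rep c d \<phi>" "\<xi> d \<circ> param c"
      by (rule charted_hypersurface_local_rep[OF assms(1,3) c d])
    have A: "?A c d y = hyp.shape y" if "y \<in> local_dom c d \<phi>" for y
      by (rule ext) (simp add: shape_operator_def Let_def shape_operator_eq[OF that])
    have eig: "\<kappa> \<in> {k1, k2, k3}"
      if "y \<in> local_dom c d \<phi>" "u \<noteq> 0" "hyp.shape y u = \<kappa> *\<^sub>R u" for y u \<kappa>
      unfolding PC[symmetric] principal_curvatures_def using that c d A[OF that(1)]
      by (metis (mono_tags, lifting) mem_Collect_eq)
    have mult: "dim {u. hyp.shape y u = \<kappa> *\<^sub>R u} = \<mu> \<kappa>" if "y \<in> local_dom c d \<phi>" for y \<kappa>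
      using \<mu>[OF c d that, of \<kappa>] by (simp add: A[OF that])
    show ?thesis
      unfolding A[OF x] by (rule c_bitension_eq_0_iff[OF ne eig mult pos x])
  qed
  moreover have "smooth_map M ?N \<phi>"
    using assms(3) unfolding oriented_hypersurface_def isometric_immersion_def by blast
  ultimately show ?thesis
    unfolding c_biharmonic_def minimal_hypersurface_def by blast
qed

end
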